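(* Let $x,y\in\mathbb{C}\setminus\{0\}$ with $x,y\notin q^{\mathbb{Z}}$, and let $c,c_1,c_2\in\mathbb{C}\setminus\{0\}$ be such that $x/c,\,yc,\,x/c_1,\,yc_1,\,x/c_2,\,yc_2\notin q^{\mathbb{Z}}$. In each formula below assume that the theta functions in the denominators do not vanish. Then: (1) $l\widehat{\mu}(x,y)=l\widehat{\mu}(qx,y)-xy\,l\widehat{\mu}(x/q,y)$. (2) $l\widehat{\mu}(x,y)=l\widehat{\mu}(x/q,qy)=l\widehat{\mu}(y,x)$. (3) $\displaystyle l\widehat{\mu}(x,y)=\frac{iq^{-1/8}}{(qy,q)_\infty\theta(x)}\,{}_0\psi_2\left(\begin{matrix}-\\1/y,0\end{matrix};q;\frac xy\right)$. (4) $\displaystyle l\widehat{\mu}(x,y)=\frac{iq^{-1/8}}{(x,yq,q)_\infty\,\theta\!\left(\frac{x}{yq}\right)}\sum_{n\in\mathbb{Z}}\left(1-\frac xy q^{2n-1}\right)\frac{(x)_n}{(1/y)_n}\,q^{\frac52n(n-1)}\left(-\frac{x^2}{y^3q}\right)^n$. (5) $\displaystyle \lim_{y\to1}\theta(y)\,l\widehat{\mu}(x,y)=\frac{iq^{-1/8}}{\theta(qx)}\,{}_0\phi_1\left(\begin{matrix}-\\0\end{matrix};q;xq^2\right)$. (6) $$l\widehat{\mu}(x,y)=\frac{\theta(x/c_1)\theta(c_1y)\theta(c_2y/x)\theta(c_2)}{\theta(x)\theta(y)\theta(c_1c_2y/x)\theta(c_2/c_1)}\,l\widehat{\mu}(x/c_1,yc_1)+\frac{\theta(x/c_2)\theta(c_2y)\theta(c_1y/x)\theta(c_1)}{\theta(x)\theta(y)\theta(c_1c_2y/x)\theta(c_1/c_2)}\,l\widehat{\mu}(x/c_2,yc_2).$$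 (7) $$l\widehat{\mu}(x,y)=l\widehat{\mu}(x/c,yc)-\frac{iq^{-1/8}\theta(c)\theta(yc/x)}{\theta(xq)\theta(yq)\theta(c/x)\theta(yc)}\,{}_0\phi_1\left(\begin{matrix}-\\0\end{matrix};q;xyq^2\right).$$ (8) For every $n\in\mathbb{Z}$, $$l\widehat{\mu}(xq^{n-1},y)=l\widehat{\mu}(xq^{-1},y)\,T_{n-1}(xy,q)+l\widehat{\mu}(x,y)\,S_n(xy,q).$$
   Context: Let $i=\sqrt{-1}$, $\tau\in\mathbb{C}$ with $\mathrm{Im}(\tau)>0$, $q=e^{2\pi i\tau}$, $q^s=e^{2\pi i\tau s}$, $q^{\mathbb{Z}}=\{q^n:n\in\mathbb{Z}\}$. Set $(x)_\infty=\prod_{n\ge0}(1-xq^n)$, $(x)_n=(x)_\infty/(xq^n)_\infty$ for $n\in\mathbb{Z}$ (so $(0)_n=1$), $(a_1,\dots,a_r)_\beta=\prod_j(a_j)_\beta$ for $\beta\in\mathbb{Z}\cup\{\infty\}$, and $\theta(x)=(x,q/x)_\infty$. Series: ${}_r\phi_s\left(\begin{matrix}a_1,\dots,a_r\\ b_1,\dots,b_s\end{matrix};q;x\right)=\sum_{n\ge0}\frac{(a_1,\dots,a_r)_n}{(b_1,\dots,b_s,q)_n}\bigl((-1)^nq^{n(n-1)/2}\bigr)^{s-r+1}x^n$ and ${}_r\psi_s\left(\begin{matrix}a_1,\dots,a_r\\ b_1,\dots,b_s\end{matrix};q;x\right)=\sum_{n\in\mathbb{Z}}\frac{(a_1,\dots,a_r)_n}{(b_1,\dots,b_s)_n}\bigl((-1)^nq^{n(n-1)/2}\bigr)^{s-r}x^n$;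 "$-$" denotes an empty parameter list. The little $\mu$-function is, for nonzero $x,y\notin q^{\mathbb{Z}}$, $$l\widehat{\mu}(x,y)=\frac{iq^{-1/8}}{(x,q)_\infty\theta(qy)}\,{}_1\psi_2\left(\begin{matrix}x\\0,0\end{matrix};q;\frac1y\right).$$ The $q,t$-Fibonacci sequences $(S_n(t,q))_{n\in\mathbb{Z}}$ and $(T_{n-1}(t,q))_{n\in\mathbb{Z}}$ (for $t\ne0$) are the unique solutions $F_n=S_n$ and $F_n=T_{n-1}$ of $F_n(t,q)=F_{n-1}(t,q)+tq^{n-2}F_{n-2}(t,q)$ $(n\in\mathbb{Z})$ with initial values $F_0=S_0=0$, $F_1=S_1=1$ and $F_0=T_{-1}=1$, $F_1=T_0=0$ respectively. *)

theory Defs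
  imports "HOL-Analysis.Analysis"
begin

text \<open>The power \<open>q\<^sup>s = exp (2 \<pi> i \<tau> s)\<close> of the nome is taken with respect to \<open>\<tau>\<close>, since \<open>q\<close> alone
  does not determine \<open>q\<^sup>s\<close> for non-integral \<open>s\<close>.\<close>

definition qpow :: "complex \<Rightarrow> complex \<Rightarrow> complex" where
  "qpow \<tau> s = exp (2 * of_real pi * \<i> * \<tau> * s)"

definition q_ints :: "complex \<Rightarrow> complex set" where
  "q_ints q = range (\<lambda>n::int. q powi n)"

definition qpoch_inf :: "complex \<Rightarrow> complex \<Rightarrow> complex" where
  "qpoch_inf q x = (\<Prod>n. 1 - x * q ^ n)"

definition qpoch :: "complex \<Rightarrow> complex \<Rightarrow> int \<Rightarrow> complex" where
  "qpoch q x n = qpoch_inf q x / qpoch_inf q (x * q powi n)"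

definition qpochs_inf :: "complex \<Rightarrow> complex list \<Rightarrow> complex" where
  "qpochs_inf q as = (\<Prod>a\<leftarrow>as. qpoch_inf q a)"

definition qpochs :: "complex \<Rightarrow> complex list \<Rightarrow> int \<Rightarrow> complex" where
  "qpochs q as n = (\<Prod>a\<leftarrow>as. qpoch q a n)"

definition qtheta :: "complex \<Rightarrow> complex \<Rightarrow> complex" where
  "qtheta q x = qpochs_inf q [x, q / x]"

text \<open>The exponent \<open>n (n - 1) / 2\<close> is an integer, so the integer division below is exact.  The lists
  \<open>as\<close> and \<open>bs\<close> are the upper and lower parameters.\<close>

definition q_phi :: "complex \<Rightarrow> complex list \<Rightarrow> complex list \<Rightarrow> complex \<Rightarrow> complex" where
  "q_phi q as bs x =
     (\<Sum>n::nat. qpochs q as (int n) / qpochs q (bs @ [q]) (int n)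
        * ((-1) powi int n * q powi (int n * (int n - 1) div 2))
            powi (int (length bs) - int (length as) + 1)
        * x ^ n)"

text \<open>The bilateral series is an unordered (absolutely convergent) sum over all integers.\<close>

definition q_psi :: "complex \<Rightarrow> complex list \<Rightarrow> complex list \<Rightarrow> complex \<Rightarrow> complex" where
  "q_psi q as bs x =
     (\<Sum>\<^sub>\<infinity>n\<in>(UNIV::int set). qpochs q as n / qpochs q bs n
        * ((-1) powi n * q powi (n * (n - 1) div 2)) powi (int (length bs) - int (length as))
        * x powi n)"

definition little_mu :: "complex \<Rightarrow> complex \<Rightarrow> complex \<Rightarrow> complex" where
  "little_mu \<tau> x y =
     (let q = qpow \<tau> 1
      in \<i> * qpow \<tau> (-1/8) / (qpochs_inf q [x, q] * qtheta q (q * y)) * q_psi q [x] [0, 0] (1 / y))"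

definition qt_fib_rec :: "complex \<Rightarrow> complex \<Rightarrow> (int \<Rightarrow> complex) \<Rightarrow> bool" where
  "qt_fib_rec t q F \<longleftrightarrow> (\<forall>n. F n = F (n - 1) + t * q powi (n - 2) * F (n - 2))"

definition fib_S :: "int \<Rightarrow> complex \<Rightarrow> complex \<Rightarrow> complex" where
  "fib_S n t q = (THE S. qt_fib_rec t q S \<and> S 0 = 0 \<and> S 1 = 1) n"

text \<open>For \<open>T\<close> it is the shifted sequence \<open>F\<^sub>n = T\<^bsub>n-1\<^esub>\<close> that satisfies the recurrence.\<close>

definition fib_T :: "int \<Rightarrow> complex \<Rightarrow> complex \<Rightarrow> complex" where
  "fib_T n t q = (THE T. qt_fib_rec t q (\<lambda>n. T (n - 1)) \<and> T (-1) = 1 \<and> T 0 = 0) n"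

text \<open>Both definite descriptions are well-defined.\<close>

fun fib_up :: "complex \<Rightarrow> complex \<Rightarrow> complex \<Rightarrow> complex \<Rightarrow> nat \<Rightarrow> complex" where
  "fib_up t q a b 0 = a"
| "fib_up t q a b (Suc 0) = b"
| "fib_up t q a b (Suc (Suc n)) = fib_up t q a b (Suc n) + t * q ^ n * fib_up t q a b n"

fun fib_down :: "complex \<Rightarrow> complex \<Rightarrow> complex \<Rightarrow> complex \<Rightarrow> nat \<Rightarrow> complex" where
  "fib_down t q a b 0 = b"
| "fib_down t q a b (Suc 0) = a"
| "fib_down t q a b (Suc (Suc n)) =
     (fib_down t q a b n - fib_down t q a b (Suc n)) / (t * q powi (- int n - 1))"

lemma qt_fib_exists:
  assumes "t \<noteq> 0" "q \<noteq> 0"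
  shows "\<exists>F. qt_fib_rec t q F \<and> F 0 = a \<and> F 1 = b"
proof -
  define F where "F n = (if n \<ge> 0 then fib_up t q a b (nat n) else fib_down t q a b (nat (1 - n)))"
    for n
  have "F n = F (n - 1) + t * q powi (n - 2) * F (n - 2)" for n
  proof (cases "n \<ge> 2")
    case True
    define m where "m = nat (n - 2)"
    have n: "n = int m + 2" using True by (simp add: m_def)
    have e: "nat (int m + 2) = Suc (Suc m)" "nat (int m + 1) = Suc m" "nat (1 + int m) = Suc m" by auto
    show ?thesis unfolding n F_def by (simp add: e)
  next
    case False
    define m where "m = nat (1 - n)"
    have n: "n = 1 - int m" using False by (simp add: m_def)
    have F': "F (1 - int k) = fib_down t q a b k" for k
    proof (cases "k \<le> 1")
      case True
      then have "k = 0 \<or> k = 1" by auto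
      then show ?thesis by (auto simp: F_def)
    qed (auto simp: F_def)
    have idx: "1 - int m = n" "1 - int (Suc m) = n - 1" "1 - int (Suc (Suc m)) = n - 2"
      "- int m - 1 = n - 2"
      using n by simp_all
    have "F n = fib_down t q a b m" "F (n - 1) = fib_down t q a b (Suc m)"
      "F (n - 2) = (fib_down t q a b m - fib_down t q a b (Suc m)) / (t * q powi (n - 2))"
      using F'[of m, unfolded idx] F'[of "Suc m", unfolded idx]
        F'[of "Suc (Suc m)", unfolded idx fib_down.simps(3)] by simp_all
    moreover have "t * q powi (n - 2) \<noteq> 0" using assms by simp
    ultimately show ?thesis by simp
  qed
  then have "qt_fib_rec t q F" unfolding qt_fib_rec_def by blast
  moreover have "F 0 = a" "F 1 = b" by (simp_all add: F_def)
  ultimately show ?thesis by blast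
qed

lemma qt_fib_unique:
  assumes "t \<noteq> 0" "q \<noteq> 0"
    and F: "qt_fib_rec t q F" "F 0 = a" "F 1 = b"
    and G: "qt_fib_rec t q G" "G 0 = a" "G 1 = b"
  shows "F = G"
proof
  fix n :: int
  have up: "F (int m) = G (int m) \<and> F (int m + 1) = G (int m + 1)" for m
  proof (induction m)
    case (Suc m)
    have "F (int m + 2) = F (int m + 1) + t * q powi int m * F (int m)"
      "G (int m + 2) = G (int m + 1) + t * q powi int m * G (int m)"
      using F(1)[unfolded qt_fib_rec_def, rule_format, of "int m + 2"]
        G(1)[unfolded qt_fib_rec_def, rule_format, of "int m + 2"] by (simp_all add: algebra_simps)
    with Suc show ?case by (simp add: add.commute)
  qed (use F G in simp)
  have down: "F (- int m) = G (- int m) \<and> F (1 - int m) = G (1 - int m)" for m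
  proof (induction m)
    case (Suc m)
    have e: "1 - int m - 1 = - int m" "1 - int m - 2 = - int m - 1" by simp_all
    have rec: "H (1 - int m) = H (- int m) + t * q powi (- int m - 1) * H (- int m - 1)"
      if "qt_fib_rec t q H" for H
      using that[unfolded qt_fib_rec_def, rule_format, of "1 - int m"] unfolding e .
    have "t * q powi (- int m - 1) * F (- int m - 1) = t * q powi (- int m - 1) * G (- int m - 1)"
      using rec[OF F(1)] rec[OF G(1)] Suc by (metis add_left_cancel)
    moreover have "t * q powi (- int m - 1) \<noteq> 0" using assms by simp
    ultimately have "F (- int m - 1) = G (- int m - 1)" by (metis mult_left_cancel)
    moreover have "- int (Suc m) = - int m - 1" "1 - int (Suc m) = - int m" by simp_all
    ultimately show ?case using Suc by (simp only: simp_thms)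
  qed (use F G in simp)
  show "F n = G n"
    using up[of "nat n"] down[of "nat (- n)"] by (cases "n \<ge> 0") auto
qed

lemma fib_S_ex1:
  assumes "t \<noteq> 0" "q \<noteq> 0"
  shows "\<exists>!S. qt_fib_rec t q S \<and> S 0 = 0 \<and> S 1 = 1"
proof (rule ex_ex1I)
  show "\<exists>S. qt_fib_rec t q S \<and> S 0 = 0 \<and> S 1 = 1" by (rule qt_fib_exists[OF assms])
qed (elim conjE, rule qt_fib_unique[OF assms])

lemma fib_T_ex1:
  assumes "t \<noteq> 0" "q \<noteq> 0"
  shows "\<exists>!T. qt_fib_rec t q (\<lambda>n. T (n - 1)) \<and> T (-1) = 1 \<and> T 0 = 0"
proof -
  obtain F where F: "qt_fib_rec t q F" "F 0 = 1" "F 1 = 0"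
    using qt_fib_exists[OF assms] by blast
  show ?thesis
  proof (rule ex1I[of _ "\<lambda>n. F (n + 1)"])
    fix T assume T: "qt_fib_rec t q (\<lambda>n. T (n - 1)) \<and> T (-1) = 1 \<and> T 0 = 0"
    have "(\<lambda>n. T (n - 1)) = F"
      by (rule qt_fib_unique[OF assms, where a = 1 and b = 0]) (use T F in auto)
    then have "T (n + 1 - 1) = F (n + 1)" for n by metis
    then show "T = (\<lambda>n. F (n + 1))" by auto
  qed (use F in auto)
qed

end

theory Submission
  imports Defs
begin

text \<open>Fix \<open>\<bar>q\<bar> < 1\<close>. All eight statements are read off from the double theta series
  \<open>N(x, y) = \<Sum>\<^bsub>n,m\<^esub> (-1)\<^bsup>n+m\<^esup> q\<^bsup>n(n-1)/2 + m(m-1)/2\<^esup> x\<^sup>n y\<^bsup>-m\<^esup> / (q; q)\<^bsub>m-n\<^esub>\<close>, called \<open>theta_pair\<close>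
  below, where terms with \<open>m < n\<close> vanish. Summing over \<open>n\<close> first, by Euler's expansion of
  \<open>(z; q)\<^sub>\<infinity>\<close>, gives the \<open>\<^sub>1\<psi>\<^sub>2\<close> series of the definition up to theta functions; summing over \<open>m\<close>
  first gives the \<open>\<^sub>0\<psi>\<^sub>2\<close> series. Hence the little mu function is
  \<open>- i q\<^bsup>-1/8\<^esup> y N(x, y) / ((q; q)\<^sub>\<infinity> \<theta>(x) \<theta>(y))\<close> (\<open>little_mu_eq\<close>), and the second series is
  another representation of it. Reindexing the double series gives the symmetry
  (\<open>theta_pair_commute\<close>) and the invariance under \<open>(x, y) \<mapsto> (x / q, q y)\<close> (\<open>theta_pair_q_shift\<close>).
  The recursion of \<open>1 / (q; q)\<^sub>k\<close> gives the contiguous relation (\<open>theta_pair_contiguous\<close>), whose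
  iteration in \<open>x\<close> is the Fibonacci recurrence.

  For the relations between different points with the same product \<open>x y\<close>, put \<open>x = p s\<close> and
  \<open>y = p / s\<close>. Collecting the terms with \<open>m - n = k\<close> gives
  \<open>N(p s, p / s) = \<Sum>\<^bsub>k\<^esub> (-1/p)\<^sup>k L\<^sub>k(s) / (q; q)\<^sub>k\<close>, where \<open>L\<^sub>k\<close> is \<open>theta_corr k\<close>, and a shift of
  indices shows \<open>L\<^bsub>k+2\<^esub> = q\<^bsup>k+1\<^esup> L\<^sub>k\<close>. For fixed \<open>p\<close> the series is therefore a combination of the
  two functions \<open>L\<^sub>0\<close> and \<open>L\<^sub>1\<close>, so any three of its values satisfy a linear relation, with the
  minors \<open>L\<^sub>0(s) L\<^sub>1(t) - L\<^sub>1(s) L\<^sub>0(t)\<close> as coefficients. By the Jacobi triple product such a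
  minor equals \<open>t (q; q)\<^sub>\<infinity>\<^sup>2 \<theta>(s / t) \<theta>(s t)\<close> (\<open>casoratian_eq_theta\<close>). This is the relation
  between \<open>l\<mu>(x, y)\<close>, \<open>l\<mu>(x / c\<^sub>1, y c\<^sub>1)\<close> and \<open>l\<mu>(x / c\<^sub>2, y c\<^sub>2)\<close>. At \<open>y = 1\<close> the series \<open>N\<close>
  reduces to a \<open>\<^sub>0\<phi>\<^sub>1\<close> series (\<open>theta_pair_at_1\<close>); this value gives the limit \<open>y \<rightarrow> 1\<close> by
  continuity, and, as the third point of the relation, the translation formula.

  It remains to compare \<open>N\<close> with the very-well-poised series. That series, as a function of
  \<open>z = - 1 / p\<close> for fixed \<open>s\<close>, is an entire power series. A telescoping identity
  (\<open>telescoper_identity\<close>) yields a q-difference equation in \<open>z\<close>, which says that its coefficients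
  satisfy the same two-step recursion as \<open>L\<^sub>k(s) / (q; q)\<^sub>k\<close>. Its first two coefficients are
  instances of the quintuple product (\<open>quintuple_product\<close>) and equal those of \<open>N\<close> times
  \<open>\<theta>(s\<^sup>2 / q) = \<theta>(x / (q y))\<close>. So the very-well-poised series is \<open>\<theta>(x / (q y)) N(x, y)\<close>
  (\<open>vwp_sum_eq_theta_pair\<close>), up to the factor that normalises its q-shifted factorials
  (\<open>very_well_poised_sum\<close>).\<close>

section \<open>Unordered sums and power series\<close>

lemma has_sum_times:
  fixes f :: "'a \<Rightarrow> complex" and g :: "'b \<Rightarrow> complex"
  assumes f: "(f has_sum a) UNIV" and g: "(g has_sum b) UNIV"
  shows "((\<lambda>(i, j). f i * g j) has_sum a * b) UNIV"
proof -
  have sf: "(\<lambda>i. norm (f i)) summable_on UNIV" and sg: "(\<lambda>j. norm (g j)) summable_on UNIV"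
    using f g summable_on_iff_abs_summable_on_complex has_sum_imp_summable by blast+
  have "(\<lambda>p. norm (case p of (i, j) \<Rightarrow> f i * g j)) summable_on (UNIV \<times> UNIV)"
    unfolding Infinite_Sum.abs_summable_on_Sigma_iff
    using sf sg by (auto simp: norm_mult abs_mult infsum_cmult_right' infsum_nonneg
        intro!: summable_on_cmult_right summable_on_cmult_left)
  then have "(\<lambda>(i, j). f i * g j) summable_on (UNIV \<times> UNIV)"
    using summable_on_iff_abs_summable_on_complex by blast
  moreover have "((\<lambda>j. f i * g j) has_sum f i * b) UNIV" for i
    by (rule has_sum_cmult_right[OF g])
  moreover have "((\<lambda>i. f i * b) has_sum a * b) UNIV"
    by (rule has_sum_cmult_left[OF f])
  ultimately have "((\<lambda>(i, j). f i * g j) has_sum a * b) (UNIV \<times> UNIV)"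
    by (intro has_sum_SigmaI[where g = "\<lambda>i. f i * b"]) auto
  then show ?thesis by simp
qed

lemma summable_on_times:
  fixes f :: "'a \<Rightarrow> complex" and g :: "'b \<Rightarrow> complex"
  assumes "f summable_on UNIV" and "g summable_on UNIV"
  shows "(\<lambda>(i, j). f i * g j) summable_on UNIV"
  using has_sum_times[OF assms[THEN has_sum_infsum]] has_sum_imp_summable by blast

lemma summable_on_bounded_factor:
  fixes f g :: "'a \<Rightarrow> complex"
  assumes "f summable_on A" and "\<And>x. x \<in> A \<Longrightarrow> norm (g x) \<le> C"
  shows "(\<lambda>x. f x * g x) summable_on A"
proof -
  have "(\<lambda>x. C * norm (f x)) summable_on A"
    using assms(1) by (intro summable_on_cmult_right)
        (simp add: summable_on_iff_abs_summable_on_complex)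
  then have "(\<lambda>x. norm (f x * g x)) summable_on A"
    by (rule Infinite_Sum.abs_summable_on_comparison_test')
      (use assms(2) in \<open>auto simp: norm_mult mult.commute[of C] intro!: mult_left_mono\<close>)
  then show ?thesis using summable_on_iff_abs_summable_on_complex by blast
qed

lemma has_sum_int_iff_nat:
  fixes f :: "int \<Rightarrow> complex"
  assumes "\<And>k. k < 0 \<Longrightarrow> f k = 0"
  shows "(f has_sum a) UNIV \<longleftrightarrow> ((\<lambda>k::nat. f (int k)) has_sum a) UNIV"
proof -
  have "(f has_sum a) UNIV \<longleftrightarrow> (f has_sum a) (range int)"
  proof (rule has_sum_cong_neutral)
    fix k assume "k \<in> UNIV - range int"
    then show "f k = 0" by (intro assms) (metis DiffD2 nat_0_le not_le rangeI)
  qed auto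
  then show ?thesis by (simp add: has_sum_reindex o_def)
qed

lemma summable_on_int_iff_nat:
  fixes f :: "int \<Rightarrow> complex"
  assumes "\<And>k. k < 0 \<Longrightarrow> f k = 0"
  shows "f summable_on UNIV \<longleftrightarrow> (\<lambda>k::nat. f (int k)) summable_on UNIV"
  using has_sum_int_iff_nat[of f, OF assms] unfolding summable_on_def by blast

lemma has_sum_diff:
  fixes f g :: "'a \<Rightarrow> complex"
  assumes "(f has_sum a) A" and "(g has_sum b) A"
  shows "((\<lambda>x. f x - g x) has_sum a - b) A"
  using has_sum_add[OF assms(1) has_sum_uminusI[OF assms(2)]] by simp

lemma has_sum_shift:
  fixes f :: "int \<Rightarrow> complex"
  shows "((\<lambda>k. f (k + m)) has_sum a) UNIV \<longleftrightarrow> (f has_sum a) UNIV"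
  by (rule has_sum_reindex_bij_witness[of _ "\<lambda>k. k - m" "\<lambda>k. k + m"]) auto

text \<open>The lattice of pairs with even coordinate sum is the image of the rotation
  \<open>(m, n) \<mapsto> (m - n, m + n)\<close>; the complementary coset is treated below. Splitting a double theta
  series along the two cosets turns a product of theta functions of \<open>s / t\<close> and \<open>s t\<close> into
  products of theta functions of \<open>s\<close> and of \<open>t\<close> alone.\<close>

lemma has_sum_even_pairs:
  fixes g :: "int \<times> int \<Rightarrow> complex"
  shows "(g has_sum S) {(i, j). even (i + j)} \<longleftrightarrow> ((\<lambda>(m, n). g (m - n, m + n)) has_sum S) UNIV"
proof -
  have "{(i, j). even (i + j)} = range (\<lambda>(m, n). (m - n, m + n :: int))"
  proof (safe elim!: evenE)
    fix i j k :: int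
    assume "i + j = 2 * k"
    then show "(i, j) \<in> range (\<lambda>(m, n). (m - n, m + n))"
      by (intro image_eqI[of _ _ "(k, k - i)"]) auto
  qed auto
  then show ?thesis
    by (simp add: has_sum_reindex inj_on_def o_def case_prod_unfold)
qed

lemma has_sum_odd_pairs:
  fixes g :: "int \<times> int \<Rightarrow> complex"
  shows "(g has_sum S) {(i, j). odd (i + j)} \<longleftrightarrow> ((\<lambda>(m, n). g (m - n + 1, m + n)) has_sum S) UNIV"
proof -
  have "{(i, j). odd (i + j)} = range (\<lambda>(m, n). (m - n + 1, m + n :: int))"
  proof (safe elim!: oddE)
    fix i j k :: int
    assume "i + j = 2 * k + 1"
    then show "(i, j) \<in> range (\<lambda>(m, n). (m - n + 1, m + n))"
      by (intro image_eqI[of _ _ "(k, k - i + 1)"]) auto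
  qed auto
  then show ?thesis
    by (simp add: has_sum_reindex inj_on_def o_def case_prod_unfold)
qed

text \<open>The substitution \<open>m = k + 2 * i\<close>, \<open>n = i + \<rho> - k\<close> turns \<open>m\<^sup>2 / 2 + n\<^sup>2\<close> into a sum of a
  multiple of \<open>i\<^sup>2\<close>, a multiple of \<open>k\<^sup>2\<close> and linear terms. This is the leading part of the
  exponent in a product of two theta series in bases \<open>q\<close> and \<open>q\<^sup>2\<close>, whose double sum therefore
  factors on each class.\<close>

lemma has_sum_mod_3_class:
  fixes g :: "int \<times> int \<Rightarrow> complex" and \<rho> :: int
  assumes "0 \<le> \<rho>" "\<rho> < 3"
  shows "(g has_sum S) {(m, n). (m + n) mod 3 = \<rho>}
      \<longleftrightarrow> ((\<lambda>(i, k). g (k + 2 * i, i + \<rho> - k)) has_sum S) UNIV"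
proof -
  have "{(m, n). (m + n) mod 3 = \<rho>} = range (\<lambda>(i, k). (k + 2 * i, i + \<rho> - k))"
  proof (intro set_eqI iffI)
    fix p assume "p \<in> {(m, n). (m + n) mod 3 = \<rho>}"
    then obtain m n where p: "p = (m, n)" "(m + n) mod 3 = \<rho>" by auto
    define i where "i = (m + n) div 3"
    have "m + n = 3 * i + \<rho>" using p(2) div_mult_mod_eq[of "m + n" 3] by (simp add: i_def)
    then show "p \<in> range (\<lambda>(i, k). (k + 2 * i, i + \<rho> - k))"
      by (intro image_eqI[of _ _ "(i, m - 2 * i)"]) (auto simp: p(1))
  next
    fix p assume "p \<in> range (\<lambda>(i, k). (k + 2 * i, i + \<rho> - k))"
    then obtain i k where p: "p = (k + 2 * i, i + \<rho> - k)" by auto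
    have "k + 2 * i + (i + \<rho> - k) = \<rho> + i * 3" by simp
    then show "p \<in> {(m, n). (m + n) mod 3 = \<rho>}" using assms unfolding p
        by (simp only: mem_Collect_eq prod.case mod_mult_self1 mod_pos_pos_trivial)
  qed
  moreover have "inj (\<lambda>(i, k). (k + 2 * i, i + \<rho> - k))" by (auto simp: inj_on_def)
  ultimately show ?thesis by (simp add: has_sum_reindex o_def case_prod_unfold)
qed

text \<open>After division by \<open>z ^ j\<close> a series whose coefficients below \<open>j\<close> vanish tends to its
  coefficient \<open>j\<close> at the origin.\<close>

lemma power_series_zero_imp_coeff_zero:
  fixes a :: "nat \<Rightarrow> complex"
  assumes "\<And>z. z \<noteq> 0 \<Longrightarrow> (\<lambda>j. a j * z ^ j) sums 0"
  shows "a j = 0"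
proof (induction j rule: less_induct)
  case (less j)
  have "(\<lambda>i. a (i + j) * z ^ i) sums 0" if z: "z \<noteq> 0" for z
  proof -
    have "(\<lambda>i. a (i + j) * z ^ (i + j)) sums 0"
      using assms[OF z] less by (subst sums_iff_shift) simp
    then have "(\<lambda>i. z ^ j * (a (i + j) * z ^ i)) sums (z ^ j * 0)"
      by (simp add: power_add mult_ac)
    then show ?thesis using z by (subst (asm) sums_mult_iff) auto
  qed
  then have "((\<lambda>_. 0) \<longlongrightarrow> a (0 + j)) (at (0::complex))"
    by (intro powser_limit_0_strong[where s = 1]) auto
  then show "a j = 0" by (simp add: tendsto_const_iff)
qed

lemma has_sum_suminf:
  fixes f :: "nat \<Rightarrow> complex"
  assumes "f summable_on UNIV"
  shows "(f has_sum suminf f) UNIV"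
  using has_sum_infsum[OF assms]
      has_sum_imp_sums[OF has_sum_infsum[OF assms]] by (simp add: sums_iff)

text \<open>Splitting at exponent zero leaves an entire power series in \<open>y\<close> and one in \<open>1 / y\<close>.\<close>

lemma bilateral_Laurent_isCont:
  fixes a :: "int \<Rightarrow> complex"
  assumes f: "\<And>y. y \<noteq> 0 \<Longrightarrow> ((\<lambda>n. a n * y powi n) has_sum f y) UNIV" and y: "y0 \<noteq> 0"
  shows "isCont f y0"
proof -
  have sm: "(\<lambda>n. a n * y powi n) summable_on A" if "y \<noteq> 0" for y A
    using has_sum_imp_summable[OF f[OF that]] by (rule summable_on_subset) auto
  have pos: "summable (\<lambda>n. a (int n) * y ^ n)" and neg: "summable (\<lambda>n. a (- int n - 1) * y ^ n)"
      if "y \<noteq> 0" for y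
  proof -
    have "(\<lambda>n. a (int n) * y ^ n) summable_on UNIV"
      using sm[OF that, of "range int"] by (subst (asm) summable_on_reindex) (auto simp: o_def)
    then show "summable (\<lambda>n. a (int n) * y ^ n)" by (rule summable_on_imp_summable)
    have "1 / y \<noteq> 0" using that by simp
    from sm[OF this, of "range (\<lambda>n. - int n - 1)"]
    have "(\<lambda>n. a (- int n - 1) * (1 / y) powi (- int n - 1)) summable_on UNIV"
      by (subst (asm) summable_on_reindex) (auto simp: o_def inj_on_def)
    then have "(\<lambda>n. 1 / y * (a (- int n - 1) * (1 / y) powi (- int n - 1))) summable_on UNIV"
      by (rule summable_on_cmult_right)
    then have "(\<lambda>n. a (- int n - 1) * y ^ n) summable_on UNIV"
      using that by (simp add: power_int_diff power_int_minus power_int_divide_distrib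
          field_simps)
    then show "summable (\<lambda>n. a (- int n - 1) * y ^ n)" by (rule summable_on_imp_summable)
  qed
  have split: "f y = (\<Sum>n. a (int n) * y ^ n) + 1 / y * (\<Sum>n. a (- int n - 1) * (1 / y) ^ n)" if
      "y \<noteq> 0" for y
  proof -
    have cover: "range int \<union> range (\<lambda>n. - int n - 1) = UNIV"
      by (auto simp: image_iff) (metis int_cases uminus_add_conv_diff of_nat_Suc
          minus_add_distrib)
    have "((\<lambda>n. a n * y powi n) has_sum (\<Sum>n. a (int n) * y ^ n)) (range int)"
    proof -
      have "(\<lambda>n. a (int n) * y ^ n) summable_on UNIV"
        using sm[OF that, of "range int"] by (subst (asm) summable_on_reindex) (auto simp: o_def)
      then have "((\<lambda>n. a (int n) * y ^ n) has_sum (\<Sum>n. a (int n) * y ^ n)) UNIV"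
        by (rule has_sum_suminf)
      then show ?thesis by (subst has_sum_reindex) (auto simp: o_def)
    qed
    moreover have "((\<lambda>n. a n * y powi n)
        has_sum 1 / y * (\<Sum>n. a (- int n - 1) * (1 / y) ^ n)) (range (\<lambda>n. - int n - 1))"
    proof -
      have "(\<lambda>n. a (- int n - 1) * y powi (- int n - 1)) summable_on UNIV"
        using sm[OF that, of "range (\<lambda>n. - int n - 1)"]
        by (subst (asm) summable_on_reindex) (auto simp: o_def inj_on_def)
      moreover have e: "a (- int n - 1) * y powi (- int n - 1)
          = 1 / y * (a (- int n - 1) * (1 / y) ^ n)" for n
        using that by (simp add: power_int_diff power_int_minus power_divide field_simps)
      ultimately have "(\<lambda>n. 1 / y * (a (- int n - 1) * (1 / y) ^ n)) summable_on UNIV" by simp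
      then have "((\<lambda>n. 1 / y * (a (- int n - 1) * (1 / y) ^ n))
          has_sum (\<Sum>n. 1 / y * (a (- int n - 1) * (1 / y) ^ n))) UNIV"
        by (rule has_sum_suminf)
      moreover have "(\<Sum>n. 1 / y * (a (- int n - 1) * (1 / y) ^ n))
          = 1 / y * (\<Sum>n. a (- int n - 1) * (1 / y) ^ n)"
        using that by (intro suminf_mult neg) simp
      ultimately have "((\<lambda>n. a (- int n - 1) * y powi (- int n - 1))
          has_sum 1 / y * (\<Sum>n. a (- int n - 1) * (1 / y) ^ n)) UNIV"
        unfolding e by (simp only:)
      then show ?thesis by (subst has_sum_reindex) (auto simp: o_def inj_on_def)
    qed
    ultimately have "((\<lambda>n. a n * y powi n)
        has_sum (\<Sum>n. a (int n) * y ^ n) + 1 / y * (\<Sum>n. a (- int n - 1) * (1 / y) ^ n))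
      (range int \<union> range (\<lambda>n. - int n - 1))"
      by (rule has_sum_Un_disjoint) auto
    with f[OF that] show ?thesis unfolding cover by (rule has_sum_unique)
  qed
  have summ: "summable (\<lambda>n. c n * y ^ n)" if "\<And>y::complex. y \<noteq> 0 \<Longrightarrow> summable (\<lambda>n. c n * y ^ n)"
      for c y
    using that[of y] summable_finite[of "{0}" "\<lambda>n. c n * y ^ n"] by (cases "y = 0") auto
  have P: "isCont (\<lambda>y. \<Sum>n. a (int n) * y ^ n) y0" for y0
    by (rule isCont_powser_converges_everywhere) (rule summ[OF pos])
  have R: "isCont (\<lambda>y. \<Sum>n. a (- int n - 1) * y ^ n) y0" for y0
    by (rule isCont_powser_converges_everywhere) (rule summ[OF neg])
  have "isCont (\<lambda>y. (\<Sum>n. a (int n) * y ^ n) + 1 / y * (\<Sum>n. a (- int n - 1) * (1 / y) ^ n)) y0"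
  proof -
    have inv: "isCont (\<lambda>y. 1 / y) y0"
      using y by (intro continuous_intros) auto
    have "isCont (\<lambda>y. \<Sum>n. a (- int n - 1) * (1 / y) ^ n) y0"
      by (rule isCont_o2[OF inv, where g = "\<lambda>y. \<Sum>n. a (- int n - 1) * y ^ n"]) (rule R)
    then show ?thesis using P inv by (intro isCont_add isCont_mult)
  qed
  moreover have "eventually (\<lambda>y. (\<Sum>n. a (int n) * y ^ n) + 1 / y
      * (\<Sum>n. a (- int n - 1) * (1 / y) ^ n) = f y) (nhds y0)"
    using t1_space_nhds[OF y] by (rule eventually_mono) (simp add: split)
  ultimately show ?thesis by (simp add: isCont_cong)
qed

section \<open>Integer powers and triangular exponents\<close>

lemma minus_powi: "(- z) powi n = (-1) powi n * (z::complex) powi n"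
  using power_int_mult_distrib[of "-1" z n] by simp

lemma powi_double: "(z::complex) powi (2 * m) = z powi m * z powi m"
  by (simp add: power_int_mult power2_eq_square power_int_mult_distrib)

lemma minus_one_powi_square: "(-1) powi n * (-1) powi n = (1::complex)"
  by (metis power_int_mult_distrib mult_minus1 minus_minus power_int_1_left)

text \<open>The exponent \<open>n (n - 1) / 2\<close> of a theta series, as an integer; being quadratic, it splits
  under addition with the cross term \<open>m n\<close>, which is what every rearrangement below uses.\<close>

definition tri :: "int \<Rightarrow> int" where
  "tri n = n * (n - 1) div 2"

lemma two_tri: "2 * tri n = n * (n - 1)"
  unfolding tri_def by (rule dvd_mult_div_cancel) simp

lemma tri_add: "tri (m + n) = tri m + tri n + m * n"
  using two_tri[of "m + n"] two_tri[of m] two_tri[of n] by (simp add: algebra_simps)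

lemma tri_uminus: "tri (- n) = tri n + n"
  using two_tri[of "- n"] two_tri[of n] by (simp add: algebra_simps)

lemma tri_diff: "tri (m - n) = tri m + tri n + n - m * n"
  using tri_add[of m "- n"] by (simp add: tri_uminus)

lemma tri_simps [simp]: "tri 0 = 0" "tri 1 = 0" "tri 2 = 1"
  by (simp_all add: tri_def)

lemma tri_nonneg: "tri n \<ge> 0"
proof -
  have "n * (n - 1) \<ge> 0" by (cases "n \<ge> 1") (auto intro: mult_nonneg_nonneg mult_nonpos_nonpos)
  then show ?thesis using two_tri[of n] by linarith
qed

lemma qpow_of_int: "qpow \<tau> (of_int n) = qpow \<tau> 1 powi n"
  by (simp add: qpow_def exp_power_int mult_ac)

lemma qpow_eq_powi_tri: "qpow \<tau> (5 / 2 * of_int n * (of_int n - 1)) = qpow \<tau> 1 powi (5 * tri n)"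
proof -
  have "(2 :: complex) * of_int (tri n) = of_int n * (of_int n - 1)"
    using arg_cong[OF two_tri[of n], of "of_int :: int \<Rightarrow> complex"] by simp
  then have "5 / 2 * of_int n * (of_int n - 1) = (of_int (5 * tri n) :: complex)"
    by simp
  then show ?thesis by (simp only: qpow_of_int)
qed

section \<open>Infinite products and theta functions of nome q\<close>

locale nome =
  fixes q :: complex
  assumes q_nonzero [simp]: "q \<noteq> 0" and norm_q: "norm q < 1"
begin

abbreviation "pinf \<equiv> qpoch_inf q"
abbreviation "theta \<equiv> qtheta q"

lemma q_add: "q powi (m + n) = q powi m * q powi n"
  by (simp add: power_int_add)

lemma norm_mult_q_pow_less_1: "norm z < 1 \<Longrightarrow> norm (z * q ^ n) < 1"
proof -
  assume z: "norm z < 1"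
  have "norm z * norm q ^ n \<le> norm z * 1"
    by (intro mult_left_mono power_le_one) (use norm_q in auto)
  then show ?thesis using z by (simp add: norm_mult norm_power)
qed

lemma q_pow_neq_1: "n > 0 \<Longrightarrow> q ^ n \<noteq> 1"
  by (metis norm_one norm_power norm_q norm_ge_zero order_less_irrefl power_less_one_iff)

lemma q_powi_neq_1: "n \<noteq> 0 \<Longrightarrow> q powi n \<noteq> 1"
proof -
  assume "n \<noteq> 0"
  then consider "n = int (nat n)" "nat n > 0" | "n = - int (nat (- n))" "nat (- n) > 0"
      by linarith
  then show ?thesis
    by cases (metis power_int_of_nat q_pow_neq_1, metis inverse_eq_1_iff power_int_minus
        power_int_of_nat q_pow_neq_1)
qed

lemma convergent_pinf: "convergent_prod (\<lambda>n. 1 - x * q ^ n)"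
proof -
  have "summable (\<lambda>n. norm x * norm q ^ n)"
    using norm_q by (intro summable_mult summable_geometric) auto
  then have "abs_convergent_prod (\<lambda>n. 1 - x * q ^ n)"
    unfolding abs_convergent_prod_conv_summable by (simp add: norm_mult norm_power)
  then show ?thesis by (rule abs_convergent_prod_imp_convergent_prod)
qed

lemma pinf_LIMSEQ: "(\<lambda>n. \<Prod>k<n. 1 - x * q ^ k) \<longlonglongrightarrow> pinf x"
  unfolding qpoch_inf_def
  by (rule has_prod_imp_tendsto'[OF convergent_prod_has_prod[OF convergent_pinf]])

lemma pinf_0 [simp]: "pinf 0 = 1"
  by (simp add: qpoch_inf_def)

lemma pinf_rec: "pinf x = (1 - x) * pinf (q * x)"
proof -
  have "(\<Prod>k<Suc n. 1 - x * q ^ k) = (1 - x) * (\<Prod>k<n. 1 - q * x * q ^ k)" for n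
    by (subst prod.lessThan_Suc_shift) (simp add: mult_ac)
  then have "(\<lambda>n. \<Prod>k<Suc n. 1 - x * q ^ k) \<longlonglongrightarrow> (1 - x) * pinf (q * x)"
    by (simp only:) (intro tendsto_intros pinf_LIMSEQ)
  with pinf_LIMSEQ[of x, THEN LIMSEQ_Suc] show ?thesis
    by (rule LIMSEQ_unique)
qed

lemma pinf_eq_0: "pinf x = 0 \<Longrightarrow> \<exists>n. x * q ^ n = 1"
  using prodinf_nonzero[OF convergent_pinf[of x]] unfolding qpoch_inf_def by fastforce

lemma pinf_q_nonzero [simp]: "pinf q \<noteq> 0"
proof
  assume "pinf q = 0"
  from pinf_eq_0[OF this] obtain n where "q ^ Suc n = 1" by auto
  then show False using q_pow_neq_1[of "Suc n"] by simp
qed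

lemma pinf_nonzero: "x \<notin> q_ints q \<Longrightarrow> pinf x \<noteq> 0"
proof
  assume x: "x \<notin> q_ints q" and "pinf x = 0"
  from pinf_eq_0[OF this(2)] obtain n where "x * q ^ n = 1" by auto
  then have "x = q powi (- int n)" by (simp add: power_int_minus field_simps)
  with x show False unfolding q_ints_def by blast
qed

lemma q_ints_mult: "x \<notin> q_ints q \<Longrightarrow> x * q powi n \<notin> q_ints q"
proof
  assume x: "x \<notin> q_ints q" and "x * q powi n \<in> q_ints q"
  then obtain m where "x * q powi n = q powi m" by (auto simp: q_ints_def)
  then have "x = q powi (m - n)" by (simp add: power_int_diff field_simps)
  with x show False by (auto simp: q_ints_def)
qed

lemma q_ints_inverse: "x \<notin> q_ints q \<Longrightarrow> 1 / x \<notin> q_ints q"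
proof
  assume x: "x \<notin> q_ints q" and "1 / x \<in> q_ints q"
  then obtain m where "1 / x = q powi m" by (auto simp: q_ints_def)
  then have "x = q powi (- m)" by (metis power_int_minus inverse_eq_divide inverse_inverse_eq)
  with x show False by (auto simp: q_ints_def)
qed

lemma theta_eq_pinf: "theta x = pinf x * pinf (q / x)"
  by (simp add: qtheta_def qpochs_inf_def)

lemma theta_q_mult: "x \<noteq> 0 \<Longrightarrow> theta (q * x) = - theta x / x"
proof -
  assume x: "x \<noteq> 0"
  have *: "pinf x = (1 - x) * pinf (q * x)" "pinf (1 / x) = (1 - 1 / x) * pinf (q / x)"
    using pinf_rec[of x] pinf_rec[of "1 / x"] by simp_all
  have "theta (q * x) = pinf (q * x) * pinf (1 / x)" by (simp add: theta_eq_pinf)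
  then show ?thesis unfolding theta_eq_pinf * using x by (simp add: field_simps)
qed

lemma inverse_pinf_product: "y \<noteq> 0 \<Longrightarrow> 1 / (pinf (q * y) * pinf (1 / y)) = - y / theta y"
  using theta_q_mult[of y] by (simp add: theta_eq_pinf)

lemma theta_inverse: "x \<noteq> 0 \<Longrightarrow> theta (1 / x) = - theta x / x"
  using theta_q_mult[of x] by (simp add: theta_eq_pinf mult.commute)

lemma theta_eq_theta_div_q: "x \<noteq> 0 \<Longrightarrow> theta x = - (q / x) * theta (x / q)"
  using theta_q_mult[of "x / q"] by simp

lemma theta_nonzero: "x \<notin> q_ints q \<Longrightarrow> theta x \<noteq> 0"
  using pinf_nonzero[of x] pinf_nonzero[of "q / x"] q_ints_mult[OF q_ints_inverse, of x 1]
  by (simp add: theta_eq_pinf)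

lemma theta_1 [simp]: "theta 1 = 0"
  using pinf_rec[of 1] by (simp add: theta_eq_pinf)

section \<open>Theta terms, Euler expansions and the triple product\<close>

text \<open>The coefficient \<open>1 / (q; q)\<^sub>k\<close>, set to \<open>0\<close> for negative \<open>k\<close>. With this convention the
  recursion \<open>(1 - q\<^sup>k) / (q; q)\<^sub>k = 1 / (q; q)\<^bsub>k-1\<^esub>\<close> holds for all integers, so that all series
  can be indexed by \<open>int\<close> and shifted freely.\<close>

definition inv_poch :: "int \<Rightarrow> complex" where
  "inv_poch k = (if k < 0 then 0 else 1 / (\<Prod>i<nat k. 1 - q ^ Suc i))"

lemma inv_poch_neg [simp]: "k < 0 \<Longrightarrow> inv_poch k = 0" and inv_poch_0 [simp]: "inv_poch 0 = 1"
  by (simp_all add: inv_poch_def)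

lemma inv_poch_rec: "(1 - q powi k) * inv_poch k = inv_poch (k - 1)"
proof (cases "k > 0")
  case True
  then obtain m where k: "k = int (Suc m)" by (metis zero_less_imp_eq_int gr0_implies_Suc)
  have "q ^ Suc m \<noteq> 1" by (rule q_pow_neq_1) simp
  then show ?thesis
    unfolding k power_int_of_nat by (simp add: inv_poch_def nat_add_distrib)
next
  case False
  then show ?thesis by (cases "k = 0") auto
qed

lemma inv_poch_of_nat: "inv_poch (int n) = pinf (q ^ Suc n) / pinf q"
proof (induction n)
  case (Suc n)
  have "(1 - q ^ Suc n) * inv_poch (int (Suc n)) = pinf (q ^ Suc n) / pinf q"
    using Suc inv_poch_rec[of "int (Suc n)"] unfolding power_int_of_nat by simp
  moreover have "pinf (q ^ Suc n) = (1 - q ^ Suc n) * pinf (q ^ Suc (Suc n))"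
    using pinf_rec[of "q ^ Suc n"] by simp
  moreover have "q ^ Suc n \<noteq> 1" by (rule q_pow_neq_1) simp
  ultimately have "(1 - q ^ Suc n) * inv_poch (int (Suc n))
      = (1 - q ^ Suc n) * (pinf (q ^ Suc (Suc n)) / pinf q)"
    and "1 - q ^ Suc n \<noteq> 0" by simp_all
  then show ?case by (metis mult_left_cancel)
qed simp

text \<open>For negative \<open>k\<close> both sides vanish: the product \<open>pinf (q powi (k + 1))\<close> then contains the
  factor \<open>1 - q powi 0\<close>.\<close>

lemma inv_poch_mult_pinf: "inv_poch k * pinf q = pinf (q powi (k + 1))"
proof (cases "k \<ge> 0")
  case True
  then obtain n where k: "k = int n" by (metis nonneg_int_cases)
  show ?thesis using inv_poch_of_nat[of n] power_int_of_nat[of q "Suc n"]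
      by (simp add: k add.commute)
next
  case False
  have "pinf (q powi (- int n)) = 0" for n
  proof (induction n)
    case 0
    show ?case using pinf_rec[of 1] by simp
  next
    case (Suc n)
    have "q * q powi (- int (Suc n)) = q powi (- int n)"
      by (simp add: power_int_diff power_int_minus field_simps)
    then show ?case using pinf_rec[of "q powi (- int (Suc n))"] Suc by simp
  qed
  from this[of "nat (- k - 1)"] False show ?thesis by (simp add: add.commute)
qed

lemma inv_poch_bounded: obtains C where "C > 0" "\<And>k. norm (inv_poch k) \<le> C"
proof -
  have "(\<lambda>n. 1 / (\<Prod>i<n. 1 - q * q ^ i)) \<longlonglongrightarrow> 1 / pinf q"
    by (intro tendsto_intros pinf_LIMSEQ) simp
  then have "Bseq (\<lambda>n. 1 / (\<Prod>i<n. 1 - q * q ^ i))"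
    by (rule convergent_imp_Bseq[OF convergentI])
  then obtain B where B: "B > 0" "\<And>n. norm (1 / (\<Prod>i<n. 1 - q * q ^ i)) \<le> B"
    by (auto elim: BseqE)
  show ?thesis
  proof (rule that[OF B(1)])
    show "norm (inv_poch k) \<le> B" for k
      using B(2)[of "nat k"] B(1) by (simp add: inv_poch_def)
  qed
qed

definition theta_term :: "complex \<Rightarrow> int \<Rightarrow> complex" where
  "theta_term z n = q powi tri n * (- z) powi n"

lemma theta_term_0 [simp]: "theta_term z 0 = 1" by (simp add: theta_term_def)

text \<open>The cross term of the quadratic exponent is absorbed into the argument; this is the source
  of every quasi-periodicity below.\<close>

lemma theta_term_add: "z \<noteq> 0 \<Longrightarrow> theta_term z (n + k)
    = theta_term z n * theta_term (z * q powi n) k"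
proof -
  assume "z \<noteq> 0"
  moreover have "- (z * q powi n) = - z * q powi n" by simp
  then have "(- (z * q powi n)) powi k = (- z) powi k * q powi (n * k)"
    by (simp only: power_int_mult_distrib power_int_mult)
  ultimately show ?thesis by (simp add: theta_term_def tri_add power_int_add)
qed

lemma theta_term_uminus: "theta_term z (- n) = theta_term (q / z) n"
proof -
  have "(- (q / z)) powi n = q powi n * (- z) powi (- n)"
    by (simp add: power_int_minus flip: power_int_mult_distrib power_int_inverse)
       (simp add: field_simps)
  then show ?thesis by (simp add: theta_term_def tri_uminus power_int_add)
qed

lemma theta_term_diff: "z \<noteq> 0 \<Longrightarrow> theta_term z (n - k)
    = theta_term z n * theta_term (q powi (1 - n) / z) k"
  using theta_term_add[of z n "- k"] by (simp add: theta_term_uminus power_int_diff mult.commute)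

text \<open>Consecutive terms have the ratio \<open>- z q\<^sup>n\<close>, which tends to zero.\<close>

lemma theta_term_summable_nat: "summable (\<lambda>n. norm (theta_term z (int n)))"
proof -
  have rat: "norm (theta_term z (int (Suc n)))
      = norm z * norm q ^ n * norm (theta_term z (int n))" for n
  proof -
    have "tri (int (Suc n)) = tri (int n) + int n" using tri_add[of "int n" 1]
        by (simp add: add.commute)
    then show ?thesis by (simp add: theta_term_def power_int_add norm_mult norm_power
        norm_power_int)
  qed
  have "(\<lambda>n. norm z * norm q ^ n) \<longlonglongrightarrow> norm z * 0"
    by (intro tendsto_intros LIMSEQ_power_zero) (use norm_q in auto)
  then have "eventually (\<lambda>n. norm z * norm q ^ n < 1 / 2) sequentially"
    by (intro order_tendstoD(2)) auto
  then obtain n0 where n0: "\<And>n. n \<ge> n0 \<Longrightarrow> norm z * norm q ^ n < 1 / 2"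
    by (auto simp: eventually_sequentially)
  show ?thesis
  proof (rule summable_ratio_test)
    show "norm (norm (theta_term z (int (Suc n)))) \<le> 1 / 2 * norm (norm (theta_term z (int n)))"
        if "n \<ge> n0" for n
      using mult_right_mono[OF less_imp_le[OF n0[OF that]], of "norm (theta_term z (int n))"]
          rat[of n] by simp
  qed simp
qed

lemma theta_term_summable: "theta_term z summable_on UNIV"
proof -
  have nat: "(\<lambda>n. theta_term z (int n)) summable_on UNIV" for z
    by (rule norm_summable_imp_summable_on[OF theta_term_summable_nat])
  have "theta_term z summable_on range int"
    using nat[of z] by (subst summable_on_reindex) (auto simp: o_def)
  moreover have "theta_term z summable_on range (\<lambda>n. - int n)"
    using nat[of "q / z"] by (subst summable_on_reindex)
        (auto simp: o_def inj_on_def theta_term_uminus)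
  ultimately have "theta_term z summable_on (range int \<union> range (\<lambda>n. - int n))"
    by (rule summable_on_union)
  moreover have "range int \<union> range (\<lambda>n. - int n) = UNIV"
    by (auto simp: image_iff) (metis int_cases2)
  ultimately show ?thesis by simp
qed

lemma theta_term_inv_poch_summable: "(\<lambda>k. theta_term z k * inv_poch k) summable_on UNIV"
  using inv_poch_bounded by (metis summable_on_bounded_factor[OF theta_term_summable])

lemma iterate_functional_eq:
  assumes "\<And>z. f z = (1 - z) * f (q * z)"
  shows "f z = (\<Prod>k<n. 1 - z * q ^ k) * f (z * q ^ n)"
proof (induction n)
  case (Suc n)
  then show ?case using assms[of "z * q ^ n"] by (simp add: mult_ac)
qed simp

lemma q_pow_LIMSEQ: "(\<lambda>n. z * q ^ n) \<longlonglongrightarrow> 0"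
proof -
  have "(\<lambda>n. z * q ^ n) \<longlonglongrightarrow> z * 0"
    by (intro tendsto_intros LIMSEQ_power_zero) (use norm_q in auto)
  then show ?thesis by simp
qed

text \<open>Euler's expansion of \<open>(z; q)\<^sub>\<infinity>\<close>. Both sides satisfy \<open>f z = (1 - z) * f (q * z)\<close>, are
  continuous at the origin and take the value \<open>1\<close> there, and iterating the equation drives the
  argument to the origin.\<close>

lemma euler_pinf: "((\<lambda>k. theta_term z k * inv_poch k) has_sum pinf z) UNIV"
proof -
  define f where "f z = (\<Sum>\<^sub>\<infinity>k. theta_term z k * inv_poch k)" for z
  have f: "((\<lambda>k. theta_term z k * inv_poch k) has_sum f z) UNIV" for z
    unfolding f_def by (rule has_sum_infsum[OF theta_term_inv_poch_summable])
  have rec: "f z = (1 - z) * f (q * z)" for z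
  proof (cases "z = 0")
    case False
    have "((\<lambda>k. theta_term z k * inv_poch k - theta_term (q * z) k * inv_poch k)
        has_sum f z - f (q * z)) UNIV"
      by (intro has_sum_diff f)
    moreover have "theta_term z k * inv_poch k - theta_term (q * z) k * inv_poch k
        = theta_term z k * inv_poch (k - 1)" for k
    proof -
      have "theta_term (q * z) k = q powi k * theta_term z k"
        using power_int_mult_distrib[of q "- z" k] by (simp add: theta_term_def)
      then show ?thesis using inv_poch_rec[of k] by (simp add: algebra_simps flip: inv_poch_rec)
    qed
    ultimately have "((\<lambda>k. theta_term z k * inv_poch (k - 1)) has_sum f z - f (q * z)) UNIV"
        by simp
    then have "((\<lambda>k. theta_term z (k + 1) * inv_poch k) has_sum f z - f (q * z)) UNIV"
      by (subst (asm) has_sum_shift[of _ 1, symmetric]) simp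
    moreover have "theta_term z (k + 1) * inv_poch k
        = - z * (theta_term (q * z) k * inv_poch k)" for k
      using theta_term_add[OF False, of 1 k]
          by (simp add: add.commute mult.commute theta_term_def)
    ultimately have "((\<lambda>k. - z * (theta_term (q * z) k * inv_poch k))
        has_sum f z - f (q * z)) UNIV" by simp
    moreover have "((\<lambda>k. - z * (theta_term (q * z) k * inv_poch k)) has_sum - z * f (q * z)) UNIV"
      by (intro has_sum_cmult_right f)
    ultimately have "f z - f (q * z) = - z * f (q * z)" by (rule has_sum_unique)
    then show ?thesis by (simp add: algebra_simps)
  qed simp
  define c where "c n = q powi tri (int n) * (-1) ^ n * inv_poch (int n)" for n
  have c: "(\<lambda>n. c n * z ^ n) sums f z" for z
  proof -
    have "((\<lambda>n. theta_term z (int n) * inv_poch (int n)) has_sum f z) UNIV"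
      using f[of z] by (subst (asm) has_sum_int_iff_nat) auto
    then have "(\<lambda>n. theta_term z (int n) * inv_poch (int n)) sums f z" by (rule has_sum_imp_sums)
    then show ?thesis
      by (simp add: c_def theta_term_def power_minus[of z] mult_ac)
  qed
  then have f_eq: "f = (\<lambda>z. \<Sum>n. c n * z ^ n)" by (auto simp: sums_iff)
  have "isCont f 0"
    unfolding f_eq by (rule isCont_powser_converges_everywhere) (use c in \<open>auto simp: sums_iff\<close>)
  then have "(\<lambda>n. f (z * q ^ n)) \<longlonglongrightarrow> f 0"
    using q_pow_LIMSEQ by (rule isCont_tendsto_compose)
  moreover have "f 0 = 1"
    using c[of 0] sums_unique2[OF c[of 0] powser_sums_zero[of c]] by (simp add: c_def)
  ultimately have "(\<lambda>n. (\<Prod>k<n. 1 - z * q ^ k) * f (z * q ^ n)) \<longlonglongrightarrow> pinf z * 1"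
    by (intro tendsto_mult pinf_LIMSEQ) simp
  then have "f z = pinf z"
    by (simp flip: iterate_functional_eq[of f, OF rec] add: LIMSEQ_const_iff)
  with f[of z] show ?thesis by simp
qed

text \<open>Euler's expansion of \<open>1 / (z; q)\<^sub>\<infinity>\<close>, by the same argument with the equation
  \<open>(1 - z) * g z = g (q * z)\<close>.\<close>

lemma euler_inverse_pinf:
  assumes "norm z < 1" and "z \<noteq> 0"
  shows "((\<lambda>k. inv_poch k * z powi k) has_sum 1 / pinf z) UNIV"
proof -
  define g where "g z = (\<Sum>\<^sub>\<infinity>k. inv_poch k * z powi k)" for z
  have nat: "((\<lambda>k. inv_poch k * z powi k) has_sum g z) UNIV
      \<and> (\<lambda>n. inv_poch (int n) * z ^ n) sums g z" if z: "norm z < 1" for z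
  proof -
    obtain C where C: "C > 0" "\<And>k. norm (inv_poch k) \<le> C" using inv_poch_bounded by blast
    have "(\<lambda>n. z ^ n) summable_on UNIV"
      by (rule norm_summable_imp_summable_on) (use z in \<open>simp add: norm_power\<close>)
    then have "(\<lambda>n. z ^ n * inv_poch (int n)) summable_on UNIV"
      by (rule summable_on_bounded_factor) (rule C)
    then have "(\<lambda>k. inv_poch k * z powi k) summable_on UNIV"
      by (subst summable_on_int_iff_nat) (auto simp: mult.commute)
    then have 1: "((\<lambda>k. inv_poch k * z powi k) has_sum g z) UNIV"
      unfolding g_def by (rule has_sum_infsum)
    then have "((\<lambda>k. inv_poch (int k) * z ^ k) has_sum g z) UNIV"
      by (subst (asm) has_sum_int_iff_nat) auto
    with 1 show ?thesis by (auto dest: has_sum_imp_sums)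
  qed
  have small: "norm (z * q ^ n) < 1" for n
    using assms by (intro norm_mult_q_pow_less_1)
  have rec: "(1 - w) * g w = g (q * w)" if w: "norm w < 1" "w \<noteq> 0" for w
  proof -
    have w': "norm (q * w) < 1" using norm_mult_q_pow_less_1[OF w(1), of 1]
        by (simp add: mult.commute)
    have "((\<lambda>k. inv_poch k * w powi k - inv_poch k * (q * w) powi k)
        has_sum g w - g (q * w)) UNIV"
      by (intro has_sum_diff nat[THEN conjunct1] w w')
    moreover have "inv_poch k * w powi k - inv_poch k * (q * w) powi k
        = inv_poch (k - 1) * w powi k" for k
      by (simp add: power_int_mult_distrib algebra_simps flip: inv_poch_rec)
    ultimately have "((\<lambda>k. inv_poch (k - 1) * w powi k) has_sum g w - g (q * w)) UNIV" by simp
    then have "((\<lambda>k. inv_poch k * w powi (k + 1)) has_sum g w - g (q * w)) UNIV"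
      by (subst (asm) has_sum_shift[of _ 1, symmetric]) simp
    moreover have "((\<lambda>k. w * (inv_poch k * w powi k)) has_sum w * g w) UNIV"
      by (intro has_sum_cmult_right nat[THEN conjunct1] w)
    ultimately have "g w - g (q * w) = w * g w"
      by (intro has_sum_unique) (auto simp: power_int_add w mult_ac)
    then show ?thesis by (simp add: algebra_simps)
  qed
  have "(\<Prod>k<n. 1 - z * q ^ k) * g z = g (z * q ^ n)" for n
  proof (induction n)
    case (Suc n)
    have "(\<Prod>k<Suc n. 1 - z * q ^ k) * g z = (1 - z * q ^ n) * ((\<Prod>k<n. 1 - z * q ^ k) * g z)"
      by (simp add: mult_ac)
    also have "\<dots> = g (q * (z * q ^ n))" unfolding Suc by (rule rec) (use small assms in auto)
    finally show ?case by (simp add: mult_ac)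
  qed simp
  moreover have "(\<lambda>n. (\<Prod>k<n. 1 - z * q ^ k) * g z) \<longlonglongrightarrow> pinf z * g z"
    by (intro tendsto_intros pinf_LIMSEQ)
  moreover have "(\<lambda>n. g (z * q ^ n)) \<longlonglongrightarrow> 1"
  proof -
    have "isCont (\<lambda>w. \<Sum>n. inv_poch (int n) * w ^ n) 0"
      by (rule isCont_powser[of _ z]) (use nat[of z] assms in \<open>auto simp: sums_iff\<close>)
    then have "(\<lambda>n. \<Sum>m. inv_poch (int m) * (z * q ^ n) ^ m) \<longlonglongrightarrow> (\<Sum>m. inv_poch (int m) * 0 ^ m)"
      using q_pow_LIMSEQ by (rule isCont_tendsto_compose)
    moreover have "(\<Sum>m. inv_poch (int m) * 0 ^ m) = 1"
      using powser_sums_zero[of "\<lambda>m. inv_poch (int m)"] by (simp add: sums_iff)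
    moreover have "(\<Sum>m. inv_poch (int m) * (z * q ^ n) ^ m) = g (z * q ^ n)" for n
      using nat[OF small[of n]] by (simp add: sums_iff)
    ultimately show ?thesis by simp
  qed
  ultimately have *: "pinf z * g z = 1" by (simp add: LIMSEQ_unique)
  then have "pinf z \<noteq> 0" by auto
  with * have "g z = 1 / pinf z" by (simp add: field_simps)
  with nat[of z] assms show ?thesis by simp
qed

text \<open>Andrews' proof. For \<open>\<bar>q / z\<bar> < 1\<close>, multiply the theta series by the expansion of
  \<open>1 / pinf (q / z)\<close> and collect terms so that the inner sum is Euler's expansion of
  \<open>pinf (q powi (n + 1))\<close>; this is a multiple of \<open>inv_poch n\<close>, and the outer sum is then Euler's
  expansion of \<open>pinf z\<close>. Both sides change by the factor \<open>- 1 / z\<close> under \<open>z \<mapsto> q * z\<close>, which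
  extends the formula to all nonzero \<open>z\<close>.\<close>

theorem jacobi_triple_product:
  assumes "z \<noteq> 0"
  shows "(theta_term z has_sum pinf q * theta z) UNIV"
proof -
  define Th where "Th z = infsum (theta_term z) UNIV" for z
  have Th: "(theta_term z has_sum Th z) UNIV" for z
    unfolding Th_def by (rule has_sum_infsum[OF theta_term_summable])
  have big: "Th w = pinf q * theta w" if w: "norm w > norm q" for w
  proof -
    have w0: "w \<noteq> 0" and qw: "norm (q / w) < 1" "q / w \<noteq> 0"
      using w by (auto simp: norm_divide divide_simps)
    have "((\<lambda>(m, k). theta_term w m * (inv_poch k * (q / w) powi k))
        has_sum Th w * (1 / pinf (q / w))) UNIV"
      by (intro has_sum_times Th euler_inverse_pinf qw)
    \<comment> \<open>The substitution \<open>m = n + k\<close> makes the inner sum over \<open>k\<close> an Euler expansion.\<close>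
    also have "?this \<longleftrightarrow> ((\<lambda>(n, k). theta_term w (n + k) * (inv_poch k * (q / w) powi k))
        has_sum Th w * (1 / pinf (q / w))) UNIV"
      by (rule has_sum_reindex_bij_witness[of _ "\<lambda>(n, k). (n + k, k)" "\<lambda>(n, k). (n - k, k)"]) auto
    finally have 1: "((\<lambda>(n, k). theta_term w (n + k) * (inv_poch k * (q / w) powi k))
        has_sum Th w * (1 / pinf (q / w))) (UNIV \<times> UNIV)"
      by simp
    have "((\<lambda>k. theta_term w (n + k) * (inv_poch k * (q / w) powi k))
        has_sum theta_term w n * (inv_poch n * pinf q)) UNIV" for n
    proof -
      have "((\<lambda>k. theta_term w n * (theta_term (q powi (n + 1)) k * inv_poch k))
          has_sum theta_term w n * pinf (q powi (n + 1))) UNIV"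
        by (intro has_sum_cmult_right euler_pinf)
      moreover have "theta_term (w * q powi n) k * (q / w) powi k
          = theta_term (q powi (n + 1)) k" for k
        using w0 by (simp add: theta_term_def q_add mult.assoc flip: power_int_mult_distrib)
      then have "theta_term w n * (theta_term (q powi (n + 1)) k * inv_poch k)
          = theta_term w (n + k) * (inv_poch k * (q / w) powi k)" for k
        using theta_term_add[OF w0, of n k] by (metis mult.assoc mult.commute)
      ultimately show ?thesis by (simp add: inv_poch_mult_pinf)
    qed
    with 1 have "((\<lambda>n. theta_term w n * (inv_poch n * pinf q))
        has_sum Th w * (1 / pinf (q / w))) UNIV"
      by (intro has_sum_SigmaD[OF 1]) auto
    moreover have "((\<lambda>n. theta_term w n * inv_poch n * pinf q) has_sum pinf w * pinf q) UNIV"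
      by (intro has_sum_cmult_left euler_pinf)
    ultimately have "Th w * (1 / pinf (q / w)) = pinf w * pinf q"
      by (intro has_sum_unique) (auto simp: mult.assoc)
    moreover have "pinf (q / w) \<noteq> 0"
    proof
      assume "pinf (q / w) = 0"
      then obtain n where n: "q / w * q ^ n = 1" using pinf_eq_0 by blast
      with norm_mult_q_pow_less_1[OF qw(1), of n] show False by simp
    qed
    ultimately show ?thesis by (simp add: theta_eq_pinf field_simps)
  qed
  have step: "Th (q * w) = - Th w / w" if "w \<noteq> 0" for w
  proof -
    have "((\<lambda>n. theta_term w (n + 1)) has_sum Th w) UNIV"
      using Th by (simp add: has_sum_shift)
    moreover have "theta_term w (n + 1) = - w * theta_term (q * w) n" for n
      using theta_term_add[OF that, of 1 n] by (simp add: add.commute mult.commute theta_term_def)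
    ultimately have "((\<lambda>n. - w * theta_term (q * w) n) has_sum Th w) UNIV" by simp
    moreover have "((\<lambda>n. - w * theta_term (q * w) n) has_sum - w * Th (q * w)) UNIV"
      by (intro has_sum_cmult_right Th)
    ultimately have "Th w = - w * Th (q * w)" by (rule has_sum_unique)
    then show ?thesis using that by (simp add: field_simps)
  qed
  obtain n0 where n0: "norm q ^ n0 < norm z / norm q"
    using real_arch_pow_inv[of "norm z / norm q" "norm q"] assms norm_q by auto
  \<comment> \<open>A point of the region of convergence whose \<open>q\<close>-orbit contains \<open>z\<close>.\<close>
  define w where "w = z / q ^ n0"
  have "norm w > norm q" using n0 assms by (simp add: w_def norm_divide norm_power field_simps)
  then have "Th (w * q ^ n) = pinf q * theta (w * q ^ n)" for n
  proof (induction n)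
    case 0
    then show ?case using big by simp
  next
    case (Suc n)
    then show ?case using step[of "w * q ^ n"] theta_q_mult[of "w * q ^ n"] assms
      by (simp add: w_def mult_ac)
  qed
  from this[of n0] have "Th z = pinf q * theta z" by (simp add: w_def)
  with Th[of z] show ?thesis by simp
qed

section \<open>The double theta series\<close>

lemma theta_term_product_summable:
    "(\<lambda>(n, m). theta_term a n * theta_term b m * inv_poch (m - n)) summable_on UNIV"
proof -
  obtain C where C: "\<And>k. norm (inv_poch k) \<le> C" using inv_poch_bounded by blast
  have "(\<lambda>p. (case p of (n, m) \<Rightarrow> theta_term a n * theta_term b m)
      * (case p of (n, m) \<Rightarrow> inv_poch (m - n))) summable_on UNIV"
    by (intro summable_on_bounded_factor[where C = C] summable_on_times theta_term_summable)
        (use C in auto)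
  then show ?thesis by (simp add: case_prod_unfold)
qed

text \<open>The series that underlies the little mu function: up to elementary factors both the \<open>\<^sub>1\<psi>\<^sub>2\<close>
  series that defines that function and its \<open>\<^sub>0\<psi>\<^sub>2\<close> form are partial summations of it. Its
  absolute convergence is that of a product of two theta series, since \<open>inv_poch\<close> is bounded.\<close>

definition theta_pair :: "complex \<Rightarrow> complex \<Rightarrow> complex" where
  "theta_pair x y = (\<Sum>\<^sub>\<infinity>(n, m). theta_term x n * theta_term (1 / y) m * inv_poch (m - n))"

lemma theta_pair_has_sum: "((\<lambda>(n, m). theta_term x n * theta_term (1 / y) m * inv_poch (m - n))
    has_sum theta_pair x y) (UNIV \<times> UNIV)"
  unfolding theta_pair_def UNIV_Times_UNIV by (rule
      has_sum_infsum[OF theta_term_product_summable])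

text \<open>Sum over \<open>m = n + k\<close> first, by Euler's expansion.\<close>

lemma theta_pair_has_sum_rows:
  assumes "y \<noteq> 0"
  shows "((\<lambda>n. theta_term x n * theta_term (1 / y) n * pinf (q powi n / y))
      has_sum theta_pair x y) UNIV"
proof (rule has_sum_SigmaD[OF theta_pair_has_sum])
  fix n :: int
  have "((\<lambda>k. theta_term x n * theta_term (1 / y) n
      * (theta_term (1 / y * q powi n) k * inv_poch k)) has_sum
      theta_term x n * theta_term (1 / y) n * pinf (1 / y * q powi n)) UNIV"
    by (intro has_sum_cmult_right euler_pinf)
  moreover have "theta_term (1 / y) (k + n)
      = theta_term (1 / y) n * theta_term (1 / y * q powi n) k" for k
    using theta_term_add[of "1 / y" n k] assms by (simp add: add.commute)
  ultimately have "((\<lambda>k. theta_term x n * theta_term (1 / y) (k + n) * inv_poch (k + n - n))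
      has_sum
      theta_term x n * theta_term (1 / y) n * pinf (q powi n / y)) UNIV"
    by (simp add: mult.assoc)
  then show "((\<lambda>m. case (n, m) of (n, m) \<Rightarrow> theta_term x n * theta_term (1 / y) m
      * inv_poch (m - n)) has_sum
      theta_term x n * theta_term (1 / y) n * pinf (q powi n / y)) UNIV"
    by (subst has_sum_shift[of _ n, symmetric]) simp
qed

text \<open>Sum over \<open>n = m - k\<close> first, by Euler's expansion.\<close>

lemma theta_pair_has_sum_columns:
  assumes "x \<noteq> 0"
  shows "((\<lambda>n. theta_term x n * theta_term (1 / y) n * pinf (q powi (1 - n) / x))
      has_sum theta_pair x y) UNIV"
proof (rule has_sum_SigmaD)
  show "((\<lambda>(m, n). theta_term x n * theta_term (1 / y) m * inv_poch (m - n))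
      has_sum theta_pair x y) (UNIV \<times> UNIV)"
    using theta_pair_has_sum[of x y] by (subst (asm) has_sum_swap) (simp add: case_prod_unfold)
  fix n :: int
  have "((\<lambda>k. theta_term x n * theta_term (1 / y) n
      * (theta_term (q powi (1 - n) / x) k * inv_poch k)) has_sum
      theta_term x n * theta_term (1 / y) n * pinf (q powi (1 - n) / x)) UNIV"
    by (intro has_sum_cmult_right euler_pinf)
  then have "((\<lambda>k. theta_term x (n - k) * theta_term (1 / y) n * inv_poch (n - (n - k))) has_sum
      theta_term x n * theta_term (1 / y) n * pinf (q powi (1 - n) / x)) UNIV"
    using assms by (simp add: theta_term_diff mult_ac)
  then show "((\<lambda>m. case (n, m) of (m, n) \<Rightarrow> theta_term x n * theta_term (1 / y) m
      * inv_poch (m - n)) has_sum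
      theta_term x n * theta_term (1 / y) n * pinf (q powi (1 - n) / x)) UNIV"
    by (subst has_sum_reindex_bij_witness[of UNIV "\<lambda>k. n - k" "\<lambda>k. n - k" UNIV]) auto
qed

lemma theta_term_succ: "z \<noteq> 0 \<Longrightarrow> theta_term z (n + 1) = - z * q powi n * theta_term z n"
  using theta_term_add[of z n 1] by (simp add: theta_term_def)

lemma theta_term_one_minus: "z \<noteq> 0 \<Longrightarrow> theta_term z (1 - m) = - z * theta_term (1 / z) m"
  using theta_term_diff[of z 1 m] by (simp add: theta_term_def)

lemma theta_term_product:
  assumes "s \<noteq> 0" and "t \<noteq> 0"
  shows "theta_term (s / t) i * theta_term (s * t) j
      = q powi (tri i + tri j) * (-1) powi (i + j) * s powi (i + j) * t powi (j - i)"
  using assms by (simp add: theta_term_def minus_powi[of "s / t"] minus_powi[of "s * t"]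
      power_int_mult_distrib power_int_divide_distrib power_int_add power_int_diff)

lemma theta_term_pred: "z \<noteq> 0 \<Longrightarrow> theta_term z (n - 1) = - (q powi (1 - n) / z) * theta_term z n"
  using theta_term_diff[of z n 1] by (simp add: theta_term_def)

lemma theta_pair_has_sum_reindex:
  "((\<lambda>(n, m). theta_term x (n + a) * theta_term (1 / y) (m + b) * inv_poch (m - n + (b - a)))
      has_sum theta_pair x y) UNIV"
proof -
  have "((\<lambda>(n, m). theta_term x n * theta_term (1 / y) m * inv_poch (m - n))
      has_sum theta_pair x y) UNIV"
    using theta_pair_has_sum by simp
  then show ?thesis
    by (subst has_sum_reindex_bij_witness[of UNIV "\<lambda>(n, m). (n - a, m - b)"
        "\<lambda>(n, m). (n + a, m + b)" UNIV])
      (auto simp: algebra_simps)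
qed

text \<open>The reflection \<open>(n, m) \<mapsto> (1 - m, 1 - n)\<close> preserves \<open>m - n\<close> and exchanges the two theta
  terms.\<close>

lemma theta_pair_commute:
  assumes "x \<noteq> 0" and "y \<noteq> 0"
  shows "y * theta_pair x y = x * theta_pair y x"
proof -
  have "((\<lambda>(n, m). theta_term x n * theta_term (1 / y) m * inv_poch (m - n))
      has_sum theta_pair x y) UNIV"
    using theta_pair_has_sum by simp
  also have "?this \<longleftrightarrow> ((\<lambda>(n, m). theta_term x (1 - m) * theta_term (1 / y) (1 - n)
      * inv_poch (m - n)) has_sum theta_pair x y) UNIV"
    by (rule has_sum_reindex_bij_witness[of _ "\<lambda>(n, m). (1 - m, 1 - n)"
        "\<lambda>(n, m). (1 - m, 1 - n)"]) auto
  also have "(\<lambda>(n, m). theta_term x (1 - m) * theta_term (1 / y) (1 - n) * inv_poch (m - n))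
      = (\<lambda>p. x / y * (case p of (n, m) \<Rightarrow> theta_term y n * theta_term (1 / x) m
          * inv_poch (m - n)))"
    using assms by (auto simp: theta_term_one_minus fun_eq_iff)
  finally have "((\<lambda>p. x / y * (case p of (n, m) \<Rightarrow> theta_term y n * theta_term (1 / x) m
      * inv_poch (m - n))) has_sum theta_pair x y) UNIV" .
  moreover have "((\<lambda>p. x / y * (case p of (n, m) \<Rightarrow> theta_term y n * theta_term (1 / x) m
      * inv_poch (m - n))) has_sum x / y * theta_pair y x) UNIV"
    by (intro has_sum_cmult_right) (use theta_pair_has_sum[of y x] in simp)
  ultimately have "theta_pair x y = x / y * theta_pair y x" by (rule has_sum_unique)
  then show ?thesis using assms by simp
qed

text \<open>Shifting both indices by one preserves \<open>m - n\<close> and rescales the theta terms.\<close>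

lemma theta_pair_q_shift:
  assumes "x \<noteq> 0" and "y \<noteq> 0"
  shows "theta_pair (x / q) (q * y) = x / (q ^ 2 * y) * theta_pair x y"
proof -
  have *: "theta_term (z / q) n = - (z / q) * theta_term z (n - 1)" if "z \<noteq> 0" for z n
    using that theta_term_add[of z "-1" n]
        by (simp add: theta_term_def[of z "-1"] tri_def power_int_minus field_simps)
  have "((\<lambda>p. x / (q ^ 2 * y) * (case p of (n, m) \<Rightarrow> theta_term x (n - 1)
      * theta_term (1 / y) (m - 1) * inv_poch (m - n)))
      has_sum x / (q ^ 2 * y) * theta_pair x y) UNIV"
    by (intro has_sum_cmult_right) (use theta_pair_has_sum_reindex[of x "-1" y "-1"] in simp)
  moreover have "(\<lambda>p. x / (q ^ 2 * y)
      * (case p of (n, m) \<Rightarrow> theta_term x (n - 1) * theta_term (1 / y) (m - 1) * inv_poch (m - n)))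
    = (\<lambda>(n, m). theta_term (x / q) n * theta_term (1 / (q * y)) m * inv_poch (m - n))"
    using assms *[of x] *[of "1 / y"] by (auto simp: fun_eq_iff power2_eq_square mult_ac)
  ultimately have "((\<lambda>(n, m). theta_term (x / q) n * theta_term (1 / (q * y)) m
      * inv_poch (m - n)) has_sum x / (q ^ 2 * y) * theta_pair x y) UNIV"
    by (simp only:)
  moreover have "((\<lambda>(n, m). theta_term (x / q) n * theta_term (1 / (q * y)) m * inv_poch (m - n))
      has_sum theta_pair (x / q) (q * y)) UNIV"
    using theta_pair_has_sum[of "x / q" "q * y"] by simp
  ultimately show ?thesis by (rule has_sum_unique[rotated])
qed

text \<open>The recursion \<open>inv_poch (k - 1) = inv_poch k - q powi k * inv_poch k\<close> at \<open>k = m - n + 1\<close>,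
  summed against the theta terms: the first part is a shift in \<open>n\<close>, the second a shift in \<open>m\<close>.\<close>

lemma theta_pair_contiguous:
  assumes "x \<noteq> 0" and "y \<noteq> 0"
  shows "theta_pair x y = - x * theta_pair (q * x) y + q * y * theta_pair (x / q) y"
proof -
  have 1: "((\<lambda>(n, m). theta_term x n * theta_term (1 / y) m * inv_poch (m - n))
      has_sum theta_pair x y) UNIV"
    using theta_pair_has_sum by simp
  have 2: "((\<lambda>(n, m). theta_term x n * theta_term (1 / y) m * inv_poch (m - n + 1))
      has_sum - x * theta_pair (q * x) y) UNIV"
  proof -
    have "((\<lambda>p. - x * (case p of (n, m) \<Rightarrow> theta_term (q * x) (n - 1) * theta_term (1 / y) m
        * inv_poch (m - n + 1))) has_sum - x * theta_pair (q * x) y) UNIV"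
      by (intro has_sum_cmult_right) (use theta_pair_has_sum_reindex[of "q * x" "-1" y 0] in simp)
    moreover have "theta_term x n = - x * theta_term (q * x) (n - 1)" for n
      using theta_term_add[of x 1 "n - 1"] assms by (simp add: mult.commute theta_term_def)
    ultimately show ?thesis by (simp add: case_prod_unfold mult_ac)
  qed
  have 3: "((\<lambda>(n, m). theta_term x n * theta_term (1 / y) m
      * (- (q powi (m - n + 1)) * inv_poch (m - n + 1)))
      has_sum q * y * theta_pair (x / q) y) UNIV"
  proof -
    have "((\<lambda>p. q * y * (case p of (n, m) \<Rightarrow> theta_term (x / q) n * theta_term (1 / y) (m + 1)
        * inv_poch (m - n + 1))) has_sum q * y * theta_pair (x / q) y) UNIV"
      by (intro has_sum_cmult_right) (use theta_pair_has_sum_reindex[of "x / q" 0 y 1] in simp)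
    moreover have "theta_term (x / q) n = theta_term x n * q powi (- n)" for n
      by (simp add: theta_term_def minus_powi[of "x / q"] minus_powi[of x]
          power_int_divide_distrib power_int_minus_divide)
    ultimately show ?thesis using assms
      by (simp add: case_prod_unfold theta_term_succ power_int_diff power_int_minus_divide
          power_int_add mult_ac)
  qed
  have "((\<lambda>p. (case p of (n, m) \<Rightarrow> theta_term x n * theta_term (1 / y) m * inv_poch (m - n + 1)) +
        (case p of (n, m) \<Rightarrow> theta_term x n * theta_term (1 / y) m
            * (- (q powi (m - n + 1)) * inv_poch (m - n + 1))))
      has_sum - x * theta_pair (q * x) y + q * y * theta_pair (x / q) y) UNIV"
    by (intro has_sum_add 2 3)
  moreover have "(case p of (n, m) \<Rightarrow> theta_term x n * theta_term (1 / y) m * inv_poch (m - n + 1))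
      +
        (case p of (n, m) \<Rightarrow> theta_term x n * theta_term (1 / y) m
            * (- (q powi (m - n + 1)) * inv_poch (m - n + 1)))
      = (case p of (n, m) \<Rightarrow> theta_term x n * theta_term (1 / y) m * inv_poch (m - n))" for p
  proof -
    obtain n m where p: "p = (n, m)" by force
    have "inv_poch (m - n + 1) - q powi (m - n + 1) * inv_poch (m - n + 1) = inv_poch (m - n)"
      using inv_poch_rec[of "m - n + 1"] by (simp add: left_diff_distrib)
    moreover have "A * r1 + A * (- vwp_moment * r1)
        = A * (r1 - vwp_moment * r1)" for A vwp_moment r1 :: complex
      by (simp add: algebra_simps)
    ultimately show ?thesis unfolding p prod.case by metis
  qed
  ultimately have "((\<lambda>(n, m). theta_term x n * theta_term (1 / y) m * inv_poch (m - n))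
      has_sum - x * theta_pair (q * x) y + q * y * theta_pair (x / q) y) UNIV"
    by (simp only:)
  with 1 show ?thesis by (rule has_sum_unique)
qed

text \<open>Quasi-periodicity of \<open>theta\<close> over all integral powers of \<open>q\<close>, read off from the shifted
  triple product.\<close>

lemma theta_q_powi: "x \<noteq> 0 \<Longrightarrow> theta_term x n * theta (x * q powi n) = theta x"
proof -
  assume x: "x \<noteq> 0"
  have "((\<lambda>k. theta_term x n * theta_term (x * q powi n) k)
      has_sum theta_term x n * (pinf q * theta (x * q powi n))) UNIV"
    using x by (intro has_sum_cmult_right jacobi_triple_product) simp
  moreover have "((\<lambda>k. theta_term x (k + n)) has_sum pinf q * theta x) UNIV"
    using jacobi_triple_product[OF x] by (simp add: has_sum_shift)
  ultimately have "theta_term x n * (pinf q * theta (x * q powi n)) = pinf q * theta x"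
    using x by (intro has_sum_unique) (auto simp: theta_term_add add.commute[of _ n])
  then show ?thesis by simp
qed

section \<open>Three-term relation\<close>

text \<open>The sum over the diagonal \<open>m - n = k\<close> of the double theta series, freed from the product
  \<open>x * y\<close>. The shift by two diagonals below leaves only the functions for \<open>k = 0\<close> and \<open>k = 1\<close> up
  to constants.\<close>

definition theta_corr :: "int \<Rightarrow> complex \<Rightarrow> complex" where
  "theta_corr k s = (\<Sum>\<^sub>\<infinity>n. theta_term (- s) n * theta_term (- s) (n + k))"

lemma theta_corr_pairs_summable:
    "(\<lambda>(k, n). theta_term (- s) n * theta_term (- s) (n + k)) summable_on (UNIV \<times> UNIV)"
proof -
  have "(\<lambda>(n, m). theta_term (- s) n * theta_term (- s) m) summable_on UNIV"
    by (intro summable_on_times theta_term_summable)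
  then show ?thesis
    by (subst summable_on_reindex_bij_witness[of _ "\<lambda>(n, m). (m - n, n)" "\<lambda>(k, n). (n, n + k)"
        UNIV]) auto
qed

lemma theta_corr_has_sum: "((\<lambda>n. theta_term (- s) n * theta_term (- s) (n + k))
    has_sum theta_corr k s) UNIV"
  unfolding theta_corr_def by (intro
      has_sum_infsum summable_on_SigmaD1[OF theta_corr_pairs_summable]) simp

text \<open>Moving the first index down and the second index up by one connects the diagonals \<open>k\<close> and
  \<open>k + 2\<close>.\<close>

lemma theta_corr_rec: "s \<noteq> 0 \<Longrightarrow> theta_corr (k + 2) s = q powi (k + 1) * theta_corr k s"
proof -
  assume s: "s \<noteq> 0"
  have "((\<lambda>n. theta_term (- s) (n - 1) * theta_term (- s) (n + k + 1))
      has_sum theta_corr (k + 2) s) UNIV"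
    using theta_corr_has_sum[of s "k + 2"] by (subst (asm)
        has_sum_shift[of _ "-1", symmetric]) (simp add: algebra_simps)
  moreover have "theta_term (- s) (n - 1) * theta_term (- s) (n + k + 1)
      = q powi (k + 1) * (theta_term (- s) n * theta_term (- s) (n + k))" for n
    using s by (simp add: theta_term_succ theta_term_pred power_int_add power_int_diff)
  moreover have "((\<lambda>n. q powi (k + 1) * (theta_term (- s) n * theta_term (- s) (n + k)))
      has_sum q powi (k + 1) * theta_corr k s) UNIV"
    by (intro has_sum_cmult_right theta_corr_has_sum)
  ultimately show ?thesis by (simp only:) (rule has_sum_unique)
qed

text \<open>With \<open>x = p * s\<close> and \<open>y = p / s\<close>, the product \<open>x * y\<close> depends on \<open>p\<close> alone, and the
  diagonals separate the two variables: as a function of \<open>s\<close> the series lies in the span of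
  \<open>theta_corr 0\<close> and \<open>theta_corr 1\<close>.\<close>

lemma theta_pair_param:
  assumes "p \<noteq> 0" and "s \<noteq> 0"
  shows "((\<lambda>k. (- 1 / p) powi k * (inv_poch k * theta_corr k s))
      has_sum theta_pair (p * s) (p / s)) UNIV"
proof (rule has_sum_SigmaD)
  have "((\<lambda>(n, m). theta_term (p * s) n * theta_term (1 / (p / s)) m * inv_poch (m - n))
      has_sum theta_pair (p * s) (p / s)) UNIV"
    using theta_pair_has_sum[of "p * s" "p / s"] by simp
  then show "((\<lambda>(k, n). theta_term (p * s) n * theta_term (s / p) (n + k) * inv_poch k)
      has_sum theta_pair (p * s) (p / s)) (UNIV \<times> UNIV)"
    by (subst has_sum_reindex_bij_witness[of _ "\<lambda>(n, m). (m - n, n)" "\<lambda>(k, n). (n, n + k)" UNIV])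
        auto
  fix k
  have "((\<lambda>n. (- 1 / p) powi k * inv_poch k * (theta_term (- s) n * theta_term (- s) (n + k)))
      has_sum (- 1 / p) powi k * inv_poch k * theta_corr k s) UNIV"
    by (intro has_sum_cmult_right theta_corr_has_sum)
  moreover have "(- 1 / p) powi k * inv_poch k * (theta_term (- s) n * theta_term (- s) (n + k))
      = theta_term (p * s) n * theta_term (s / p) (n + k) * inv_poch k" for n
  proof -
    define w where "w = - 1 / p"
    have w: "w \<noteq> 0" "- (p * s) = (- p) * s" "- (s / p) = s * w" "(- p) * w = 1"
      using assms by (auto simp: w_def)
    have 1: "(- (p * s)) powi n = (- p) powi n * s powi n"
      unfolding w(2) by (rule power_int_mult_distrib)
    have 2: "(- (s / p)) powi (n + k) = s powi (n + k) * (w powi n * w powi k)"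
      unfolding w(3) power_int_mult_distrib using w(1) by (simp add: power_int_add)
    have 3: "(- p) powi n * w powi n = 1"
      unfolding power_int_mult_distrib[symmetric] w(4) by simp
    have "w powi k * inv_poch k * (theta_term (- s) n * theta_term (- s) (n + k))
      = ((- p) powi n * w powi n) * (w powi k * inv_poch k
          * (theta_term (- s) n * theta_term (- s) (n + k)))"
      unfolding 3 by simp
    also have "\<dots> = theta_term (p * s) n * theta_term (s / p) (n + k) * inv_poch k"
      unfolding theta_term_def 1 2 by (simp add: mult_ac)
    finally show ?thesis by (simp add: w_def)
  qed
  ultimately have "((\<lambda>n. theta_term (p * s) n * theta_term (s / p) (n + k) * inv_poch k)
      has_sum (- 1 / p) powi k * inv_poch k * theta_corr k s) UNIV"
    by (simp only:)
  then show "((\<lambda>n. case (k, n) of (k, n) \<Rightarrow> theta_term (p * s) n * theta_term (s / p) (n + k)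
      * inv_poch k) has_sum
      (- 1 / p) powi k * (inv_poch k * theta_corr k s)) UNIV"
    by (simp add: mult.assoc)
qed

definition casoratian :: "complex \<Rightarrow> complex \<Rightarrow> complex" where
  "casoratian s t = theta_corr 0 s * theta_corr 1 t - theta_corr 1 s * theta_corr 0 t"

text \<open>Expand both theta functions on the right by the triple product and split the double sum by
  the parity of \<open>i + j\<close>. The even part is \<open>theta_corr 0 s * theta_corr 1 t\<close>, the odd part, whose
  terms carry a minus sign, is the other product.\<close>

lemma casoratian_eq_theta:
  assumes "s \<noteq> 0" and "t \<noteq> 0"
  shows "casoratian s t = t * (pinf q)\<^sup>2 * theta (s / t) * theta (s * t)"
proof -
  define g where "g = (\<lambda>(i, j). t * (theta_term (s / t) i * theta_term (s * t) j))"
  have "(g has_sum t * ((pinf q * theta (s / t)) * (pinf q * theta (s * t)))) UNIV"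
    unfolding g_def case_prod_unfold
    using has_sum_times[OF jacobi_triple_product jacobi_triple_product, of "s / t" "s * t"] assms
    by (intro has_sum_cmult_right) (simp add: case_prod_unfold)
  moreover have "(g has_sum casoratian s t) UNIV"
  proof -
    have "((\<lambda>(m, n). (theta_term (- s) m * theta_term (- s) (m + 0))
        * (theta_term (- t) n * theta_term (- t) (n + 1)))
        has_sum theta_corr 0 s * theta_corr 1 t) UNIV"
      by (intro has_sum_times theta_corr_has_sum)
    also have "(\<lambda>(m, n). (theta_term (- s) m * theta_term (- s) (m + 0))
        * (theta_term (- t) n * theta_term (- t) (n + 1))) = (\<lambda>(m, n). g (m - n, m + n))"
    proof (safe intro!: ext)
      fix m n
      have e: "tri (m - n) + tri (m + n) = (tri m + tri m) + (tri n + (tri n + n))"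
        "m - n + (m + n) = m + m" "m + n - (m - n) = n + n"
        by (simp_all add: tri_add tri_diff)
      show "(theta_term (- s) m * theta_term (- s) (m + 0))
          * (theta_term (- t) n * theta_term (- t) (n + 1)) = g (m - n, m + n)"
        using assms unfolding g_def prod.case theta_term_product[OF assms] e
        by (simp add: theta_term_def tri_add power_int_add powi_double
            powi_double[unfolded mult.commute[of 2]]
            power_int_mult_distrib mult_ac)
    qed
    also note has_sum_even_pairs[symmetric]
    finally have 1: "(g has_sum theta_corr 0 s * theta_corr 1 t) {(i, j). even (i + j)}" .
    have "((\<lambda>(m, n). - ((theta_term (- s) m * theta_term (- s) (m + 1))
        * (theta_term (- t) n * theta_term (- t) (n + 0))))
        has_sum - (theta_corr 1 s * theta_corr 0 t)) UNIV"
      using has_sum_uminusI[OF has_sum_times[OF theta_corr_has_sum[of s 1]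
          theta_corr_has_sum[of t 0]]] by (simp add: case_prod_unfold)
    also have "(\<lambda>(m, n). - ((theta_term (- s) m * theta_term (- s) (m + 1))
        * (theta_term (- t) n * theta_term (- t) (n + 0)))) = (\<lambda>(m, n). g (m - n + 1, m + n))"
    proof (safe intro!: ext)
      fix m n
      have e: "tri (m - n + 1) + tri (m + n) = (tri m + (tri m + m)) + (tri n + tri n)"
        "m - n + 1 + (m + n) = m + m + 1" "m + n - (m - n + 1) = n + n - 1"
        by (simp_all add: tri_add tri_diff)
      show "- ((theta_term (- s) m * theta_term (- s) (m + 1))
          * (theta_term (- t) n * theta_term (- t) (n + 0))) = g (m - n + 1, m + n)"
      proof -
        have 1: "t * t powi (n + n - 1) = t powi n * t powi n"
          using assms by (simp add: power_int_diff powi_double)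
        have 2: "s powi (m + m + 1) = s powi m * s powi m * s"
          using assms by (simp add: power_int_add powi_double)
        have "(-1) powi m * (-1) powi m = (1::complex)"
          by (rule minus_one_powi_square)
        then have 3: "(-1) powi (m + m + 1) = (-1::complex)"
          by (simp add: power_int_add powi_double)
        have 4: "q powi ((tri m + (tri m + m)) + (tri n + tri n))
            = q powi tri m * (q powi tri m * q powi m) * (q powi tri n * q powi tri n)"
          by (simp only: q_add)
        have 5: "theta_term (- s) (m + 1) = q powi tri m * q powi m * (s powi m * s)"
          using assms by (simp add: theta_term_def tri_add power_int_add)
        have "g (m - n + 1, m + n) = q powi ((tri m + (tri m + m)) + (tri n + tri n))
            * (-1) powi (m + m + 1) * s powi (m + m + 1) * (t * t powi (n + n - 1))"
          unfolding g_def prod.case theta_term_product[OF assms] e by (simp only: mult_ac)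
        then show ?thesis unfolding 1 2 3 4 5 by (simp add: theta_term_def mult_ac)
      qed
    qed
    also note has_sum_odd_pairs[symmetric]
    finally have "(g has_sum - (theta_corr 1 s * theta_corr 0 t)) {(i, j). odd (i + j)}" .
    with 1 have "(g has_sum theta_corr 0 s * theta_corr 1 t + - (theta_corr 1 s * theta_corr 0 t))
        ({(i, j). even (i + j)} \<union> {(i, j). odd (i + j)})"
      by (rule has_sum_Un_disjoint) auto
    moreover have "{(i, j). even (i + j)} \<union> {(i, j). odd (i + j)} = (UNIV :: (int \<times> int) set)"
        by auto
    ultimately show ?thesis by (simp add: casoratian_def)
  qed
  ultimately have "t * ((pinf q * theta (s / t)) * (pinf q * theta (s * t))) = casoratian s t"
      by (rule has_sum_unique)
  then show ?thesis by (simp add: power2_eq_square mult_ac)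
qed

text \<open>Three vectors in a space of dimension two are dependent, with the minors as coefficients.
  For \<open>k = 0\<close> and \<open>k = 1\<close> this is the expansion of a determinant with a repeated row; the
  recursion in \<open>k\<close> has a factor that does not depend on the argument, so it propagates the
  relation.\<close>

lemma theta_corr_three_term:
  assumes "a \<noteq> 0" "b \<noteq> 0" "c \<noteq> 0"
  shows "theta_corr (int k) a * casoratian b c + theta_corr (int k) b * casoratian c a
      + theta_corr (int k) c * casoratian a b = 0"
proof (induction k rule: nat_induct2)
  case (step k)
  have "theta_corr (int (k + 2)) z = q powi (int k + 1) * theta_corr (int k) z" if "z \<noteq> 0" for z
    using theta_corr_rec[OF that, of "int k"] by (simp add: add.commute)
  then have "theta_corr (int (k + 2)) a * casoratian b c + theta_corr (int (k + 2)) b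
      * casoratian c a + theta_corr (int (k + 2)) c * casoratian a b
    = q powi (int k + 1) * (theta_corr (int k) a * casoratian b c + theta_corr (int k) b
        * casoratian c a + theta_corr (int k) c * casoratian a b)"
    using assms by (simp add: distrib_left mult.assoc)
  then show ?case using step by simp
qed (simp_all add: casoratian_def algebra_simps)

lemma theta_pair_three_term_param:
  assumes "p \<noteq> 0" "a \<noteq> 0" "b \<noteq> 0" "c \<noteq> 0"
  shows "theta_pair (p * a) (p / a) * casoratian b c + theta_pair (p * b) (p / b) * casoratian c a
      + theta_pair (p * c) (p / c) * casoratian a b = 0"
proof -
  have "((\<lambda>k. (- 1 / p) powi k * (inv_poch k * theta_corr k a) * casoratian b c + (- 1 / p) powi k
      * (inv_poch k * theta_corr k b) * casoratian c a
      + (- 1 / p) powi k * (inv_poch k * theta_corr k c) * casoratian a b) has_sum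
      theta_pair (p * a) (p / a) * casoratian b c + theta_pair (p * b) (p / b) * casoratian c a
          + theta_pair (p * c) (p / c) * casoratian a b) UNIV"
    by (intro has_sum_add has_sum_cmult_left theta_pair_param assms)
  moreover have "(- 1 / p) powi k * (inv_poch k * theta_corr k a) * casoratian b c
      + (- 1 / p) powi k * (inv_poch k * theta_corr k b) * casoratian c a
      + (- 1 / p) powi k * (inv_poch k * theta_corr k c) * casoratian a b = 0" for k
  proof (cases "k < 0")
    case False
    then have "theta_corr k a * casoratian b c + theta_corr k b * casoratian c a + theta_corr k c
        * casoratian a b = 0"
      using theta_corr_three_term[OF assms(2-4), of "nat k"] by simp
    then have "(- 1 / p) powi k * inv_poch k
        * (theta_corr k a * casoratian b c + theta_corr k b * casoratian c a + theta_corr k c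
        * casoratian a b) = 0" by simp
    then show ?thesis by (simp add: algebra_simps)
  qed simp
  ultimately have "((\<lambda>k::int. 0)
      has_sum theta_pair (p * a) (p / a) * casoratian b c + theta_pair (p * b) (p / b)
      * casoratian c a + theta_pair (p * c) (p / c) * casoratian a b) UNIV"
    by (simp only:)
  then show ?thesis by (rule has_sum_unique) (rule has_sum_0_simp)
qed

text \<open>The relation between the points \<open>s\<close>, \<open>s / c1\<close> and \<open>s / c2\<close>, where \<open>s\<^sup>2 = x / y\<close>; these
  scalings replace \<open>(x, y)\<close> by \<open>(x / c1, y * c1)\<close> and \<open>(x / c2, y * c2)\<close> and keep the product.\<close>

lemma theta_pair_three_term:
  assumes nz: "x \<noteq> 0" "y \<noteq> 0" "c1 \<noteq> 0" "c2 \<noteq> 0"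
  shows "y * theta_pair x y * (theta (c2 / c1) * theta (c1 * c2 * y / x))
    = (y * c1) * theta_pair (x / c1) (y * c1) * (theta (c2 * y / x) * theta c2)
      - c2 / c1 * ((y * c2) * theta_pair (x / c2) (y * c2) * (theta (c1 * y / x) * theta c1))"
proof -
  define s where "s = csqrt (x / y)"
  have s2: "s\<^sup>2 = x / y" by (simp add: s_def)
  have s: "s \<noteq> 0" using nz by (simp add: s_def)
  have ys: "y * s * s = x" using s2 nz by (simp add: power2_eq_square mult.assoc)
  have "theta_pair (y * s * s) (y * s / s) * casoratian (s / c1) (s / c2)
      + theta_pair (y * s * (s / c1)) (y * s / (s / c1)) * casoratian (s / c2) s
      + theta_pair (y * s * (s / c2)) (y * s / (s / c2)) * casoratian s (s / c1) = 0"
    using nz s by (intro theta_pair_three_term_param) auto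
  then have 0: "theta_pair x y * casoratian (s / c1) (s / c2) + theta_pair (x / c1) (y * c1)
      * casoratian (s / c2) s + theta_pair (x / c2) (y * c2) * casoratian s (s / c1) = 0"
    using s ys by simp
  have th: "theta (s * s / c) = - theta (c * y / x) * x / (c * y)" if "c \<noteq> 0" for c
  proof -
    have "s * s / c = 1 / (c * y / x)" using that nz s2
        by (simp add: power2_eq_square field_simps)
    then show ?thesis using theta_inverse[of "c * y / x"] nz that by simp
  qed
  have 1: "casoratian (s / c1) (s / c2)
      = - (s * (pinf q)\<^sup>2 * (x / y)) / (c1 * c2\<^sup>2) * (theta (c2 / c1) * theta (c1 * c2 * y / x))"
    using casoratian_eq_theta[of "s / c1" "s / c2"] th[of "c1 * c2"] s nz
        by (simp add: power2_eq_square mult_ac)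
  have 2: "casoratian (s / c2) s
      = s * (pinf q)\<^sup>2 * (x / y) / c2\<^sup>2 * (theta (c2 * y / x) * theta c2)"
    using casoratian_eq_theta[of "s / c2" s] th[of c2] theta_inverse[of c2] s nz
        by (simp add: power2_eq_square mult_ac)
  have 3: "casoratian s (s / c1)
      = - (s * (pinf q)\<^sup>2 * (x / y)) / c1\<^sup>2 * (theta (c1 * y / x) * theta c1)"
    using casoratian_eq_theta[of s "s / c1"] th[of c1] s nz
        by (simp add: power2_eq_square mult_ac)
  define A where "A = s * (pinf q)\<^sup>2 * (x / y)"
  have A: "A \<noteq> 0" using s nz by (simp add: A_def)
  \<comment> \<open>The three products of the relation, without the common factor \<open>A\<close> of the minors.\<close>
  define T0 T1 T2 where "T0 = theta_pair x y * (theta (c2 / c1) * theta (c1 * c2 * y / x))"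
    and "T1 = theta_pair (x / c1) (y * c1) * (theta (c2 * y / x) * theta c2)"
    and "T2 = theta_pair (x / c2) (y * c2) * (theta (c1 * y / x) * theta c1)"
  have "- (A / (c1 * c2\<^sup>2)) * (T0 - c1 * T1 + c2\<^sup>2 / c1 * T2)
      = T0 * (- A / (c1 * c2\<^sup>2)) + T1 * (A / c2\<^sup>2) + T2 * (- A / c1\<^sup>2)"
    using nz by (simp add: field_simps power2_eq_square)
  also have "\<dots> = 0"
    using 0 unfolding 1 2 3 A_def[symmetric] T0_def T1_def T2_def by (simp add: mult_ac)
  finally have "- (A / (c1 * c2\<^sup>2)) * (T0 - c1 * T1 + c2\<^sup>2 / c1 * T2) = 0" .
  moreover have "- (A / (c1 * c2\<^sup>2)) \<noteq> 0" using A nz by simp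
  ultimately have "T0 - c1 * T1 + c2\<^sup>2 / c1 * T2 = 0" by (metis mult_eq_0_iff)
  then have "T0 = c1 * T1 - c2\<^sup>2 / c1 * T2" by (simp add: algebra_simps)
  then have "y * T0 = y * (c1 * T1 - c2\<^sup>2 / c1 * T2)" by (simp only:)
  also have "\<dots> = y * c1 * T1 - c2 / c1 * (y * c2 * T2)"
    by (simp add: right_diff_distrib power2_eq_square mult_ac)
  finally have "y * T0 = y * c1 * T1 - c2 / c1 * (y * c2 * T2)" .
  then show ?thesis by (simp add: T0_def T1_def T2_def mult_ac)
qed

section \<open>The quintuple product\<close>

text \<open>Since \<open>tri n \<ge> 0\<close>, raising the exponent only makes the terms of a theta series smaller.\<close>

lemma quadratic_exponent_summable:
  assumes "c \<ge> 1"
  shows "(\<lambda>n. q powi (c * tri n) * u powi n) summable_on UNIV"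
proof -
  have "(\<lambda>n. theta_term (- u) n * q powi ((c - 1) * tri n)) summable_on UNIV"
  proof (rule summable_on_bounded_factor[OF theta_term_summable])
    show "norm (q powi ((c - 1) * tri n)) \<le> 1" for n
      using assms tri_nonneg[of n] norm_q
          by (auto simp: norm_power_int intro!: power_int_le_one mult_nonneg_nonneg)
  qed
  moreover have "theta_term (- u) n * q powi ((c - 1) * tri n)
      = q powi (c * tri n) * u powi n" for n
  proof -
    have "c * tri n = tri n + (c - 1) * tri n" by (simp add: algebra_simps)
    then show ?thesis by (simp only: q_add theta_term_def minus_minus mult_ac)
  qed
  ultimately show ?thesis by simp
qed

lemma pinf_cube_split: "pinf q
    = qpoch_inf (q ^ 3) q * qpoch_inf (q ^ 3) (q ^ 2) * qpoch_inf (q ^ 3) (q ^ 3)"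
proof -
  interpret q3: nome "q ^ 3"
    using norm_q by unfold_locales (auto simp: norm_power power_less_one_iff)
  have "(\<Prod>k<n * 3. 1 - q * q ^ k) = (\<Prod>k<n. 1 - q * (q ^ 3) ^ k) * (\<Prod>k<n. 1 - q ^ 2 * (q ^ 3) ^ k)
      * (\<Prod>k<n. 1 - q ^ 3 * (q ^ 3) ^ k)" for n
  proof (induction n)
    case (Suc n)
    have "Suc n * 3 = Suc (Suc (Suc (n * 3)))" by simp
    moreover have "q ^ (n * 3) = (q ^ 3) ^ n" by (simp add: mult.commute flip: power_mult)
    then have "q * q ^ (n * 3) = q * (q ^ 3) ^ n" "q * q ^ Suc (n * 3) = q ^ 2 * (q ^ 3) ^ n"
      "q * q ^ Suc (Suc (n * 3)) = q ^ 3 * (q ^ 3) ^ n"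
      by (simp_all add: power2_eq_square power3_eq_cube mult.assoc)
    ultimately show ?case by (simp only: prod.lessThan_Suc Suc mult_ac)
  qed simp
  then have "(\<lambda>n. \<Prod>k<n * 3. 1 - q * q ^ k) \<longlonglongrightarrow>
      qpoch_inf (q ^ 3) q * qpoch_inf (q ^ 3) (q ^ 2) * qpoch_inf (q ^ 3) (q ^ 3)"
    by (simp only:) (intro tendsto_intros q3.pinf_LIMSEQ)
  moreover have "(\<lambda>n. \<Prod>k<n * 3. 1 - q * q ^ k) \<longlonglongrightarrow> pinf q"
    using LIMSEQ_subseq_LIMSEQ[OF pinf_LIMSEQ[of q], of "\<lambda>n. n * 3"]
    by (simp add: strict_mono_def o_def)
  ultimately show ?thesis by (metis LIMSEQ_unique)
qed

text \<open>The inner sums in the proof of the quintuple product. They are theta series in base \<open>q\<^sup>3\<close> at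
  the arguments \<open>q\<close>, \<open>1 / q\<close> and \<open>1 / q\<^sup>3\<close>: the first is the pentagonal number theorem, the second
  follows by inversion, and the third vanishes.\<close>

lemma pentagonal_class_sums:
  fixes \<rho> :: int
  assumes "\<rho> \<in> {0, 1, 2}"
  shows "((\<lambda>k. (-1) powi k * q powi (3 * tri k + (1 - 2 * \<rho>) * k)) has_sum
      (if \<rho> = 0 then pinf q else if \<rho> = 1 then - pinf q / q else 0)) UNIV"
proof -
  interpret q3: nome "q ^ 3"
    using norm_q by unfold_locales (auto simp: norm_power power_less_one_iff)
  define u where "u = q powi (1 - 2 * \<rho>)"
  have "(q3.theta_term u has_sum qpoch_inf (q ^ 3) (q ^ 3) * qtheta (q ^ 3) u) UNIV"
    by (intro q3.jacobi_triple_product) (simp add: u_def)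
  moreover have "q3.theta_term u = (\<lambda>k. (-1) powi k * q powi (3 * tri k + (1 - 2 * \<rho>) * k))"
    unfolding q3.theta_term_def minus_powi[of u] fun_eq_iff
        by (simp add: u_def q_add power_int_mult)
  moreover have th: "qpoch_inf (q ^ 3) (q ^ 3) * qtheta (q ^ 3) q = pinf q"
    unfolding q3.theta_eq_pinf pinf_cube_split by (simp add: power2_eq_square power3_eq_cube)
  have "qpoch_inf (q ^ 3) (q ^ 3) * qtheta (q ^ 3) u
      = (if \<rho> = 0 then pinf q else if \<rho> = 1 then - pinf q / q else 0)"
  proof -
    have "u = q" if "\<rho> = 0" using that by (simp add: u_def)
    moreover have "u = 1 / q" if "\<rho> = 1" using that by (simp add: u_def power_int_minus_divide)
    moreover have "u = 1 / q ^ 3" if "\<rho> = 2" using that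
        by (simp add: u_def power_int_minus_divide)
    moreover have "qpoch_inf (q ^ 3) (q ^ 3) * qtheta (q ^ 3) (1 / q) = - pinf q / q"
      using th q3.theta_inverse[of q] by simp
    moreover have "qtheta (q ^ 3) (1 / q ^ 3) = 0"
      using q3.theta_q_mult[of "1 / q ^ 3"] by simp
    ultimately show ?thesis using assms th by auto
  qed
  ultimately show ?thesis by (simp only:)
qed

text \<open>Up to the factor \<open>(q\<^sup>2; q\<^sup>2)\<^sub>\<infinity>\<close>, the theta function of \<open>- w\<close> in base \<open>q\<^sup>2\<close>.\<close>

definition theta_q2 :: "complex \<Rightarrow> complex" where
  "theta_q2 w = (\<Sum>\<^sub>\<infinity>n. q powi (2 * tri n) * w powi n)"

lemma theta_q2_has_sum: "((\<lambda>n. q powi (2 * tri n) * w powi n) has_sum theta_q2 w) UNIV"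
  unfolding theta_q2_def by (intro has_sum_infsum quadratic_exponent_summable) simp

lemma theta_corr_eq_theta_q2: "s \<noteq> 0 \<Longrightarrow> theta_corr 0 s = theta_q2 (s\<^sup>2)" "s \<noteq> 0 \<Longrightarrow> theta_corr 1 s
    = s * theta_q2 (q * s\<^sup>2)"
proof -
  assume s: "s \<noteq> 0"
  have "theta_term (- s) n * theta_term (- s) (n + 0) = q powi (2 * tri n) * (s\<^sup>2) powi n" for n
    by (simp add: theta_term_def powi_double power2_eq_square power_int_mult_distrib)
  with theta_corr_has_sum[of s 0] theta_q2_has_sum[of "s\<^sup>2"] show "theta_corr 0 s
      = theta_q2 (s\<^sup>2)"
    by (simp only: has_sum_unique)
  have "theta_term (- s) n * theta_term (- s) (n + 1)
      = s * (q powi (2 * tri n) * (q * s\<^sup>2) powi n)" for n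
    using s by (simp add: theta_term_def tri_add power_int_add powi_double power2_eq_square
        power_int_mult_distrib)
  with theta_corr_has_sum[of s 1]
      has_sum_cmult_right[OF theta_q2_has_sum[of "q * s\<^sup>2"], of s] show "theta_corr 1 s
      = s * theta_q2 (q * s\<^sup>2)"
    by (simp only: has_sum_unique)
qed

text \<open>Multiply the theta series of \<open>w / q\<close> and of \<open>theta_q2 w\<close> and split by the total degree
  \<open>m + n\<close> modulo 3. On the class \<open>\<rho>\<close> the double sum factors into the single series \<open>A \<rho>\<close> in \<open>w\<close>
  and a pentagonal class sum; the class 2 contributes nothing, and the classes 0 and 1 combine to
  the factor \<open>1 - w * q powi (2 * n - 1)\<close>.\<close>

theorem quintuple_product:
  assumes w: "w \<noteq> 0"
  shows "((\<lambda>n. w powi (3 * n) * q powi (6 * tri n - n) * (1 - w * q powi (2 * n - 1))) has_sum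
      theta (w / q) * theta_q2 w) UNIV"
proof -
  define A where "A \<rho> i = w powi (3 * i + \<rho>) * q powi (6 * tri i + (2 * \<rho> - 1) * i + \<rho> * (\<rho> - 1))"
      for \<rho> i :: int
  have A: "A \<rho> summable_on UNIV" for \<rho>
  proof -
    have "(\<lambda>i. w powi \<rho> * q powi (\<rho> * (\<rho> - 1))
        * (q powi (6 * tri i) * (w ^ 3 * q powi (2 * \<rho> - 1)) powi i)) summable_on UNIV"
      by (intro summable_on_cmult_right quadratic_exponent_summable) simp
    moreover have "w powi \<rho> * q powi (\<rho> * (\<rho> - 1))
        * (q powi (6 * tri i) * (w ^ 3 * q powi (2 * \<rho> - 1)) powi i) = A \<rho> i" for i
    proof -
      have 1: "w powi (3 * i + \<rho>) = (w ^ 3) powi i * w powi \<rho>"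
        using w by (simp add: power_int_add power_int_power)
      have 2: "q powi ((2 * \<rho> - 1) * i) = (q powi (2 * \<rho> - 1)) powi i"
        by (simp only: power_int_mult)
      show ?thesis
        unfolding A_def q_add power_int_mult_distrib 1 2 by (simp only: mult_ac)
    qed
    ultimately show ?thesis by (simp only:)
  qed
  define g where "g = (\<lambda>(m, n). theta_term (w / q) m * (q powi (2 * tri n) * w powi n))"
  have "(g has_sum (pinf q * theta (w / q)) * theta_q2 w) UNIV"
    unfolding g_def using w by (intro has_sum_times jacobi_triple_product theta_q2_has_sum) simp
  moreover have cls: "(g has_sum infsum (A \<rho>) UNIV * (if \<rho> = 0 then pinf q else if \<rho>
      = 1 then - pinf q / q else 0))
      {(m, n). (m + n) mod 3 = \<rho>}" if "\<rho> \<in> {0, 1, 2}" for \<rho>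
  proof -
    have "g (k + 2 * i, i + \<rho> - k)
        = A \<rho> i * ((-1) powi k * q powi (3 * tri k + (1 - 2 * \<rho>) * k))" for i k
    proof -
      have "2 * (tri (k + 2 * i) - (k + 2 * i) + 2 * tri (i + \<rho> - k))
        = 2 * (6 * tri i + (2 * \<rho> - 1) * i + \<rho> * (\<rho> - 1) + (3 * tri k + (1 - 2 * \<rho>) * k))"
        using two_tri[of "k + 2 * i"] two_tri[of "i + \<rho> - k"] two_tri[of i] two_tri[of k]
        by (simp add: algebra_simps)
      then have e: "tri (k + 2 * i) - (k + 2 * i) + 2 * tri (i + \<rho> - k)
        = 6 * tri i + (2 * \<rho> - 1) * i + \<rho> * (\<rho> - 1) + (3 * tri k + (1 - 2 * \<rho>) * k)" by simp
      have sg: "(-1) powi (k + 2 * i) = ((-1) powi k :: complex)"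
        by (simp add: power_int_add power_int_mult)
      have "w powi (k + 2 * i) * w powi (i + \<rho> - k) = w powi (3 * i + \<rho>)"
        using w by (simp flip: power_int_add)
      moreover have "g (k + 2 * i, i + \<rho> - k) = (-1) powi (k + 2 * i)
          * q powi (tri (k + 2 * i) - (k + 2 * i) + 2 * tri (i + \<rho> - k))
              * (w powi (k + 2 * i) * w powi (i + \<rho> - k))"
        unfolding g_def prod.case theta_term_def minus_powi[of "w / q"] power_int_divide_distrib
        by (simp add: q_add power_int_diff)
      ultimately show ?thesis unfolding e sg A_def by (simp add: q_add mult_ac)
    qed
    moreover have "((\<lambda>(i, k). A \<rho> i * ((-1) powi k * q powi (3 * tri k + (1 - 2 * \<rho>) * k)))
        has_sum
       infsum (A \<rho>) UNIV * (if \<rho> = 0 then pinf q else if \<rho> = 1 then - pinf q / q else 0)) UNIV"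
      by (intro has_sum_times has_sum_infsum A pentagonal_class_sums that)
    ultimately show ?thesis
      using that by (subst has_sum_mod_3_class) auto
  qed
  have all: "(g has_sum infsum (A 0) UNIV * pinf q + infsum (A 1) UNIV * (- pinf q / q)
      + infsum (A 2) UNIV * 0)
      ({(m, n). (m + n) mod 3 = 0} \<union> {(m, n). (m + n) mod 3 = 1} \<union> {(m, n). (m + n) mod 3 = 2})"
    using cls[of 0] cls[of 1] cls[of 2] by (intro has_sum_Un_disjoint) auto
  have univ: "{(m, n). (m + n) mod 3 = 0} \<union> {(m, n). (m + n) mod 3 = 1} \<union> {(m, n). (m + n) mod 3
      = (2::int)} = UNIV"
    by auto
  from all have "(g has_sum infsum (A 0) UNIV * pinf q + infsum (A 1) UNIV * (- pinf q / q)
      + infsum (A 2) UNIV * 0) UNIV"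
    unfolding univ .
  ultimately have "(pinf q * theta (w / q)) * theta_q2 w
      = infsum (A 0) UNIV * pinf q + infsum (A 1) UNIV * (- pinf q / q) + infsum (A 2) UNIV * 0"
    by (rule has_sum_unique)
  then have "pinf q * (theta (w / q) * theta_q2 w)
      = pinf q * (infsum (A 0) UNIV - 1 / q * infsum (A 1) UNIV)"
    by (simp add: algebra_simps)
  then have "theta (w / q) * theta_q2 w = infsum (A 0) UNIV - 1 / q * infsum (A 1) UNIV"
    by (simp del: mult_cancel_left add: mult_left_cancel)
  moreover have "((\<lambda>n. A 0 n - 1 / q * A 1 n)
      has_sum infsum (A 0) UNIV - 1 / q * infsum (A 1) UNIV) UNIV"
    by (intro has_sum_diff has_sum_cmult_right has_sum_infsum A)
  moreover have "A 0 n - 1 / q * A 1 n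
      = w powi (3 * n) * q powi (6 * tri n - n) * (1 - w * q powi (2 * n - 1))" for n
  proof -
    have "6 * tri n + n = (6 * tri n - n) + (2 * n - 1) + 1" by simp
    then have "q powi (6 * tri n + n) = q powi (6 * tri n - n) * q powi (2 * n - 1) * q"
      by (simp only: q_add power_int_1_right)
    then show ?thesis using w by (simp add: A_def power_int_add algebra_simps)
  qed
  ultimately show ?thesis by simp
qed

section \<open>The very-well-poised bilateral series\<close>

text \<open>At \<open>z = - 1 / p\<close> and \<open>t = s * q powi n\<close> with \<open>x = p * s\<close> and \<open>y = p / s\<close> this is the product
  \<open>pinf (q powi n / y) * pinf (q powi (1 - n) / x)\<close> that occurs in the very-well-poised series.
  The parameter \<open>z\<close> makes that series a power series in \<open>z\<close>.\<close>

definition pinf_pair :: "complex \<Rightarrow> complex \<Rightarrow> complex" where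
  "pinf_pair z t = pinf (- z * t) * pinf (- z * q / t)"

text \<open>The coefficient of the quintuple product at \<open>w = s\<^sup>2\<close>; also the weight of the
  very-well-poised series.\<close>

definition quint_coeff :: "complex \<Rightarrow> int \<Rightarrow> complex" where
  "quint_coeff s n = s powi (6 * n) * q powi (6 * tri n - n)"

definition pinf_pair_term :: "complex \<Rightarrow> complex \<Rightarrow> int \<Rightarrow> int \<Rightarrow> complex" where
  "pinf_pair_term z t k l = (theta_term (- z * t) k * inv_poch k)
      * (theta_term (- z * q / t) l * inv_poch l)"

lemma pinf_pair_has_sum: "((\<lambda>(k, l). pinf_pair_term z t k l) has_sum pinf_pair z t) UNIV"
  unfolding pinf_pair_def pinf_pair_term_def by (intro has_sum_times euler_pinf)

text \<open>In the indices \<open>(n, k + n, l - n)\<close> the exponent becomes a sum of three separate quadratic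
  terms, so the triple series is a product of three theta-like series times the bounded factor
  \<open>inv_poch k * inv_poch l\<close>.\<close>

lemma vwp_triple_summable:
  assumes z: "z \<noteq> 0" and s: "s \<noteq> 0"
  shows "(\<lambda>(n, k, l). quint_coeff s n * (s * q powi n) powi a
      * pinf_pair_term z (s * q powi n) k l) summable_on (UNIV \<times> UNIV)"
proof -
  \<comment> \<open>What remains of \<open>quint_coeff s n * (s * q powi n) powi a\<close>, up to \<open>s powi a\<close>, after the two
    theta terms at \<open>n\<close> have been split off.\<close>
  define u where "u = s ^ 4 * q powi (a - 1)"
  define h where "h = (\<lambda>(n, k, l). (q powi (4 * tri n) * u powi n)
      * (theta_term (- z * s) k * theta_term (- z * q / s) l))"
  have "h summable_on UNIV"
    unfolding h_def
    using summable_on_times[OF quadratic_exponent_summable[of 4 u]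
        summable_on_times[OF theta_term_summable theta_term_summable], of "- z * s" "- z * q / s"]
    by (simp add: case_prod_unfold)
  also have "h summable_on UNIV \<longleftrightarrow> (\<lambda>(n, k, l). h (n, k + n, l - n)) summable_on (UNIV \<times> UNIV)"
    by (rule summable_on_reindex_bij_witness[of _ "\<lambda>(n, k, l). (n, k + n, l - n)"
        "\<lambda>(n, k, l). (n, k - n, l + n)"]) auto
  finally have h: "(\<lambda>(n, k, l). h (n, k + n, l - n)) summable_on (UNIV \<times> UNIV)" .
  obtain C where C: "C > 0" "\<And>k. norm (inv_poch k) \<le> C" using inv_poch_bounded by blast
  have "(\<lambda>p. (case p of (n, k, l) \<Rightarrow> h (n, k + n, l - n))
      * (case p of (n, k, l) \<Rightarrow> s powi a * (inv_poch k * inv_poch l)))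
      summable_on (UNIV \<times> UNIV)"
  proof (rule summable_on_bounded_factor[OF h, where C = "norm (s powi a) * (C * C)"])
    fix p :: "int \<times> int \<times> int"
    show "norm (case p of (n, k, l) \<Rightarrow> s powi a * (inv_poch k * inv_poch l)) \<le> norm (s powi a)
        * (C * C)"
      using C by (auto simp: norm_mult intro!: mult_left_mono mult_mono less_imp_le[OF C(1)]
          split: prod.split)
  qed
  moreover have "h (n, k + n, l - n) * (s powi a * (inv_poch k * inv_poch l))
      = quint_coeff s n * (s * q powi n) powi a * pinf_pair_term z (s * q powi n) k l" for n k l
  proof -
    have 1: "theta_term (- z * s) (k + n)
        = theta_term (- z * s) n * theta_term (- z * (s * q powi n)) k"
      using theta_term_add[of "- z * s" n k] z s by (simp add: add.commute mult_ac)
    have 2: "theta_term (- z * q / s) (l - n)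
        = theta_term (- s / z) n * theta_term (- z * q / (s * q powi n)) l"
      using theta_term_add[of "- z * q / s" "- n" l] z s
      by (simp add: add.commute power_int_minus_divide theta_term_uminus[of _ n] field_simps)
    have 3: "theta_term (- z * s) n * theta_term (- s / z) n
        = q powi (2 * tri n) * s powi (2 * n)"
    proof -
      have 1: "(z * s) powi n * (s / z) powi n = s powi n * s powi n"
        unfolding power_int_mult_distrib[symmetric] using z by simp
      have "theta_term (- z * s) n * theta_term (- s / z) n
          = (q powi tri n * q powi tri n) * ((z * s) powi n * (s / z) powi n)"
        by (simp add: theta_term_def mult_ac)
      then show ?thesis unfolding 1 powi_double .
    qed
    have 4: "q powi (4 * tri n) * u powi n * (q powi (2 * tri n) * s powi (2 * n)) * s powi a
        = quint_coeff s n * (s * q powi n) powi a"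
    proof -
      have "4 * tri n + ((a - 1) * n + 2 * tri n) = (6 * tri n - n) + n * a"
          by (simp add: algebra_simps)
      then have e: "q powi (4 * tri n) * ((q powi (a - 1)) powi n * q powi (2 * tri n))
          = q powi (6 * tri n - n) * (q powi n) powi a"
        by (simp only: flip: q_add power_int_mult)
      have "(s ^ 4) powi n * s powi (2 * n) = s powi (6 * n)"
        using s by (simp add: power_int_power flip: power_int_add)
      then have "quint_coeff s n * (s * q powi n) powi a
          = (s ^ 4) powi n * s powi (2 * n) * s powi a
          * (q powi (6 * tri n - n) * (q powi n) powi a)"
        by (simp add: quint_coeff_def power_int_mult_distrib mult_ac)
      then show ?thesis unfolding e[symmetric] u_def power_int_mult_distrib
          by (simp only: mult_ac)
    qed
    have "h (n, k + n, l - n) * (s powi a * (inv_poch k * inv_poch l))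
      = q powi (4 * tri n) * u powi n * (theta_term (- z * s) n * theta_term (- s / z) n)
          * s powi a * pinf_pair_term z (s * q powi n) k l"
      unfolding h_def prod.case 1 2 pinf_pair_term_def by (simp only: mult_ac)
    then show ?thesis unfolding 3 4 .
  qed
  ultimately show ?thesis by (simp add: case_prod_unfold)
qed

definition vwp_moment :: "complex \<Rightarrow> int \<Rightarrow> complex \<Rightarrow> complex" where
  "vwp_moment s a z = (\<Sum>\<^sub>\<infinity>n. quint_coeff s n * (s * q powi n) powi a
      * pinf_pair z (s * q powi n))"

lemma vwp_moment_has_sum:
  assumes "z \<noteq> 0" and "s \<noteq> 0"
  shows "((\<lambda>n. quint_coeff s n * (s * q powi n) powi a * pinf_pair z (s * q powi n))
      has_sum vwp_moment s a z) UNIV"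
    and "((\<lambda>(n, k, l). quint_coeff s n * (s * q powi n) powi a
        * pinf_pair_term z (s * q powi n) k l) has_sum vwp_moment s a z) (UNIV \<times> UNIV)"
proof -
  let ?f = "\<lambda>(n, k, l). quint_coeff s n * (s * q powi n) powi a
      * pinf_pair_term z (s * q powi n) k l"
  have f: "(?f has_sum infsum ?f (UNIV \<times> UNIV)) (UNIV \<times> UNIV)"
    by (intro has_sum_infsum vwp_triple_summable assms)
  have "((\<lambda>n. quint_coeff s n * (s * q powi n) powi a * pinf_pair z (s * q powi n))
      has_sum infsum ?f (UNIV \<times> UNIV)) UNIV"
  proof (rule has_sum_SigmaD[OF f])
    show "((\<lambda>y. ?f (n, y)) has_sum quint_coeff s n * (s * q powi n) powi a
        * pinf_pair z (s * q powi n)) UNIV" for n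
      using has_sum_cmult_right[OF pinf_pair_has_sum] by (simp add: case_prod_unfold)
  qed
  moreover from this have "vwp_moment s a z = infsum ?f (UNIV \<times> UNIV)"
    unfolding vwp_moment_def by (rule infsumI)
  ultimately show "((\<lambda>n. quint_coeff s n * (s * q powi n) powi a * pinf_pair z (s * q powi n))
      has_sum vwp_moment s a z) UNIV"
    and "(?f has_sum vwp_moment s a z) (UNIV \<times> UNIV)"
    using f by simp_all
qed

text \<open>The very-well-poised series as a function of \<open>s\<close> and \<open>z\<close>: the weight
  \<open>1 - (s * q powi n)\<^sup>2 / q\<close> is distributed over two moments.\<close>

definition vwp_sum :: "complex \<Rightarrow> complex \<Rightarrow> complex" where
  "vwp_sum s z = vwp_moment s 0 z - vwp_moment s 2 z / q"

lemma vwp_sum_has_sum: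
  assumes "z \<noteq> 0" and "s \<noteq> 0"
  shows "((\<lambda>n. quint_coeff s n * (1 - (s * q powi n)\<^sup>2 / q) * pinf_pair z (s * q powi n))
      has_sum vwp_sum s z) UNIV"
    and "((\<lambda>(n, k, l). quint_coeff s n * (1 - (s * q powi n)\<^sup>2 / q)
        * pinf_pair_term z (s * q powi n) k l) has_sum vwp_sum s z) (UNIV \<times> UNIV)"
  unfolding vwp_sum_def
  using has_sum_diff[OF vwp_moment_has_sum(1)[OF assms, of 0]
      has_sum_cmult_right[OF vwp_moment_has_sum(1)[OF assms, of 2], of "1 / q"]]
    has_sum_diff[OF vwp_moment_has_sum(2)[OF assms, of 0]
        has_sum_cmult_right[OF vwp_moment_has_sum(2)[OF assms, of 2], of "1 / q"]]
  by (simp_all add: case_prod_unfold algebra_simps)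

lemma pinf_pair_q_step:
  assumes "t \<noteq> 0"
  shows "pinf_pair z t = (1 + z * t) * (1 + z * q / t) * pinf_pair (q * z) t"
  unfolding pinf_pair_def using pinf_rec[of "- z * t"] pinf_rec[of "- z * q / t"]
      by (simp add: mult_ac)

text \<open>The certificate, in the manner of Wilf and Zeilberger, for the q-difference equation of
  \<open>vwp_sum\<close> in \<open>z\<close>.\<close>

definition telescoper :: "complex \<Rightarrow> complex \<Rightarrow> complex" where
  "telescoper z t = - (q\<^sup>2 / t\<^sup>2) * (1 + z * q * t) * pinf_pair (q\<^sup>2 * z) t"

text \<open>The factor \<open>t ^ 6 / q\<close> is the ratio of consecutive values of \<open>quint_coeff\<close> at
  \<open>t = s * q powi n\<close>, so after multiplication by \<open>quint_coeff s n\<close> the right side is a difference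
  in \<open>n\<close>. Since every value of \<open>pinf_pair\<close> that occurs is a rational multiple of the common factor
  \<open>E\<close> below, the identity is one of rational functions.\<close>

lemma telescoper_identity:
  assumes t: "t \<noteq> 0"
  shows "(1 - t\<^sup>2 / q) * (pinf_pair z t - (1 + 1 / q) * pinf_pair (q * z) t
      + pinf_pair (q\<^sup>2 * z) t / q - q * z\<^sup>2 * pinf_pair (q * z) t)
    = q * z\<^sup>2 * (t ^ 6 / q * telescoper z (q * t) - telescoper z t)"
proof -
  define E where "E = pinf_pair (q\<^sup>2 * z) t"
  have 1: "pinf_pair (q * z) t = (1 + q * z * t) * (1 + z * q\<^sup>2 / t) * E"
    using pinf_pair_q_step[OF t, of "q * z"] by (simp add: E_def power2_eq_square mult_ac)
  have 2: "pinf_pair z t = (1 + z * t) * (1 + z * q / t)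
      * ((1 + q * z * t) * (1 + z * q\<^sup>2 / t) * E)"
    using pinf_pair_q_step[OF t, of z] 1 by simp
  have 3: "(1 + z * q * (q * t)) * pinf_pair (q\<^sup>2 * z) (q * t) = (1 + z * q\<^sup>2 / t) * E"
  proof -
    have e: "- (q\<^sup>2 * z) * (q * t) = q * (- (q\<^sup>2 * z) * t)" "- (q\<^sup>2 * z) * q / (q * t)
        = - (z * q\<^sup>2) / t"
      "- (q\<^sup>2 * z) * q / t = q * (- (z * q\<^sup>2) / t)"
      by simp_all
    have "E = pinf (- (q\<^sup>2 * z) * t) * pinf (q * (- (z * q\<^sup>2) / t))"
      unfolding E_def pinf_pair_def e ..
    also have "\<dots> = (1 - - (q\<^sup>2 * z) * t) * pinf (q * (- (q\<^sup>2 * z) * t))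
        * pinf (q * (- (z * q\<^sup>2) / t))"
      by (subst pinf_rec[of "- (q\<^sup>2 * z) * t"]) (rule refl)
    finally have E: "E = (1 - - (q\<^sup>2 * z) * t) * pinf (q * (- (q\<^sup>2 * z) * t))
        * pinf (q * (- (z * q\<^sup>2) / t))" .
    have "pinf_pair (q\<^sup>2 * z) (q * t) = pinf (q * (- (q\<^sup>2 * z) * t)) * pinf (- (z * q\<^sup>2) / t)"
      unfolding pinf_pair_def e ..
    also have "\<dots> = pinf (q * (- (q\<^sup>2 * z) * t))
        * ((1 - - (z * q\<^sup>2) / t) * pinf (q * (- (z * q\<^sup>2) / t)))"
      by (subst pinf_rec[of "- (z * q\<^sup>2) / t"]) (rule refl)
    finally have Fq: "pinf_pair (q\<^sup>2 * z) (q * t)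
        = pinf (q * (- (q\<^sup>2 * z) * t)) * ((1 - - (z * q\<^sup>2) / t) * pinf (q * (- (z * q\<^sup>2) / t)))" .
    have "1 + z * q * (q * t) = 1 - - (q\<^sup>2 * z) * t" "1 + z * q\<^sup>2 / t = 1 - - (z * q\<^sup>2) / t"
      by (simp_all add: power2_eq_square)
    then show ?thesis unfolding E Fq by (simp only: mult_ac)
  qed
  have 4: "telescoper z (q * t) = - (1 / t\<^sup>2) * ((1 + z * q\<^sup>2 / t) * E)"
  proof -
    have "telescoper z (q * t) = - (q\<^sup>2 / (q * t)\<^sup>2)
        * ((1 + z * q * (q * t)) * pinf_pair (q\<^sup>2 * z) (q * t))"
      unfolding telescoper_def by (rule mult.assoc)
    then show ?thesis unfolding 3 by (simp add: power_mult_distrib)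
  qed
  have 5: "telescoper z t = - (q\<^sup>2 / t\<^sup>2) * (1 + z * q * t) * E"
    by (simp add: telescoper_def E_def)
  show ?thesis
    unfolding 4 5 2 unfolding 1 E_def[symmetric] using t
    by (simp add: field_simps power2_eq_square eval_nat_numeral)
qed

lemma quint_coeff_q_shift: "s \<noteq> 0 \<Longrightarrow> quint_coeff s (n + 1)
    = quint_coeff s n * ((s * q powi n) ^ 6 / q)"
proof -
  assume s: "s \<noteq> 0"
  have "6 * tri (n + 1) - (n + 1) = 6 * tri n - n + (6 * n - 1)"
    by (simp add: tri_add)
  then have "q powi (6 * tri (n + 1) - (n + 1)) = q powi (6 * tri n - n) * q powi (6 * n - 1)"
    by (simp only: q_add)
  moreover have "q powi (6 * n - 1) = (q powi n) ^ 6 / q"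
    by (simp add: power_int_diff power_int_power' mult.commute)
  moreover have "s powi (6 * (n + 1)) = s powi (6 * n) * s ^ 6"
    using s by (simp add: distrib_left power_int_add)
  ultimately show ?thesis
    by (simp add: quint_coeff_def power_mult_distrib mult_ac)
qed

text \<open>Summed over \<open>n\<close>, the telescoping right side cancels.\<close>

lemma vwp_sum_q_difference:
  assumes z: "z \<noteq> 0" and s: "s \<noteq> 0"
  shows "vwp_sum s z - (1 + 1 / q) * vwp_sum s (q * z) + vwp_sum s (q\<^sup>2 * z) / q
      = q * z\<^sup>2 * vwp_sum s (q * z)"
proof -
  define t where "t n = s * q powi n" for n
  define b where "b n = quint_coeff s n * (1 - (t n)\<^sup>2 / q)" for n
  have t: "t n \<noteq> 0" "t (n + 1) = q * t n" for n using s by (simp_all add: t_def power_int_add)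
  have b_sum: "((\<lambda>n. b n * pinf_pair z' (t n)) has_sum vwp_sum s z') UNIV" if "z' \<noteq> 0" for z'
    using vwp_sum_has_sum(1)[OF that s] by (simp add: b_def t_def)
  define h where "h n = quint_coeff s n * telescoper z (t n)" for n
  \<comment> \<open>By definition of the certificate, \<open>h\<close> is a combination of the moments \<open>- 2\<close> and \<open>- 1\<close>, hence
    summable.\<close>
  define H where "H = - q\<^sup>2 * vwp_moment s (-2) (q\<^sup>2 * z) - q ^ 3 * z
      * vwp_moment s (-1) (q\<^sup>2 * z)"
  have "((\<lambda>n. - q\<^sup>2 * (quint_coeff s n * t n powi (-2) * pinf_pair (q\<^sup>2 * z) (t n)) - q ^ 3 * z
      * (quint_coeff s n * t n powi (-1) * pinf_pair (q\<^sup>2 * z) (t n)))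
      has_sum H) UNIV"
    unfolding H_def t_def using z s by (intro has_sum_diff
        has_sum_cmult_right vwp_moment_has_sum(1)) auto
  moreover have "- q\<^sup>2 * (quint_coeff s n * t n powi (-2) * pinf_pair (q\<^sup>2 * z) (t n)) - q ^ 3 * z
      * (quint_coeff s n * t n powi (-1) * pinf_pair (q\<^sup>2 * z) (t n)) = h n" for n
    using t(1)[of n] by (simp add: h_def telescoper_def power_int_minus field_simps
        power2_eq_square power3_eq_cube)
  ultimately have h: "(h has_sum H) UNIV" by simp
  have "((\<lambda>n. q * z\<^sup>2 * (h (n + 1) - h n)) has_sum q * z\<^sup>2 * (H - H)) UNIV"
    using h by (intro has_sum_cmult_right has_sum_diff) (simp_all add: has_sum_shift)
  moreover have "((\<lambda>n. b n * pinf_pair z (t n) - (1 + 1 / q) * (b n * pinf_pair (q * z) (t n)) + 1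
      / q * (b n * pinf_pair (q\<^sup>2 * z) (t n))
        - q * z\<^sup>2 * (b n * pinf_pair (q * z) (t n))) has_sum
      vwp_sum s z - (1 + 1 / q) * vwp_sum s (q * z) + 1 / q * vwp_sum s (q\<^sup>2 * z) - q * z\<^sup>2
          * vwp_sum s (q * z)) UNIV"
    using z by (intro has_sum_diff has_sum_add has_sum_cmult_right b_sum) auto
  moreover have "b n * pinf_pair z (t n) - (1 + 1 / q) * (b n * pinf_pair (q * z) (t n)) + 1 / q
      * (b n * pinf_pair (q\<^sup>2 * z) (t n))
        - q * z\<^sup>2 * (b n * pinf_pair (q * z) (t n)) = q * z\<^sup>2 * (h (n + 1) - h n)" for n
  proof -
    have c: "quint_coeff s (n + 1) = quint_coeff s n * (t n ^ 6 / q)"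
      using quint_coeff_q_shift[OF s] by (simp add: t_def)
    have "b n * pinf_pair z (t n) - (1 + 1 / q) * (b n * pinf_pair (q * z) (t n)) + 1 / q
        * (b n * pinf_pair (q\<^sup>2 * z) (t n))
        - q * z\<^sup>2 * (b n * pinf_pair (q * z) (t n))
      = quint_coeff s n * ((1 - (t n)\<^sup>2 / q)
          * (pinf_pair z (t n) - (1 + 1 / q) * pinf_pair (q * z) (t n) + pinf_pair (q\<^sup>2 * z) (t n)
          / q - q * z\<^sup>2 * pinf_pair (q * z) (t n)))"
    proof -
      have "A * B * f1 - (1 + 1 / q) * (A * B * f2) + 1 / q * (A * B * f3) - c * (A * B * f2)
        = A * (B * (f1 - (1 + 1 / q) * f2 + f3 / q - c * f2))" for A B c f1 f2 f3 :: complex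
        by (simp add: field_simps)
      then show ?thesis unfolding b_def .
    qed
    also have "\<dots> = q * z\<^sup>2 * (h (n + 1) - h n)"
      unfolding telescoper_identity[OF t(1)] h_def c t(2) by (simp add: algebra_simps)
    finally show ?thesis .
  qed
  ultimately have "vwp_sum s z - (1 + 1 / q) * vwp_sum s (q * z) + 1 / q * vwp_sum s (q\<^sup>2 * z) - q
      * z\<^sup>2 * vwp_sum s (q * z) = q * z\<^sup>2 * (H - H)"
    by (simp only:) (rule has_sum_unique)
  then show ?thesis by simp
qed

text \<open>The coefficient of \<open>z powi j\<close> in \<open>vwp_sum s z\<close>.\<close>

definition vwp_coeff :: "complex \<Rightarrow> int \<Rightarrow> complex" where
  "vwp_coeff s j = (\<Sum>\<^sub>\<infinity>(n, k). quint_coeff s n * (1 - (s * q powi n)\<^sup>2 / q)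
      * pinf_pair_term 1 (s * q powi n) k (j - k))"

lemma pinf_pair_term_scale: "z \<noteq> 0 \<Longrightarrow> pinf_pair_term z t k l
    = z powi (k + l) * pinf_pair_term 1 t k l"
proof -
  assume "z \<noteq> 0"
  have "theta_term (- z * w) k = z powi k * theta_term (- 1 * w) k" for w k
    by (simp add: theta_term_def power_int_mult_distrib)
  from this[of t k] this[of "q / t" l] show ?thesis
    using \<open>z \<noteq> 0\<close> by (simp add: pinf_pair_term_def power_int_add)
qed

lemma vwp_coeff_has_sum:
  assumes s: "s \<noteq> 0"
  shows "((\<lambda>(n, k). quint_coeff s n * (1 - (s * q powi n)\<^sup>2 / q)
      * pinf_pair_term 1 (s * q powi n) k (j - k)) has_sum vwp_coeff s j) (UNIV \<times> UNIV)"
    and "z \<noteq> 0 \<Longrightarrow> ((\<lambda>j. vwp_coeff s j * z powi j) has_sum vwp_sum s z) UNIV"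
proof -
  let ?f = "\<lambda>z (j, n, k). quint_coeff s n * (1 - (s * q powi n)\<^sup>2 / q)
      * pinf_pair_term z (s * q powi n) k (j - k)"
  have f: "(?f z has_sum vwp_sum s z) (UNIV \<times> UNIV)" if "z \<noteq> 0" for z
    using vwp_sum_has_sum(2)[OF that s]
    by (subst has_sum_reindex_bij_witness[of _ "\<lambda>(n, k, l). (k + l, n, k)"
        "\<lambda>(j, n, k). (n, k, j - k)" "UNIV \<times> UNIV"]) auto
  have "(\<lambda>(n, k). ?f 1 (j, n, k)) summable_on (UNIV \<times> UNIV)" for j
    using summable_on_SigmaD1[of "\<lambda>j (n, k). ?f 1 (j, n, k)" UNIV "\<lambda>_. UNIV" j]
        has_sum_imp_summable[OF f[of 1]]
    by (simp add: case_prod_unfold)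
  then show 1: "((\<lambda>(n, k). quint_coeff s n * (1 - (s * q powi n)\<^sup>2 / q)
      * pinf_pair_term 1 (s * q powi n) k (j - k)) has_sum vwp_coeff s j) (UNIV \<times> UNIV)" for j
    unfolding vwp_coeff_def by (simp add: has_sum_infsum)
  show "((\<lambda>j. vwp_coeff s j * z powi j) has_sum vwp_sum s z) UNIV" if z: "z \<noteq> 0"
  proof (rule has_sum_SigmaD[OF f[OF z]])
    show "((\<lambda>y. ?f z (j, y)) has_sum vwp_coeff s j * z powi j) UNIV" for j
      using has_sum_cmult_left[OF 1[of j], of "z powi j"]
      by (simp add: pinf_pair_term_scale[OF z, of _ _ "j - _"] case_prod_unfold mult_ac)
  qed
qed

lemma vwp_coeff_neg: "j < 0 \<Longrightarrow> vwp_coeff s j = 0"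
proof -
  assume j: "j < 0"
  have "pinf_pair_term 1 t k (j - k) = 0" for t k
    using j by (cases "k < 0") (auto simp: pinf_pair_term_def)
  then show ?thesis by (simp add: vwp_coeff_def case_prod_unfold)
qed

text \<open>Compare coefficients in the q-difference equation: \<open>z \<mapsto> q * z\<close> multiplies the coefficient of
  \<open>z powi j\<close> by \<open>q powi j\<close>, and \<open>1 - (1 + 1 / q) * q powi j + q powi (2 * j - 1)\<close> factors as on
  the left side.\<close>

lemma vwp_coeff_rec:
  assumes s: "s \<noteq> 0"
  shows "(1 - q powi j) * (1 - q powi (j - 1)) * vwp_coeff s j
      = q powi (j - 1) * vwp_coeff s (j - 2)"
proof (cases "j < 0")
  case False
  define a where "a i = (1 - q powi i) * (1 - q powi (i - 1)) * vwp_coeff s i - q powi (i - 1)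
      * vwp_coeff s (i - 2)" for i
  have "(\<lambda>i. a (int i) * z ^ i) sums 0" if z: "z \<noteq> 0" for z
  proof -
    have qz: "q * z \<noteq> 0" "q\<^sup>2 * z \<noteq> 0" using z by auto
    have "((\<lambda>i. vwp_coeff s (i - 2) * (q * z) powi (i - 2)) has_sum vwp_sum s (q * z)) UNIV"
      using vwp_coeff_has_sum(2)[OF s qz(1)]
          has_sum_shift[of "\<lambda>i. vwp_coeff s i * (q * z) powi i" "-2"] by simp
    then have "((\<lambda>i. vwp_coeff s i * z powi i - (1 + 1 / q) * (vwp_coeff s i * (q * z) powi i) + 1
        / q * (vwp_coeff s i * (q\<^sup>2 * z) powi i)
        - q * z\<^sup>2 * (vwp_coeff s (i - 2) * (q * z) powi (i - 2))) has_sum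
        vwp_sum s z - (1 + 1 / q) * vwp_sum s (q * z) + 1 / q * vwp_sum s (q\<^sup>2 * z) - q * z\<^sup>2
            * vwp_sum s (q * z)) UNIV"
      using z qz by (intro has_sum_diff has_sum_add has_sum_cmult_right vwp_coeff_has_sum s)
    moreover have "vwp_sum s z - (1 + 1 / q) * vwp_sum s (q * z) + 1 / q * vwp_sum s (q\<^sup>2 * z) - q
        * z\<^sup>2 * vwp_sum s (q * z) = 0"
      using vwp_sum_q_difference[OF z s] by simp
    moreover have "vwp_coeff s i * z powi i - (1 + 1 / q) * (vwp_coeff s i * (q * z) powi i) + 1
        / q * (vwp_coeff s i * (q\<^sup>2 * z) powi i)
        - q * z\<^sup>2 * (vwp_coeff s (i - 2) * (q * z) powi (i - 2)) = a i * z powi i" for i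
    proof -
      have "(q * z) powi i = q powi i * z powi i" "(q\<^sup>2 * z) powi i
          = q powi i * q powi i * z powi i"
        "q * z\<^sup>2 * (q * z) powi (i - 2) = q powi i / q * z powi i"
        using z by (simp_all add: power2_eq_square power_int_mult_distrib power_int_diff
            field_simps)
      moreover have "q * z\<^sup>2 * (vwp_coeff s (i - 2) * (q * z) powi (i - 2))
          = vwp_coeff s (i - 2) * (q * z\<^sup>2 * (q * z) powi (i - 2))"
        by (simp only: mult_ac)
      ultimately have e: "(q * z) powi i = q powi i * z powi i" "(q\<^sup>2 * z) powi i
          = q powi i * q powi i * z powi i"
        "q * z\<^sup>2 * (vwp_coeff s (i - 2) * (q * z) powi (i - 2))
            = vwp_coeff s (i - 2) * (q powi i / q * z powi i)"
        by (simp_all only:)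
      show ?thesis unfolding e a_def by (simp add: power_int_diff field_simps)
    qed
    ultimately have "((\<lambda>i. a i * z powi i) has_sum 0) UNIV" by simp
    then have "((\<lambda>i. a (int i) * z powi (int i)) has_sum 0) UNIV"
      by (subst (asm) has_sum_int_iff_nat) (auto simp: a_def vwp_coeff_neg)
    then show ?thesis by (auto dest: has_sum_imp_sums)
  qed
  then have "a (int (nat j)) = 0" by (rule power_series_zero_imp_coeff_zero)
  with False show ?thesis by (simp add: a_def)
qed (simp add: vwp_coeff_neg)

lemma quint_coeff_summable:
  assumes "s \<noteq> 0"
  shows "(\<lambda>n. quint_coeff s n * (s * q powi n) powi a) summable_on UNIV"
proof -
  have "(\<lambda>n. s powi a * (q powi (6 * tri n) * (s ^ 6 * q powi (a - 1)) powi n)) summable_on UNIV"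
    by (intro summable_on_cmult_right quadratic_exponent_summable) simp
  moreover have "s powi a * (q powi (6 * tri n) * (s ^ 6 * q powi (a - 1)) powi n)
      = quint_coeff s n * (s * q powi n) powi a" for n
  proof -
    have "6 * tri n + (a - 1) * n = (6 * tri n - n) + n * a" by (simp add: algebra_simps)
    then have "q powi (6 * tri n) * (q powi (a - 1)) powi n
        = q powi (6 * tri n - n) * (q powi n) powi a"
      by (simp only: flip: q_add power_int_mult)
    then show ?thesis by (simp add: quint_coeff_def power_int_mult_distrib power_int_power
        mult_ac)
  qed
  ultimately show ?thesis by (simp only:)
qed

lemma quintuple_theta_corr_0:
  assumes s: "s \<noteq> 0"
  shows "((\<lambda>n. quint_coeff s n * (1 - (s * q powi n)\<^sup>2 / q))
      has_sum theta (s\<^sup>2 / q) * theta_corr 0 s) UNIV"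
proof -
  have "(s\<^sup>2) powi (3 * n) * q powi (6 * tri n - n) * (1 - s\<^sup>2 * q powi (2 * n - 1))
      = quint_coeff s n * (1 - (s * q powi n)\<^sup>2 / q)" for n
    by (simp add: quint_coeff_def power_int_power power_int_power' power_int_diff
        power_mult_distrib mult.commute[of n])
  then show ?thesis using quintuple_product[of "s\<^sup>2"] s by (simp add: theta_corr_eq_theta_q2)
qed

text \<open>The quintuple product at \<open>w = q * s\<^sup>2\<close>. It gives the moments 3 and 5 of \<open>quint_coeff\<close>,
  whereas the left side involves the moments \<open>- 1\<close> and 3; a shift of \<open>n\<close> identifies the moments 5
  and \<open>- 1\<close> up to \<open>q\<^sup>2\<close>.\<close>

lemma quintuple_theta_corr_1:
  assumes s: "s \<noteq> 0"
  shows "((\<lambda>n. quint_coeff s n * (1 - (s * q powi n)\<^sup>2 / q) * (s * q powi n + q / (s * q powi n)))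
      has_sum
     theta (s\<^sup>2 / q) * theta_corr 1 s) UNIV"
proof -
  define t where "t n = s * q powi n" for n
  have t: "t n \<noteq> 0" "t (n + 1) = q * t n" for n using s by (simp_all add: t_def power_int_add)
  define c where "c a = (\<Sum>\<^sub>\<infinity>n. quint_coeff s n * t n powi a)" for a
  have c: "((\<lambda>n. quint_coeff s n * t n powi a) has_sum c a) UNIV" for a
    unfolding c_def t_def by (intro has_sum_infsum quint_coeff_summable s)
  have "((\<lambda>n. q\<^sup>2 * (quint_coeff s (n + 1) * t (n + 1) powi (-1))) has_sum q\<^sup>2 * c (-1)) UNIV"
    using c[of "-1"] has_sum_shift[of "\<lambda>n. quint_coeff s n * t n powi (-1)" 1] by (intro
        has_sum_cmult_right) simp
  moreover have "q\<^sup>2 * (quint_coeff s (n + 1) * t (n + 1) powi (-1))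
      = quint_coeff s n * t n powi 5" for n
    using t(1)[of n] quint_coeff_q_shift[OF s, of n] unfolding t(2)
    by (simp add: power_int_minus field_simps power2_eq_square eval_nat_numeral flip: t_def)
  ultimately have "((\<lambda>n. quint_coeff s n * t n powi 5) has_sum q\<^sup>2 * c (-1)) UNIV" by (simp only:)
  with c[of 5] have c5: "c 5 = q\<^sup>2 * c (-1)" by (rule has_sum_unique)
  have "((\<lambda>n. 1 / s ^ 3 * (quint_coeff s n * t n powi 3 - quint_coeff s n * t n powi 5))
      has_sum 1 / s ^ 3 * (c 3 - c 5)) UNIV"
    by (intro has_sum_cmult_right has_sum_diff c)
  moreover have "1 / s ^ 3 * (quint_coeff s n * t n powi 3 - quint_coeff s n * t n powi 5)
      = (q * s\<^sup>2) powi (3 * n) * q powi (6 * tri n - n)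
          * (1 - q * s\<^sup>2 * q powi (2 * n - 1))" for n
  proof -
    have e1: "(q * s\<^sup>2) powi (3 * n) = (t n / s) ^ 3 * s powi (6 * n)"
      using s by (simp add: t_def power_int_mult_distrib power_int_power power_int_power'
          mult.commute[of n])
    have e2: "q * s\<^sup>2 * q powi (2 * n - 1) = (t n)\<^sup>2"
      by (simp add: t_def power_int_diff power_int_power' power_mult_distrib mult.commute[of n])
    show ?thesis
      unfolding e1 e2 quint_coeff_def using s by (simp add: field_simps eval_nat_numeral)
  qed
  ultimately have "1 / s ^ 3 * (c 3 - c 5) = theta (q * s\<^sup>2 / q) * theta_q2 (q * s\<^sup>2)"
    using quintuple_product[of "q * s\<^sup>2"] s by (simp only:
        has_sum_unique mult_eq_0_iff power_not_zero q_nonzero not_False_eq_True simp_thms)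
  also have "theta (q * s\<^sup>2 / q) = - (q / s\<^sup>2) * theta (s\<^sup>2 / q)"
    using theta_eq_theta_div_q[of "s\<^sup>2"] s by simp
  finally have "- (s ^ 3 / q) * (1 / s ^ 3 * (c 3 - c 5))
      = - (s ^ 3 / q) * (- (q / s\<^sup>2) * theta (s\<^sup>2 / q) * theta_q2 (q * s\<^sup>2))"
    by (simp only:)
  moreover have "- (s ^ 3 / q) * (1 / s ^ 3 * (c 3 - c 5)) = q * c (-1) - 1 / q * c 3"
    using s unfolding c5 by (simp add: field_simps power2_eq_square)
  moreover have "- (s ^ 3 / q) * (- (q / s\<^sup>2) * theta (s\<^sup>2 / q) * theta_q2 (q * s\<^sup>2))
      = theta (s\<^sup>2 / q) * theta_corr 1 s"
  proof -
    have "- (s ^ 3 / q) * (- (q / s\<^sup>2)) = s" using s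
        by (simp add: field_simps power2_eq_square power3_eq_cube)
    then have "(- (s ^ 3 / q) * (- (q / s\<^sup>2))) * (theta (s\<^sup>2 / q) * theta_q2 (q * s\<^sup>2))
        = theta (s\<^sup>2 / q) * (s * theta_q2 (q * s\<^sup>2))"
      by (simp only: mult_ac)
    then show ?thesis unfolding theta_corr_eq_theta_q2(2)[OF s] by (simp only: mult.assoc)
  qed
  ultimately have main: "q * c (-1) - 1 / q * c 3 = theta (s\<^sup>2 / q) * theta_corr 1 s"
    by (simp only:)
  have "((\<lambda>n. q * (quint_coeff s n * t n powi (-1)) - 1 / q * (quint_coeff s n * t n powi 3))
      has_sum q * c (-1) - 1 / q * c 3) UNIV"
    by (intro has_sum_diff has_sum_cmult_right c)
  moreover have "q * (quint_coeff s n * t n powi (-1)) - 1 / q * (quint_coeff s n * t n powi 3)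
      = quint_coeff s n * (1 - (t n)\<^sup>2 / q) * (t n + q / t n)" for n
    using t(1)[of n] by (simp add: power_int_minus field_simps eval_nat_numeral)
  ultimately show ?thesis unfolding main t_def by (simp only:)
qed

lemma vwp_coeff_0: "s \<noteq> 0 \<Longrightarrow> vwp_coeff s 0 = theta (s\<^sup>2 / q) * theta_corr 0 s"
proof -
  assume s: "s \<noteq> 0"
  have "((\<lambda>n. quint_coeff s n * (1 - (s * q powi n)\<^sup>2 / q)) has_sum vwp_coeff s 0) UNIV"
  proof (rule has_sum_SigmaD[OF vwp_coeff_has_sum(1)[OF s]])
    fix n :: int
    show "((\<lambda>k. case (n, k) of (n, k) \<Rightarrow> quint_coeff s n * (1 - (s * q powi n)\<^sup>2 / q)
        * pinf_pair_term 1 (s * q powi n) k (0 - k)) has_sum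
      quint_coeff s n * (1 - (s * q powi n)\<^sup>2 / q)) UNIV"
    proof (rule has_sum_finite_neutralI[of "{0}"])
      show "(case (n, k) of (n, k) \<Rightarrow> quint_coeff s n * (1 - (s * q powi n)\<^sup>2 / q)
          * pinf_pair_term 1 (s * q powi n) k (0 - k)) = 0"
        if "k \<in> UNIV - {0}" for k
        using that by (cases "k < 0") (auto simp: pinf_pair_term_def)
    qed (auto simp: pinf_pair_term_def)
  qed
  then show ?thesis using quintuple_theta_corr_0[OF s] by (rule has_sum_unique)
qed

lemma vwp_coeff_1: "s \<noteq> 0 \<Longrightarrow> vwp_coeff s 1 = theta (s\<^sup>2 / q) * (inv_poch 1 * theta_corr 1 s)"
proof -
  assume s: "s \<noteq> 0"
  have "((\<lambda>n. inv_poch 1 * (quint_coeff s n * (1 - (s * q powi n)\<^sup>2 / q)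
      * (s * q powi n + q / (s * q powi n)))) has_sum vwp_coeff s 1) UNIV"
  proof (rule has_sum_SigmaD[OF vwp_coeff_has_sum(1)[OF s]])
    fix n :: int
    show "((\<lambda>k. case (n, k) of (n, k) \<Rightarrow> quint_coeff s n * (1 - (s * q powi n)\<^sup>2 / q)
        * pinf_pair_term 1 (s * q powi n) k (1 - k)) has_sum
      inv_poch 1 * (quint_coeff s n * (1 - (s * q powi n)\<^sup>2 / q)
          * (s * q powi n + q / (s * q powi n)))) UNIV"
    proof (rule has_sum_finite_neutralI[of "{0, 1}"])
      show "(case (n, k) of (n, k) \<Rightarrow> quint_coeff s n * (1 - (s * q powi n)\<^sup>2 / q)
          * pinf_pair_term 1 (s * q powi n) k (1 - k)) = 0"
        if "k \<in> UNIV - {0, 1}" for k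
        using that by (cases "k < 0") (auto simp: pinf_pair_term_def)
      show "inv_poch 1 * (quint_coeff s n * (1 - (s * q powi n)\<^sup>2 / q)
          * (s * q powi n + q / (s * q powi n)))
        = (\<Sum>k\<in>{0, 1}. case (n, k) of (n, k) \<Rightarrow> quint_coeff s n * (1 - (s * q powi n)\<^sup>2 / q)
            * pinf_pair_term 1 (s * q powi n) k (1 - k))"
      proof -
        have "pinf_pair_term 1 t 0 1 = inv_poch 1 * (q / t)" "pinf_pair_term 1 t 1 0
            = inv_poch 1 * t" for t
          by (simp_all add: pinf_pair_term_def theta_term_def[of _ 1])
        then show ?thesis by (simp add: distrib_left mult_ac)
      qed
    qed auto
  qed
  moreover have "((\<lambda>n. inv_poch 1
      * (quint_coeff s n * (1 - (s * q powi n)\<^sup>2 / q) * (s * q powi n + q / (s * q powi n))))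
      has_sum
      inv_poch 1 * (theta (s\<^sup>2 / q) * theta_corr 1 s)) UNIV"
    by (intro has_sum_cmult_right quintuple_theta_corr_1 s)
  ultimately have "vwp_coeff s 1 = inv_poch 1 * (theta (s\<^sup>2 / q) * theta_corr 1 s)" by (rule
      has_sum_unique)
  then show ?thesis by (simp only: mult_ac)
qed

text \<open>Both sides satisfy the same two-step recursion in \<open>j\<close>, whose leading factor does not vanish
  for \<open>j \<ge> 2\<close>, and they agree at \<open>j = 0\<close> and \<open>j = 1\<close> by the quintuple product.\<close>

lemma vwp_coeff_eq: "s \<noteq> 0 \<Longrightarrow> vwp_coeff s (int j)
    = theta (s\<^sup>2 / q) * (inv_poch (int j) * theta_corr (int j) s)"
proof (induction j rule: nat_induct2)
  case (step j)
  define J where "J = int j + 2"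
  have J: "int (j + 2) = J" "int j = J - 2" by (simp_all add: J_def)
  have rr: "(1 - q powi J) * (1 - q powi (J - 1)) * inv_poch J = inv_poch (J - 2)"
  proof -
    have "(1 - q powi J) * (1 - q powi (J - 1)) * inv_poch J
        = (1 - q powi (J - 1)) * ((1 - q powi J) * inv_poch J)"
      by (simp only: mult_ac)
    then show ?thesis unfolding inv_poch_rec using inv_poch_rec[of "J - 1"] by simp
  qed
  have "(1 - q powi J) * (1 - q powi (J - 1)) * vwp_coeff s J
      = q powi (J - 1) * (theta (s\<^sup>2 / q) * (inv_poch (J - 2) * theta_corr (J - 2) s))"
    using vwp_coeff_rec[OF step.prems, of J] step unfolding J by simp
  also have "\<dots> = (1 - q powi J) * (1 - q powi (J - 1))
      * (theta (s\<^sup>2 / q) * (inv_poch J * theta_corr J s))"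
    using theta_corr_rec[OF step.prems, of "J - 2"] unfolding rr[symmetric] by (simp add: mult_ac)
  finally show ?case
    unfolding J using q_powi_neq_1[of J] q_powi_neq_1[of "J - 1"] by (simp add: J_def)
qed (simp_all add: vwp_coeff_0 vwp_coeff_1[simplified])

theorem vwp_sum_eq_theta_pair:
  assumes "p \<noteq> 0" and s: "s \<noteq> 0"
  shows "vwp_sum s (- 1 / p) = theta (s\<^sup>2 / q) * theta_pair (p * s) (p / s)"
proof -
  have "((\<lambda>k. theta (s\<^sup>2 / q) * ((- 1 / p) powi k * (inv_poch k * theta_corr k s)))
      has_sum theta (s\<^sup>2 / q) * theta_pair (p * s) (p / s)) UNIV"
    by (intro has_sum_cmult_right theta_pair_param assms)
  moreover have "theta (s\<^sup>2 / q) * ((- 1 / p) powi k * (inv_poch k * theta_corr k s))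
      = vwp_coeff s k * (- 1 / p) powi k" for k
  proof (cases "k < 0")
    case False
    then have "vwp_coeff s k = theta (s\<^sup>2 / q) * (inv_poch k * theta_corr k s)"
        using vwp_coeff_eq[OF s, of "nat k"] by simp
    then show ?thesis by (simp only: mult_ac)
  qed (simp add: vwp_coeff_neg)
  moreover have "((\<lambda>k. vwp_coeff s k * (- 1 / p) powi k) has_sum vwp_sum s (- 1 / p)) UNIV"
    using assms by (intro vwp_coeff_has_sum) auto
  ultimately show ?thesis by (simp only: has_sum_unique)
qed

section \<open>Continuity and hypergeometric specialisations\<close>

lemma theta_pair_isCont:
  assumes "x \<noteq> 0" and "y \<noteq> 0"
  shows "isCont (theta_pair x) y"
proof -
  define a where "a n = theta_term x (- n) * (q powi tri (- n) * (-1) powi (- n))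
      * pinf (q powi (1 + n) / x)" for n
  have "((\<lambda>n. a n * y powi n) has_sum theta_pair x y) UNIV" if "y \<noteq> 0" for y
  proof -
    have "((\<lambda>n. theta_term x (- n) * theta_term (1 / y) (- n) * pinf (q powi (1 - - n) / x))
        has_sum theta_pair x y) UNIV"
      using theta_pair_has_sum_columns[OF assms(1), of y]
      by (subst has_sum_reindex_bij_witness[of UNIV uminus uminus UNIV]) auto
    moreover have "theta_term x (- n) * theta_term (1 / y) (- n) * pinf (q powi (1 - - n) / x)
        = a n * y powi n" for n
      unfolding theta_term_def[of "1 / y"] minus_powi[of "1 / y"]
      by (simp add: a_def power_int_divide_distrib power_int_minus_divide)
    ultimately show ?thesis by simp
  qed
  from this assms(2) show ?thesis by (rule bilateral_Laurent_isCont)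
qed

lemma q_phi_has_sum: "((\<lambda>n. inv_poch (int n) * q powi (2 * tri (int n)) * x ^ n)
    has_sum q_phi q [] [0] x) UNIV"
proof -
  have "((\<lambda>n. inv_poch n * q powi (2 * tri n) * x powi n) summable_on UNIV)"
  proof -
    obtain C where C: "\<And>k. norm (inv_poch k) \<le> C" using inv_poch_bounded by blast
    have "(\<lambda>n. q powi (2 * tri n) * x powi n * inv_poch n) summable_on UNIV"
      by (rule summable_on_bounded_factor[OF quadratic_exponent_summable C]) simp
    then show ?thesis by (simp add: mult_ac)
  qed
  then have s: "(\<lambda>n. inv_poch (int n) * q powi (2 * tri (int n)) * x ^ n) summable_on UNIV"
    by (subst (asm) summable_on_int_iff_nat) auto
  have "qpochs q [] (int n) / qpochs q ([0] @ [q]) (int n)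
        * ((-1) powi int n * q powi (int n * (int n - 1) div 2)) powi
            (int (length [0]) - int (length []) + 1)
        * x ^ n = inv_poch (int n) * q powi (2 * tri (int n)) * x ^ n" for n
  proof -
    have "((-1) powi int n * q powi tri (int n)) powi 2 = q powi (2 * tri (int n))"
      by (simp add: power2_eq_square powi_double mult_ac flip: power_mult_distrib)
    moreover have "qpochs q [] (int n) / qpochs q ([0] @ [q]) (int n) = inv_poch (int n)"
      by (simp add: qpochs_def qpoch_def inv_poch_of_nat)
    ultimately show ?thesis by (simp add: tri_def)
  qed
  then have "q_phi q [] [0] x = (\<Sum>n. inv_poch (int n) * q powi (2 * tri (int n)) * x ^ n)"
    unfolding q_phi_def by simp
  with has_sum_infsum[OF s] has_sum_imp_sums[OF has_sum_infsum[OF s]] show ?thesis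
    by (simp add: sums_iff)
qed

text \<open>At \<open>y = 1\<close> the factor \<open>pinf (q powi n)\<close> vanishes for \<open>n \<le> 0\<close>, so the bilateral series
  becomes unilateral; it starts at \<open>n = 1\<close>, whence the shift and the factor \<open>x\<close>.\<close>

lemma theta_pair_at_1: "x \<noteq> 0 \<Longrightarrow> theta_pair x 1 = x * pinf q * q_phi q [] [0] (x * q\<^sup>2)"
proof -
  assume x: "x \<noteq> 0"
  have "((\<lambda>n. theta_term x (n + 1) * theta_term 1 (n + 1) * pinf (q powi (n + 1)))
      has_sum theta_pair x 1) UNIV"
    using theta_pair_has_sum_rows[of 1 x]
        has_sum_shift[of "\<lambda>n. theta_term x n * theta_term 1 n * pinf (q powi n)" 1] by simp
  moreover have "theta_term x (n + 1) * theta_term 1 (n + 1) * pinf (q powi (n + 1))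
      = x * pinf q * (inv_poch n * q powi (2 * tri n) * (x * q\<^sup>2) powi n)" for n
  proof -
    have 1: "(-1) powi n * (-1) powi n = (1::complex)"
      by (rule minus_one_powi_square)
    have "theta_term x (n + 1) * theta_term 1 (n + 1) * pinf (q powi (n + 1))
      = ((-1) powi n * (-1) powi n) * x * pinf q
          * (inv_poch n * q powi (2 * tri n) * (x * q\<^sup>2) powi n)"
      unfolding theta_term_succ[OF x] theta_term_succ[OF one_neq_zero]
      by (simp add: theta_term_def minus_powi[of x] powi_double power2_eq_square
          power_int_mult_distrib flip: inv_poch_mult_pinf)
    then show ?thesis unfolding 1 by simp
  qed
  ultimately have "((\<lambda>n. x * pinf q * (inv_poch n * q powi (2 * tri n) * (x * q\<^sup>2) powi n))
      has_sum theta_pair x 1) UNIV"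
    by (simp only:)
  then have "((\<lambda>n. x * pinf q * (inv_poch (int n) * q powi (2 * tri (int n)) * (x * q\<^sup>2) ^ n))
      has_sum theta_pair x 1) UNIV"
    by (subst (asm) has_sum_int_iff_nat) auto
  then show ?thesis by (rule has_sum_unique) (intro has_sum_cmult_right q_phi_has_sum)
qed

text \<open>Quasi-periodicity of \<open>theta\<close> moves the q-shifted factorial from the denominator to the
  numerator, where Euler's expansion applies.\<close>

lemma qpoch_eq: "x \<notin> q_ints q \<Longrightarrow> x \<noteq> 0 \<Longrightarrow> qpoch q x n
    = pinf x / theta x * (theta_term x n * pinf (q powi (1 - n) / x))"
proof -
  assume x: "x \<notin> q_ints q" "x \<noteq> 0"
  have "pinf (x * q powi n) \<noteq> 0" by (intro pinf_nonzero q_ints_mult x)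
  moreover have "theta x = theta_term x n * (pinf (x * q powi n) * pinf (q powi (1 - n) / x))"
    using theta_q_powi[OF x(2), of n] x(2) by (simp add: theta_eq_pinf power_int_diff mult_ac)
  moreover have "theta x \<noteq> 0" by (rule theta_nonzero) fact
  ultimately show ?thesis by (simp add: qpoch_def)
qed

lemma qpoch_0 [simp]: "qpoch q 0 n = 1"
  by (simp add: qpoch_def)

lemma q_psi_1_2:
  assumes "x \<notin> q_ints q" and "x \<noteq> 0"
  shows "q_psi q [x] [0, 0] (1 / y) = pinf x / theta x * theta_pair x y"
proof -
  have "qpochs q [x] n / qpochs q [0, 0] n
      * ((-1) powi n * q powi (n * (n - 1) div 2)) powi
      (int (length [0::complex, 0]) - int (length [x])) * (1 / y) powi n
     = pinf x / theta x * (theta_term x n * theta_term (1 / y) n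
         * pinf (q powi (1 - n) / x))" for n
    by (simp add: qpochs_def qpoch_eq[OF assms] theta_term_def[of "1 / y"] minus_powi[of "1 / y"]
        tri_def mult_ac)
  then have "q_psi q [x] [0, 0] (1 / y)
      = (\<Sum>\<^sub>\<infinity>n. pinf x / theta x * (theta_term x n * theta_term (1 / y) n
      * pinf (q powi (1 - n) / x)))"
    unfolding q_psi_def by simp
  also have "\<dots> = pinf x / theta x * theta_pair x y"
    by (intro infsumI has_sum_cmult_right theta_pair_has_sum_columns assms)
  finally show ?thesis .
qed

lemma q_psi_0_2:
  assumes "y \<noteq> 0"
  shows "q_psi q [] [1 / y, 0] (x / y) = theta_pair x y / pinf (1 / y)"
proof -
  have "qpochs q [] n / qpochs q [1 / y, 0] n
      * ((-1) powi n * q powi (n * (n - 1) div 2)) powi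
      (int (length [1 / y, 0]) - int (length ([]::complex list))) * (x / y) powi n
     = 1 / pinf (1 / y) * (theta_term x n * theta_term (1 / y) n * pinf (q powi n / y))" for n
  proof -
    have 1: "(-1) powi n * (-1) powi n = (1::complex)"
      by (rule minus_one_powi_square)
    have "theta_term x n * theta_term (1 / y) n
        = ((-1) powi n * q powi tri n) * ((-1) powi n * q powi tri n) * (x / y) powi n"
      by (simp add: theta_term_def minus_powi[of x] minus_powi[of "1 / y"]
          power_int_divide_distrib)
    then show ?thesis by (simp add: qpochs_def qpoch_def tri_def power2_eq_square)
  qed
  then have "q_psi q [] [1 / y, 0] (x / y)
      = (\<Sum>\<^sub>\<infinity>n. 1 / pinf (1 / y) * (theta_term x n * theta_term (1 / y) n * pinf (q powi n / y)))"
    unfolding q_psi_def by simp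
  also have "\<dots> = 1 / pinf (1 / y) * theta_pair x y"
    by (intro infsumI has_sum_cmult_right theta_pair_has_sum_rows assms)
  finally show ?thesis by simp
qed

text \<open>The series of \<open>vwp_sum s z\<close> at \<open>s\<^sup>2 = x / y\<close> and \<open>z = - 1 / (y * s)\<close>, rewritten in q-shifted
  factorials.\<close>

lemma very_well_poised_sum:
  assumes x: "x \<notin> q_ints q" "x \<noteq> 0" and y: "y \<noteq> 0"
  shows "((\<lambda>n. (1 - x / y * q powi (2 * n - 1)) * (qpoch q x n / qpoch q (1 / y) n)
             * q powi (5 * tri n) * (- (x^2 / (y^3 * q))) powi n)
      has_sum pinf x / (pinf (1 / y) * theta x) * (theta (x / (y * q)) * theta_pair x y)) UNIV"
proof -
  define s where "s = csqrt (x / y)"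
  have s2: "s\<^sup>2 = x / y" by (simp add: s_def)
  have s: "s \<noteq> 0" using x y by (simp add: s_def)
  define p where "p = y * s"
  have p: "p \<noteq> 0" "p * s = x" "p / s = y"
    using s2 s y by (simp_all add: p_def power2_eq_square mult.assoc)
  have "((\<lambda>n. pinf x / (pinf (1 / y) * theta x)
      * (quint_coeff s n * (1 - (s * q powi n)\<^sup>2 / q) * pinf_pair (- 1 / p) (s * q powi n)))
      has_sum
      pinf x / (pinf (1 / y) * theta x) * vwp_sum s (- 1 / p)) UNIV"
    using p s by (intro has_sum_cmult_right vwp_sum_has_sum) auto
  moreover have "vwp_sum s (- 1 / p) = theta (x / (y * q)) * theta_pair x y"
    using vwp_sum_eq_theta_pair[OF p(1) s] by (simp add: p s2)
  moreover have "pinf x / (pinf (1 / y) * theta x)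
      * (quint_coeff s n * (1 - (s * q powi n)\<^sup>2 / q) * pinf_pair (- 1 / p) (s * q powi n))
     = (1 - x / y * q powi (2 * n - 1)) * (qpoch q x n / qpoch q (1 / y) n)
             * q powi (5 * tri n) * (- (x^2 / (y^3 * q))) powi n" for n
  proof -
    have 1: "(s * q powi n)\<^sup>2 / q = x / y * q powi (2 * n - 1)"
      by (simp add: power_mult_distrib s2 power_int_diff power_int_power' mult.commute[of n])
    have 2: "pinf_pair (- 1 / p) (s * q powi n) = pinf (q powi n / y) * pinf (q powi (1 - n) / x)"
    proof -
      have "s / p = 1 / y" "q / (p * (s * q powi n)) = q powi (1 - n) / x"
        using p s by (auto simp: power_int_diff field_simps)
      then show ?thesis by (simp add: pinf_pair_def) (metis times_divide_eq_left mult_1)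
    qed
    have 3: "theta_term x n * (q powi (5 * tri n) * (- (x^2 / (y^3 * q))) powi n)
        = quint_coeff s n"
    proof -
      have "theta_term x n * (q powi (5 * tri n) * (- (x^2 / (y^3 * q))) powi n)
        = q powi (tri n + 5 * tri n) * ((- x) * (- (x^2 / (y^3 * q)))) powi n"
        unfolding theta_term_def q_add power_int_mult_distrib by (simp only: mult_ac)
      also have "(- x) * (- (x^2 / (y^3 * q))) = (x / y) ^ 3 * q powi (-1)"
        by (simp add: power_divide power2_eq_square power3_eq_cube power_int_minus_divide)
      also have "\<dots> = s ^ 6 * q powi (-1)"
        unfolding s2[symmetric] by (simp flip: power_mult)
      also have "q powi (tri n + 5 * tri n) * (s ^ 6 * q powi (-1)) powi n = quint_coeff s n"
      proof -
        have "6 * tri n - n = (tri n + 5 * tri n) + (-1) * n" by simp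
        then have "q powi (6 * tri n - n) = q powi (tri n + 5 * tri n) * (q powi (-1)) powi n"
          by (simp only: q_add power_int_mult)
        then show ?thesis unfolding quint_coeff_def power_int_mult_distrib power_int_power
            by (simp only: mult_ac of_nat_numeral)
      qed
      finally show ?thesis .
    qed
    have 4: "qpoch q (1 / y) n = pinf (1 / y) / pinf (q powi n / y)" by (simp add: qpoch_def)
    show ?thesis
      unfolding 1 2 4 qpoch_eq[OF x] 3[symmetric] by (simp add: mult_ac)
  qed
  ultimately show ?thesis by (simp only:)
qed

section \<open>The little mu function\<close>

text \<open>The normal form from which all properties follow: apart from \<open>y * theta_pair x y\<close>, which is
  symmetric, only theta functions occur.\<close>

lemma little_mu_eq:
  assumes q: "q = qpow \<tau> 1" and x: "x \<notin> q_ints q" "x \<noteq> 0" and y: "y \<noteq> 0"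
  shows "little_mu \<tau> x y = - (\<i> * qpow \<tau> (-1/8)) / pinf q
      * (y * theta_pair x y / (theta x * theta y))"
proof -
  have "little_mu \<tau> x y = \<i> * qpow \<tau> (-1/8) / (pinf x * pinf q * theta (q * y))
      * (pinf x / theta x * theta_pair x y)"
    unfolding little_mu_def Let_def q[symmetric] q_psi_1_2[OF x] by (simp add: qpochs_inf_def)
  moreover have "pinf x \<noteq> 0" by (rule pinf_nonzero) (rule x)
  ultimately show ?thesis using y by (simp add: theta_q_mult mult_ac)
qed

lemma q_ints_step:
  assumes "x \<notin> q_ints q"
  shows "q * x \<notin> q_ints q" "x / q \<notin> q_ints q"
  using q_ints_mult[OF assms, of 1] q_ints_mult[OF assms, of "-1"]
      by (simp_all add: mult.commute power_int_minus_divide)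

lemma little_mu_contiguous:
  assumes q: "q = qpow \<tau> 1" and x: "x \<notin> q_ints q" "x \<noteq> 0" and y: "y \<noteq> 0"
  shows "little_mu \<tau> x y = little_mu \<tau> (q * x) y - x * y * little_mu \<tau> (x / q) y"
proof -
  define B where "B = - (\<i> * qpow \<tau> (-1/8)) / pinf q"
  have th: "theta (x / q) = - (x / q) * theta x" "theta (q * x) = - theta x / x"
    using theta_eq_theta_div_q[OF x(2)] theta_q_mult[OF x(2)] x(2) by simp_all
  have mu: "little_mu \<tau> (q * x) y = B * (y * theta_pair (q * x) y / (theta (q * x) * theta y))"
    "little_mu \<tau> (x / q) y = B * (y * theta_pair (x / q) y / (theta (x / q) * theta y))"
    unfolding B_def by (rule little_mu_eq[OF q]; use x y q_ints_step[OF x(1)] in simp)+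
  have e: "little_mu \<tau> (q * x) y - x * y * little_mu \<tau> (x / q) y
      = B * (y * (- x * theta_pair (q * x) y + q * y * theta_pair (x / q) y)
          / (theta x * theta y))"
    unfolding mu th using x(2) theta_nonzero[OF x(1)]
    by (cases "theta y = 0") (simp_all add: field_simps)
  show ?thesis unfolding e theta_pair_contiguous[OF x(2) y, symmetric] B_def
      by (rule little_mu_eq) fact+
qed

lemma little_mu_shift:
  assumes q: "q = qpow \<tau> 1" and x: "x \<notin> q_ints q" "x \<noteq> 0" and y: "y \<noteq> 0"
  shows "little_mu \<tau> (x / q) (q * y) = little_mu \<tau> x y"
proof -
  have "theta (x / q) * theta (q * y) = x / (q * y) * (theta x * theta y)"
    using theta_eq_theta_div_q[OF x(2)] theta_q_mult[OF y] x(2) by simp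
  then show ?thesis
    using x y by (simp add: little_mu_eq[OF q] q_ints_step theta_pair_q_shift power2_eq_square)
qed

lemma little_mu_commute:
  assumes q: "q = qpow \<tau> 1" and x: "x \<notin> q_ints q" "x \<noteq> 0" and y: "y \<notin> q_ints q" "y \<noteq> 0"
  shows "little_mu \<tau> x y = little_mu \<tau> y x"
  using theta_pair_commute[OF x(2) y(2)] by (simp add: little_mu_eq[OF q] x y mult.commute)

lemma little_mu_eq_q_psi:
  assumes q: "q = qpow \<tau> 1" and x: "x \<notin> q_ints q" "x \<noteq> 0" and y: "y \<noteq> 0"
  shows "little_mu \<tau> x y = \<i> * qpow \<tau> (-1/8) / (qpochs_inf q [q * y, q] * theta x)
      * q_psi q [] [1 / y, 0] (x / y)"
proof -
  have "\<i> * qpow \<tau> (-1/8) * theta_pair x y / (pinf q * theta x)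
      * (1 / (pinf (q * y) * pinf (1 / y)))
    = \<i> * qpow \<tau> (-1/8) * theta_pair x y / (pinf q * theta x) * (- y / theta y)"
    unfolding inverse_pinf_product[OF y] ..
  then show ?thesis
    unfolding little_mu_eq[OF assms] q_psi_0_2[OF y] qpochs_inf_def by (simp add: mult_ac)
qed

lemma little_mu_eq_very_well_poised:
  assumes q: "q = qpow \<tau> 1" and x: "x \<notin> q_ints q" "x \<noteq> 0" and y: "y \<noteq> 0"
    and th: "theta (x / (y * q)) \<noteq> 0"
  shows "little_mu \<tau> x y =
        \<i> * qpow \<tau> (-1/8) / (qpochs_inf q [x, y * q, q] * theta (x / (y * q)))
        * (\<Sum>\<^sub>\<infinity>n\<in>(UNIV::int set).
             (1 - x / y * q powi (2 * n - 1)) * (qpoch q x n / qpoch q (1 / y) n)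
             * qpow \<tau> (5 / 2 * of_int n * (of_int n - 1)) * (- (x^2 / (y^3 * q))) powi n)"
proof -
  have *: "\<i> * qpow \<tau> (-1/8) * theta_pair x y / (pinf q * theta x)
      * (1 / (pinf (q * y) * pinf (1 / y)))
    = \<i> * qpow \<tau> (-1/8) * theta_pair x y / (pinf q * theta x) * (- y / theta y)"
    unfolding inverse_pinf_product[OF y] ..
  have "pinf x \<noteq> 0" by (rule pinf_nonzero) fact
  with * th show ?thesis
    unfolding little_mu_eq[OF q x y] qpow_eq_powi_tri q[symmetric]
        infsumI[OF very_well_poised_sum[OF x y]] qpochs_inf_def
    by (simp add: mult_ac)
qed

text \<open>In the annulus \<open>\<bar>q\<bar> < \<bar>z\<bar> < 1 / \<bar>q\<bar>\<close> the only integral power of \<open>q\<close> is \<open>1\<close>.\<close>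

lemma not_in_q_ints_near_1: "eventually (\<lambda>z. z \<notin> q_ints q) (at 1)"
proof -
  have "((\<lambda>z::complex. norm z) \<longlongrightarrow> norm (1::complex)) (at 1)"
    by (intro tendsto_intros)
  then have lim: "((\<lambda>z::complex. norm z) \<longlongrightarrow> 1) (at 1)" by simp
  have "eventually (\<lambda>z. norm z > norm q) (at (1::complex))"
    by (rule order_tendstoD(1)[OF lim norm_q])
  moreover have "eventually (\<lambda>z. norm z < 1 / norm q) (at (1::complex))"
    by (rule order_tendstoD(2)[OF lim]) (use norm_q in simp)
  moreover have "eventually (\<lambda>z::complex. z \<noteq> 1) (at 1)"
    by (simp add: eventually_at_filter)
  ultimately show ?thesis
  proof eventually_elim
    case (elim z)
    show ?case
    proof
      assume "z \<in> q_ints q"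
      then obtain n where n: "z = q powi n" by (auto simp: q_ints_def)
      consider "n = 0" | m where "n = int (Suc m)" | m where "n = - int (Suc m)"
        by (metis int_cases not0_implies_Suc of_nat_0)
      then show False
      proof cases
        case 2
        have "norm q ^ Suc m \<le> norm q" using norm_q power_decreasing[of 1 "Suc m" "norm q"]
            by simp
        moreover have "norm z = norm q ^ Suc m" unfolding n 2 power_int_of_nat
            by (rule norm_power)
        ultimately show False using elim by linarith
      next
        case 3
        have "norm q ^ Suc m \<le> norm q" using norm_q power_decreasing[of 1 "Suc m" "norm q"]
            by simp
        then have "1 / norm q \<le> 1 / norm q ^ Suc m" by (intro divide_left_mono) auto
        moreover have "norm z = 1 / norm q ^ Suc m"
          unfolding n 3 power_int_minus_divide power_int_of_nat norm_divide norm_power by simp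
        ultimately show False using elim by linarith
      qed (use elim n in simp)
    qed
  qed
qed

text \<open>The factor \<open>theta z\<close> cancels the pole, so the limit is obtained from the continuity of
  \<open>theta_pair x\<close> at \<open>1\<close>.\<close>

lemma little_mu_limit:
  assumes q: "q = qpow \<tau> 1" and x: "x \<notin> q_ints q" "x \<noteq> 0"
  shows "((\<lambda>z. theta z * little_mu \<tau> x z) \<longlongrightarrow>
         \<i> * qpow \<tau> (-1/8) / theta (q * x) * q_phi q [] [0] (x * q^2)) (at 1)"
proof -
  define C where "C = \<i> * qpow \<tau> (-1/8)"
  have "(theta_pair x \<longlongrightarrow> theta_pair x 1) (at 1)"
    using theta_pair_isCont[OF x(2), of 1] by (simp add: isCont_def)
  then have "((\<lambda>z. - C / pinf q * (z * theta_pair x z / theta x)) \<longlongrightarrow> - C / pinf q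
      * (1 * theta_pair x 1 / theta x)) (at 1)"
    by (intro tendsto_intros) (use theta_nonzero[OF x(1)] in auto)
  also have "- C / pinf q * (1 * theta_pair x 1 / theta x)
      = C / theta (q * x) * q_phi q [] [0] (x * q^2)"
    using x(2) by (simp add: theta_pair_at_1 theta_q_mult)
  finally have "((\<lambda>z. - C / pinf q * (z * theta_pair x z / theta x)) \<longlongrightarrow> C / theta (q * x)
      * q_phi q [] [0] (x * q^2)) (at 1)" .
  moreover have "eventually (\<lambda>z. z \<noteq> 0) (at (1::complex))"
    by (rule eventually_neq_at_within)
  then have "eventually (\<lambda>z. - C / pinf q * (z * theta_pair x z / theta x)
      = theta z * little_mu \<tau> x z) (at 1)"
    using not_in_q_ints_near_1
    by eventually_elim (use theta_nonzero in \<open>auto simp: little_mu_eq[OF q x] C_def\<close>)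
  ultimately show ?thesis unfolding C_def by (rule Lim_transform_eventually)
qed

lemma little_mu_three_term:
  assumes q: "q = qpow \<tau> 1" and x: "x \<notin> q_ints q" "x \<noteq> 0" and y: "y \<notin> q_ints q" "y \<noteq> 0"
    and c1: "c1 \<noteq> 0" "x / c1 \<notin> q_ints q" "y * c1 \<notin> q_ints q"
    and c2: "c2 \<noteq> 0" "x / c2 \<notin> q_ints q" "y * c2 \<notin> q_ints q"
    and th: "theta (c1 * c2 * y / x) \<noteq> 0" "theta (c2 / c1) \<noteq> 0"
  shows "little_mu \<tau> x y =
        theta (x / c1) * theta (c1 * y) * theta (c2 * y / x) * theta c2
          / (theta x * theta y * theta (c1 * c2 * y / x) * theta (c2 / c1))
          * little_mu \<tau> (x / c1) (y * c1)
        + theta (x / c2) * theta (c2 * y) * theta (c1 * y / x) * theta c1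
          / (theta x * theta y * theta (c1 * c2 * y / x) * theta (c1 / c2))
          * little_mu \<tau> (x / c2) (y * c2)"
proof -
  define C where "C = - (\<i> * qpow \<tau> (-1/8)) / pinf q"
  define W where "W x y = y * theta_pair x y" for x y
  define E where "E = theta (c2 / c1) * theta (c1 * c2 * y / x)"
  have mu: "little_mu \<tau> x y = C * (W x y / (theta x * theta y))"
    "little_mu \<tau> (x / c1) (y * c1)
        = C * (W (x / c1) (y * c1) / (theta (x / c1) * theta (y * c1)))"
    "little_mu \<tau> (x / c2) (y * c2)
        = C * (W (x / c2) (y * c2) / (theta (x / c2) * theta (y * c2)))"
    using assms by (simp_all only: little_mu_eq[OF q] C_def W_def divide_eq_0_iff mult_eq_0_iff
        not_False_eq_True simp_thms)
  have E: "E \<noteq> 0" using th by (simp add: E_def)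
  have "W x y * E = W (x / c1) (y * c1) * (theta (c2 * y / x) * theta c2)
      - c2 / c1 * (W (x / c2) (y * c2) * (theta (c1 * y / x) * theta c1))"
    unfolding W_def E_def by (rule theta_pair_three_term) fact+
  then have W: "W x y = W (x / c1) (y * c1) * (theta (c2 * y / x) * theta c2) / E
      - c2 / c1 * (W (x / c2) (y * c2) * (theta (c1 * y / x) * theta c1)) / E"
    using E by (simp add: field_simps)
  have th12: "theta (c1 / c2) = - theta (c2 / c1) * c1 / c2"
    using theta_inverse[of "c2 / c1"] c1 c2 by simp
  have nz: "theta (x / c1) \<noteq> 0" "theta (c1 * y) \<noteq> 0" "theta (x / c2) \<noteq> 0" "theta (c2 * y) \<noteq> 0"
    using c1 c2 by (simp_all add: theta_nonzero mult.commute)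
  have 1: "theta (x / c1) * theta (c1 * y) * theta (c2 * y / x) * theta c2
          / (theta x * theta y * theta (c1 * c2 * y / x) * theta (c2 / c1))
              * little_mu \<tau> (x / c1) (y * c1)
      = C / (theta x * theta y) * (W (x / c1) (y * c1) * (theta (c2 * y / x) * theta c2) / E)"
    unfolding mu E_def unfolding mult.commute[of y c1] using nz by (simp add: mult_ac)
  have 2: "theta (x / c2) * theta (c2 * y) * theta (c1 * y / x) * theta c1
          / (theta x * theta y * theta (c1 * c2 * y / x) * theta (c1 / c2))
              * little_mu \<tau> (x / c2) (y * c2)
      = - (C / (theta x * theta y) *
          (c2 / c1 * (W (x / c2) (y * c2) * (theta (c1 * y / x) * theta c1)) / E))"
    unfolding mu E_def th12 unfolding mult.commute[of y c2] using nz c1 c2 by (simp add: mult_ac)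
  show ?thesis unfolding 1 2 unfolding mu W
      by (simp add: diff_divide_distrib right_diff_distrib mult_ac)
qed

text \<open>The three-term relation with \<open>c1 = c\<close> and \<open>c2 = 1 / y\<close>. The third point is then
  \<open>(x * y, 1)\<close>, where the double theta series reduces to a \<open>\<^sub>0\<phi>\<^sub>1\<close> series.\<close>

lemma little_mu_translation:
  assumes q: "q = qpow \<tau> 1" and x: "x \<notin> q_ints q" "x \<noteq> 0" and y: "y \<notin> q_ints q" "y \<noteq> 0"
    and c: "c \<noteq> 0" "x / c \<notin> q_ints q" "y * c \<notin> q_ints q"
  shows "little_mu \<tau> x y =
        little_mu \<tau> (x / c) (y * c)
        - \<i> * qpow \<tau> (-1/8) * theta c * theta (y * c / x)
          / (theta (x * q) * theta (y * q) * theta (c / x) * theta (y * c))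
          * q_phi q [] [0] (x * y * q^2)"
proof -
  define C where "C = \<i> * qpow \<tau> (-1/8)"
  define W where "W x y = y * theta_pair x y" for x y
  define P where "P = q_phi q [] [0] (x * y * q^2)"
  have mu: "little_mu \<tau> x y = - C / pinf q * (W x y / (theta x * theta y))"
    "little_mu \<tau> (x / c) (y * c) = - C / pinf q
        * (W (x / c) (y * c) / (theta (x / c) * theta (y * c)))"
    using assms by (simp_all only: little_mu_eq[OF q] C_def W_def divide_eq_0_iff mult_eq_0_iff
        not_False_eq_True simp_thms)
  have nz: "theta x \<noteq> 0" "theta y \<noteq> 0" "theta (x / c) \<noteq> 0" "theta (y * c) \<noteq> 0"
    by (intro theta_nonzero x y c)+
  have thc: "theta (c / x) = - theta (x / c) * c / x"
    using theta_inverse[of "x / c"] c x by simp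
  have th1: "theta (1 / (y * c)) = - theta (y * c) / (y * c)" "theta (1 / x)
      = - theta x / x" "theta (1 / y) = - theta y / y"
    by (rule theta_inverse, use x y c in simp)+
  have thq: "theta (x * q) = - theta x / x" "theta (y * q) = - theta y / y"
    using theta_q_mult[of x] theta_q_mult[of y] x y by (simp_all add: mult.commute)
  have "y * theta_pair x y * (theta (1 / y / c) * theta (c * (1 / y) * y / x))
    = (y * c) * theta_pair (x / c) (y * c) * (theta (1 / y * y / x) * theta (1 / y))
      - 1 / y / c * ((y * (1 / y)) * theta_pair (x / (1 / y)) (y * (1 / y))
          * (theta (c * y / x) * theta c))"
    by (rule theta_pair_three_term) (use x y c in auto)
  then have "W x y * (theta (1 / (y * c)) * theta (c / x))
    = W (x / c) (y * c) * (theta (1 / x) * theta (1 / y)) - 1 / (y * c)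
        * (theta_pair (x * y) 1 * (theta (y * c / x) * theta c))"
    using y by (simp add: W_def mult_ac)
  also have "theta_pair (x * y) 1 = x * y * pinf q * P"
    using theta_pair_at_1[of "x * y"] x y by (simp add: P_def)
  finally have "W x y * (theta (y * c) * theta (x / c) / (x * y))
      = W (x / c) (y * c) * (theta x * theta y / (x * y)) - x / c
          * (pinf q * P * (theta (y * c / x) * theta c))"
    unfolding th1 thc using x y c by (simp add: mult_ac)
  then have W: "W x y * (theta (y * c) * theta (x / c))
      = W (x / c) (y * c) * (theta x * theta y) - x * y
          * (x / c * (pinf q * P * (theta (y * c / x) * theta c)))"
    using x y by (simp add: field_simps)
  have "W x y / (theta x * theta y) = W (x / c) (y * c) / (theta (x / c) * theta (y * c))
      - x * y * (x / c * (pinf q * P * (theta (y * c / x) * theta c)))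
          / (theta x * theta y * (theta (x / c) * theta (y * c)))"
  proof -
    have "W x y / (theta x * theta y)
        = W x y * (theta (y * c) * theta (x / c))
        / (theta x * theta y * (theta (x / c) * theta (y * c)))"
      using nz by simp
    also have "\<dots> = W (x / c) (y * c) / (theta (x / c) * theta (y * c))
      - x * y * (x / c * (pinf q * P * (theta (y * c / x) * theta c)))
          / (theta x * theta y * (theta (x / c) * theta (y * c)))"
      unfolding W diff_divide_distrib using nz by simp
    finally show ?thesis .
  qed
  then have "little_mu \<tau> x y = little_mu \<tau> (x / c) (y * c)
    + C / pinf q * (x * y * (x / c * (pinf q * P * (theta (y * c / x) * theta c)))
        / (theta x * theta y * (theta (x / c) * theta (y * c))))"
    unfolding mu by (simp add: right_diff_distrib)
  also have "C / pinf q * (x * y * (x / c * (pinf q * P * (theta (y * c / x) * theta c)))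
      / (theta x * theta y * (theta (x / c) * theta (y * c))))
    = - (C * theta c * theta (y * c / x)
        / (theta (x * q) * theta (y * q) * theta (c / x) * theta (y * c)) * P)"
    unfolding thq thc using x y c by (simp add: mult_ac)
  finally show ?thesis by (simp add: C_def P_def)
qed

text \<open>The contiguous relation at \<open>x * q powi (n - 2)\<close> is the Fibonacci recurrence for
  \<open>n \<mapsto> little_mu (x * q powi (n - 1)) y\<close>. A solution is determined by its values at \<open>0\<close> and \<open>1\<close>.\<close>

lemma little_mu_fibonacci:
  assumes q: "q = qpow \<tau> 1" and x: "x \<notin> q_ints q" "x \<noteq> 0" and y: "y \<noteq> 0"
  shows "little_mu \<tau> (x * q powi (n - 1)) y =
        little_mu \<tau> (x * q powi (-1)) y * fib_T (n - 1) (x * y) q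
        + little_mu \<tau> x y * fib_S n (x * y) q"
proof -
  define t where "t = x * y"
  have t: "t \<noteq> 0" using x y by (simp add: t_def)
  define G where "G n = little_mu \<tau> (x * q powi (n - 1)) y" for n
  define H where "H n = G 0 * fib_T (n - 1) t q + G 1 * fib_S n t q" for n
  have S: "qt_fib_rec t q (\<lambda>n. fib_S n t q)" "fib_S 0 t q = 0" "fib_S 1 t q = 1"
    using theI'[OF fib_S_ex1[OF t q_nonzero]] by (simp_all add: fib_S_def[abs_def])
  have T: "qt_fib_rec t q (\<lambda>n. fib_T (n - 1) t q)" "fib_T (-1) t q = 1" "fib_T 0 t q = 0"
    using theI'[OF fib_T_ex1[OF t q_nonzero]] by (simp_all add: fib_T_def[abs_def])
  have "G = H"
  proof (rule qt_fib_unique[OF t q_nonzero])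
    show "qt_fib_rec t q G"
      unfolding qt_fib_rec_def
    proof
      fix n
      have "little_mu \<tau> (x * q powi (n - 2)) y = little_mu \<tau> (q * (x * q powi (n - 2))) y
          - x * q powi (n - 2) * y * little_mu \<tau> (x * q powi (n - 2) / q) y"
        using x y by (intro little_mu_contiguous q q_ints_mult) auto
      moreover have "q * (x * q powi (n - 2)) = x * q powi (n - 1)" "x * q powi (n - 2) / q
          = x * q powi (n - 3)"
        by (simp_all add: power_int_diff field_simps power2_eq_square power3_eq_cube)
      ultimately show "G n = G (n - 1) + t * q powi (n - 2) * G (n - 2)"
        by (simp add: G_def t_def mult_ac)
    qed
    show "qt_fib_rec t q H"
      unfolding qt_fib_rec_def
    proof
      fix n
      have S_n: "fib_S n t q = fib_S (n - 1) t q + t * q powi (n - 2) * fib_S (n - 2) t q"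
        using S(1) unfolding qt_fib_rec_def by blast
      have T_n: "fib_T (n - 1) t q = fib_T (n - 1 - 1) t q + t * q powi (n - 2)
          * fib_T (n - 2 - 1) t q"
        using T(1) unfolding qt_fib_rec_def by blast
      show "H n = H (n - 1) + t * q powi (n - 2) * H (n - 2)"
        unfolding H_def S_n T_n by (simp only: distrib_left distrib_right mult_ac add_ac)
    qed
    show "G 0 = G 0" "G 1 = G 1" by simp_all
    show "H 0 = G 0" "H 1 = G 1" using S T by (simp_all add: H_def)
  qed
  then have "G n = H n" by simp
  then show ?thesis by (simp add: G_def H_def t_def)
qed

end

lemma nome_qpow: "Im \<tau> > 0 \<Longrightarrow> nome (qpow \<tau> 1)"
  by unfold_locales (simp_all add: qpow_def)

theorem theorem2:
  fixes \<tau> q x y :: complex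
  assumes "Im \<tau> > 0" and "q = qpow \<tau> 1"
    and "x \<noteq> 0" and "y \<noteq> 0" and "x \<notin> q_ints q" and "y \<notin> q_ints q"
  shows
    "(little_mu \<tau> x y = little_mu \<tau> (q * x) y - x * y * little_mu \<tau> (x / q) y)
   \<and> (little_mu \<tau> x y = little_mu \<tau> (x / q) (q * y) \<and>
      little_mu \<tau> (x / q) (q * y) = little_mu \<tau> y x)
   \<and> (qtheta q x \<noteq> 0 \<longrightarrow>
      little_mu \<tau> x y =
        \<i> * qpow \<tau> (-1/8) / (qpochs_inf q [q * y, q] * qtheta q x)
        * q_psi q [] [1 / y, 0] (x / y))
   \<and> (qtheta q (x / (y * q)) \<noteq> 0 \<longrightarrow>
      little_mu \<tau> x y =
        \<i> * qpow \<tau> (-1/8) / (qpochs_inf q [x, y * q, q] * qtheta q (x / (y * q)))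
        * (\<Sum>\<^sub>\<infinity>n\<in>(UNIV::int set).
             (1 - x / y * q powi (2 * n - 1)) * (qpoch q x n / qpoch q (1 / y) n)
             * qpow \<tau> (5 / 2 * of_int n * (of_int n - 1)) * (- (x^2 / (y^3 * q))) powi n))
   \<and> (qtheta q (q * x) \<noteq> 0 \<longrightarrow>
      ((\<lambda>z. qtheta q z * little_mu \<tau> x z) \<longlongrightarrow>
         \<i> * qpow \<tau> (-1/8) / qtheta q (q * x) * q_phi q [] [0] (x * q^2)) (at 1))
   \<and> (\<forall>c1 c2.
      c1 \<noteq> 0 \<and> c2 \<noteq> 0 \<and> x / c1 \<notin> q_ints q \<and> y * c1 \<notin> q_ints q \<and>
      x / c2 \<notin> q_ints q \<and> y * c2 \<notin> q_ints q \<and>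
      qtheta q x \<noteq> 0 \<and> qtheta q y \<noteq> 0 \<and> qtheta q (c1 * c2 * y / x) \<noteq> 0 \<and>
      qtheta q (c2 / c1) \<noteq> 0 \<and> qtheta q (c1 / c2) \<noteq> 0 \<longrightarrow>
      little_mu \<tau> x y =
        qtheta q (x / c1) * qtheta q (c1 * y) * qtheta q (c2 * y / x) * qtheta q c2
          / (qtheta q x * qtheta q y * qtheta q (c1 * c2 * y / x) * qtheta q (c2 / c1))
          * little_mu \<tau> (x / c1) (y * c1)
        + qtheta q (x / c2) * qtheta q (c2 * y) * qtheta q (c1 * y / x) * qtheta q c1
          / (qtheta q x * qtheta q y * qtheta q (c1 * c2 * y / x) * qtheta q (c1 / c2))
          * little_mu \<tau> (x / c2) (y * c2))
   \<and> (\<forall>c.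
      c \<noteq> 0 \<and> x / c \<notin> q_ints q \<and> y * c \<notin> q_ints q \<and>
      qtheta q (x * q) \<noteq> 0 \<and> qtheta q (y * q) \<noteq> 0 \<and> qtheta q (c / x) \<noteq> 0 \<and>
      qtheta q (y * c) \<noteq> 0 \<longrightarrow>
      little_mu \<tau> x y =
        little_mu \<tau> (x / c) (y * c)
        - \<i> * qpow \<tau> (-1/8) * qtheta q c * qtheta q (y * c / x)
          / (qtheta q (x * q) * qtheta q (y * q) * qtheta q (c / x) * qtheta q (y * c))
          * q_phi q [] [0] (x * y * q^2))
   \<and> (\<forall>n::int.
      little_mu \<tau> (x * q powi (n - 1)) y =
        little_mu \<tau> (x * q powi (-1)) y * fib_T (n - 1) (x * y) q
        + little_mu \<tau> x y * fib_S n (x * y) q)"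
proof -
  interpret nome q unfolding assms(2) by (rule nome_qpow) (rule assms(1))
  note q = assms(2) and x = assms(5,3) and y = assms(6,4)
  show ?thesis
  proof (intro conjI allI impI, goal_cases)
    case 1
    show ?case by (rule little_mu_contiguous[OF q x y(2)])
  next
    case 2
    show ?case by (rule little_mu_shift[OF q x y(2), symmetric])
  next
    case 3
    show ?case unfolding little_mu_shift[OF q x y(2)] by (rule little_mu_commute[OF q x y])
  next
    case 4
    show ?case by (rule little_mu_eq_q_psi[OF q x y(2)])
  next
    case 5
    then show ?case by (rule little_mu_eq_very_well_poised[OF q x y(2)])
  next
    case 6
    show ?case by (rule little_mu_limit[OF q x])
  next
    case (7 c1 c2)
    then show ?case by (intro little_mu_three_term[OF q x y]) blast+
  next
    case (8 c)
    then show ?case by (intro little_mu_translation[OF q x y]) blast+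
  next
    case (9 n)
    show ?case by (rule little_mu_fibonacci[OF q x y(2)])
  qed
qed

end
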